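(* Let $d\ge 2$ and $0<\varepsilon<1$. There exists $c_d(\varepsilon)>0$ such that for any (deterministic) sequence $(A_n)_{n\in\mathbb N}$ of real $d\times d$ matrices with $\|A_n\|\le 1$ for all $n$, and for each $1\le j\le d-1$, the random variable $$\liminf_{n\to\infty}\frac 1n\log\frac{s_j(A_\varepsilon^{(n)})}{s_{j+1}(A_\varepsilon^{(n)})}$$ is almost surely constant, and the constant is at least $c_d(\varepsilon)$.
   Context: $\|M\|$ is the operator norm of a matrix $M$ induced by the Euclidean norm, and $s_1(M)\ge\dots\ge s_d(M)$ are the singular values of a $d\times d$ matrix $M$. $(\Xi_n)_{n\in\mathbb N}$ is a sequence of independent random $d\times d$ matrices, each with mutually independent entries uniformly distributed on $[-1,1]$. Given a fixed sequence $(A_n)$, set $A_{n,\varepsilon}=A_n+\varepsilon\Xi_n$ and $A_\varepsilon^{(n)}=A_{n,\varepsilon}A_{n-1,\varepsilon}\cdots A_{1,\varepsilon}$. "Almost surely" refers to the randomness of $(\Xi_n)$. *)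

theory Defs
  imports "HOL-Probability.Probability" "HOL-Computational_Algebra.Polynomial"
begin

definition charpoly :: "real^'d^'d \<Rightarrow> real poly" where
  "charpoly M = det (\<chi> i j. (if i = j then [:0, 1:] else 0) - [:M $ i $ j:])"

text \<open>
  The singular values are the square roots of the eigenvalues of \<open>M\<^sup>T M\<close>, repeated according to
  multiplicity and listed in decreasing order. As \<open>M\<^sup>T M\<close> is symmetric positive semidefinite, its
  characteristic polynomial splits over the reals with nonnegative roots, so there are
  \<open>CARD('d)\<close> of them.
\<close>

definition singular_values :: "real^'d^'d \<Rightarrow> real list" where
  "singular_values M =
     rev (sorted_list_of_multiset (image_mset sqrt (proots (charpoly (transpose M ** M)))))"

text \<open>Indexed from 1: meaningful for \<open>1 \<le> j \<le> CARD('d)\<close>.\<close>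

definition singular_value :: "nat \<Rightarrow> real^'d^'d \<Rightarrow> real" where
  "singular_value j M = singular_values M ! (j - 1)"

text \<open>Index 0 of a sequence of matrices is never used: sequences are indexed by \<open>n \<ge> 1\<close>.\<close>

primrec matrix_product :: "(nat \<Rightarrow> real^'d^'d) \<Rightarrow> nat \<Rightarrow> real^'d^'d" where
  "matrix_product B 0 = mat 1"
| "matrix_product B (Suc n) = B (Suc n) ** matrix_product B n"

definition perturbed_product ::
    "(nat \<Rightarrow> real^'d^'d) \<Rightarrow> real \<Rightarrow> (nat \<Rightarrow> real^'d^'d) \<Rightarrow> nat \<Rightarrow> real^'d^'d" where
  "perturbed_product A \<epsilon> X n = matrix_product (\<lambda>k. A k + \<epsilon> *\<^sub>R X k) n"

definition iid_uniform_matrices :: "'w measure \<Rightarrow> (nat \<Rightarrow> 'w \<Rightarrow> real^'d^'d) \<Rightarrow> bool" where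
  "iid_uniform_matrices P \<Xi> \<longleftrightarrow>
     prob_space P \<and>
     prob_space.indep_vars P (\<lambda>_. borel) \<Xi> {1..} \<and>
     (\<forall>n\<ge>1. prob_space.indep_vars P (\<lambda>_. borel) (\<lambda>(i, j) \<omega>. \<Xi> n \<omega> $ i $ j) UNIV \<and>
       (\<forall>i j. distr P borel (\<lambda>\<omega>. \<Xi> n \<omega> $ i $ j) = uniform_measure lborel {-1..1}))"

end

theory Submission
  imports Defs
begin

text \<open>
  Fix a partial flag \<open>V\<^sub>j\<^sub>-\<^sub>1 \<subseteq> V\<^sub>j\<^sub>+\<^sub>1\<close>. The subspaces between the two form a projective line, on which a
  matrix acts with Jacobian \<open>G\<^sub>j\<^sub>-\<^sub>1 G\<^sub>j\<^sub>+\<^sub>1 / G\<^sub>j\<^sup>2\<close>, where \<open>G\<^sub>i\<close> is the volume growth on the \<open>i\<close>-dimensional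
  member of the flag; for a flag in general position this is comparable to \<open>s\<^sub>j\<^sub>+\<^sub>1 / s\<^sub>j\<close>. Weighted with
  the square root of the Jacobian the action on \<open>L\<^sup>2\<close> of the fibre is isometric, and averaging over one
  noise step contracts it by a fixed factor: the law of \<open>A + \<epsilon> \<Xi>\<close> dominates a multiple of a law of the
  form \<open>M S\<close>, with \<open>S\<close> drawn independently of \<open>M\<close> from four elements of \<open>SL\<^sub>2\<close> acting on the fibre, and
  the average over these four is a strict contraction by Schur's test with the rotation invariant
  weight. Hence the mean of \<open>sqrt (s\<^sub>j\<^sub>+\<^sub>1 / s\<^sub>j)\<close> decays exponentially, at a rate that depends only on
  the dimension and \<open>\<epsilon>\<close>, and the Borel--Cantelli lemma gives the lower bound. The \<open>liminf\<close> does not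
  change when finitely many factors are modified, so it is constant by Kolmogorov's law.
\<close>

section \<open>Invariance of Lebesgue measure\<close>

text \<open>The matrices \<open>A n\<close> are arbitrary, so there is no stationary measure to work
  with: every estimate must hold for a single step, uniformly in \<open>A n\<close> and in the
  current frame. Therefore masses are bounded by suprema over all frames, and no construction
  inverts a frame; degenerate frames receive the value 0. The domination of the noise law rests on
  the identity (A + \<epsilon> X) S = A + \<epsilon> X': a right factor S near the identity, chosen
  according to the current frame, is absorbed by an affine change of the noise. The bound on
  \<open>A n\<close> decides how near S has to be. Four elements are taken because a single
  hyperbolic element with its inverse fails the pointwise inequality in Schur's test on its own
  axis; a second pair, with axes turned by 45 degrees, compensates. The remaining obstacle is
  general position: the flag adapted to the product is random, while the decay of the mean is known
  for a fixed flag only. A finite net of frames, one of which is within 1/2 of any given orthogonal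
  matrix, settles this at the price of a constant factor.\<close>

lemma nn_integral_lborel_translate:
  fixes f :: "'a::euclidean_space \<Rightarrow> ennreal"
  assumes [measurable]: "f \<in> borel_measurable borel"
  shows "(\<integral>\<^sup>+x. f (c + x) \<partial>lborel) = (\<integral>\<^sup>+x. f x \<partial>lborel)"
proof -
  have "(\<integral>\<^sup>+x. f x \<partial>lborel) = (\<integral>\<^sup>+x. f x \<partial>distr lborel borel ((+) c))"
    by (simp add: lborel_distr_plus)
  then show ?thesis by (simp add: nn_integral_distr)
qed

lemma nn_integral_lborel_reflect:
  fixes f :: "'a::euclidean_space \<Rightarrow> ennreal"
  assumes [measurable]: "f \<in> borel_measurable borel"
  shows "(\<integral>\<^sup>+x. f (- x) \<partial>lborel) = (\<integral>\<^sup>+x. f x \<partial>lborel)"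
proof -
  have "(\<Sum>j\<in>Basis. (- 1 * (x \<bullet> j)) *\<^sub>R j) = - x" for x :: 'a
    by (simp add: sum_negf euclidean_representation)
  then have "lborel = (density (distr lborel borel uminus) (\<lambda>_. 1) :: 'a measure)"
    using lborel_affine_euclidean[of "\<lambda>_. - 1" 0]
    by (simp add: sum_negf euclidean_representation)
  then have "(\<integral>\<^sup>+x. f x \<partial>lborel) = (\<integral>\<^sup>+x. f x \<partial>distr lborel borel uminus)"
    by (simp add: density_1)
  then show ?thesis by (simp add: nn_integral_distr)
qed

text \<open>Uniqueness of Haar measure by Tonelli: integrate \<open>f (y) g (T x + y)\<close> over \<open>x\<close> and \<open>y\<close> in
  both orders.\<close>

lemma nn_integral_lborel_affine_tonelli:
  fixes f g :: "'a::euclidean_space \<Rightarrow> ennreal" and T :: "'a \<Rightarrow> 'a"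
  assumes f[measurable]: "f \<in> borel_measurable borel" and g[measurable]: "g \<in> borel_measurable borel"
    and T[measurable]: "T \<in> borel_measurable borel"
    and equi: "\<And>u. \<exists>v. \<forall>x. T x + u = T (x + v)"
  shows "(\<integral>\<^sup>+x. f (T x) \<partial>lborel) * (\<integral>\<^sup>+x. g x \<partial>lborel) =
    (\<integral>\<^sup>+x. g (T x) \<partial>lborel) * (\<integral>\<^sup>+x. f x \<partial>lborel)"
proof -
  \<comment> \<open>The image of Lebesgue measure under \<open>T\<close> is translation invariant:
    by \<open>equi\<close> a shift of the value is a shift of the argument.\<close>
  have inv: "(\<integral>\<^sup>+x. h (T x + u) \<partial>lborel) = (\<integral>\<^sup>+x. h (T x) \<partial>lborel)"
    if [measurable]: "h \<in> borel_measurable borel" for h :: "'a \<Rightarrow> ennreal" and u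
  proof -
    obtain v where "\<forall>x. T x + u = T (x + v)" using equi by blast
    then have "(\<integral>\<^sup>+x. h (T x + u) \<partial>lborel) = (\<integral>\<^sup>+x. h (T (v + x)) \<partial>lborel)"
      by (simp add: add.commute)
    also have "\<dots> = (\<integral>\<^sup>+x. h (T x) \<partial>lborel)"
      by (rule nn_integral_lborel_translate[where f = "\<lambda>x. h (T x)"]) measurable
    finally show ?thesis .
  qed
  have "(\<integral>\<^sup>+x. f (T x) \<partial>lborel) * (\<integral>\<^sup>+x. g x \<partial>lborel)
      = (\<integral>\<^sup>+x. f (T x) * (\<integral>\<^sup>+y. g y \<partial>lborel) \<partial>lborel)"
    by (simp add: nn_integral_multc)
  also have "\<dots> = (\<integral>\<^sup>+x. (\<integral>\<^sup>+y. f (T x) * g (T x + y) \<partial>lborel) \<partial>lborel)"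
    by (simp add: nn_integral_cmult nn_integral_lborel_translate)
  also have "\<dots> = (\<integral>\<^sup>+y. (\<integral>\<^sup>+x. f (T x) * g (T x + y) \<partial>lborel) \<partial>lborel)"
    by (rule lborel_pair.Fubini') measurable
  also have "\<dots> = (\<integral>\<^sup>+y. (\<integral>\<^sup>+x. f (T x - y) * g (T x) \<partial>lborel) \<partial>lborel)"
  proof (rule nn_integral_cong)
    fix y :: 'a
    show "(\<integral>\<^sup>+x. f (T x) * g (T x + y) \<partial>lborel) = (\<integral>\<^sup>+x. f (T x - y) * g (T x) \<partial>lborel)"
      using inv[of "\<lambda>z. f (z - y) * g z" y] by simp
  qed
  also have "\<dots> = (\<integral>\<^sup>+x. (\<integral>\<^sup>+y. f (T x - y) * g (T x) \<partial>lborel) \<partial>lborel)"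
    by (rule lborel_pair.Fubini') measurable
  also have "\<dots> = (\<integral>\<^sup>+x. (\<integral>\<^sup>+y. f y \<partial>lborel) * g (T x) \<partial>lborel)"
  proof (rule nn_integral_cong)
    fix x :: 'a
    have "(\<integral>\<^sup>+y. f (T x - y) \<partial>lborel) = (\<integral>\<^sup>+y. f y \<partial>lborel)"
      using nn_integral_lborel_reflect[of "\<lambda>y. f (T x + y)"] nn_integral_lborel_translate[of f "T x"] by simp
    then show "(\<integral>\<^sup>+y. f (T x - y) * g (T x) \<partial>lborel) = (\<integral>\<^sup>+y. f y \<partial>lborel) * g (T x)"
      by (simp add: nn_integral_multc)
  qed
  also have "\<dots> = (\<integral>\<^sup>+x. g (T x) \<partial>lborel) * (\<integral>\<^sup>+x. f x \<partial>lborel)"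
    by (simp add: nn_integral_cmult mult.commute)
  finally show ?thesis .
qed

text \<open>The map \<open>- 1 / u\<close> is increasing on each half-line, has derivative
  \<open>1 / u^2\<close> and exchanges the two half-lines. The substitution rule is for compact
  intervals, so each half-line is exhausted by the intervals \<open>P n\<close> or
  \<open>Q n\<close>, which avoid 0.\<close>

lemma nn_integral_inversion_half:
  fixes E :: "real set"
  assumes [measurable]: "E \<in> sets borel"
  shows "(\<integral>\<^sup>+u. indicator E (- 1 / u) * ennreal (1 / u\<^sup>2) * indicator {0<..} u \<partial>lborel) =
      emeasure lborel (E \<inter> {..<0})" (is ?A)
    and "(\<integral>\<^sup>+u. indicator E (- 1 / u) * ennreal (1 / u\<^sup>2) * indicator {..<0} u \<partial>lborel) =
      emeasure lborel (E \<inter> {0<..})" (is ?B)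
proof -
  have sub: "(\<integral>\<^sup>+u. ennreal (indicator E u) * indicator {- 1 / a..- 1 / b} u \<partial>lborel) =
      (\<integral>\<^sup>+u. ennreal (indicator E (- 1 / u) * (1 / u\<^sup>2)) * indicator {a..b} u \<partial>lborel)"
    if ab: "a \<le> b" "0 \<notin> {a..b}" for a b :: real
  proof -
    have *: "(\<integral>\<^sup>+x. ennreal (indicat_real E x * indicat_real {- 1 / a..- 1 / b} x) \<partial>lborel) =
        (\<integral>\<^sup>+x. ennreal (indicat_real E (- 1 / x) * (1 / x\<^sup>2) * indicat_real {a..b} x) \<partial>lborel)"
    proof (rule nn_integral_substitution)
      show "set_borel_measurable borel {- 1 / a..- 1 / b} (indicat_real E)"
        unfolding set_borel_measurable_def by measurable
      show "((\<lambda>x. - 1 / x) has_real_derivative 1 / x\<^sup>2) (at x)" if "x \<in> {a..b}" for x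
        using that ab by (auto intro!: derivative_eq_intros simp: power2_eq_square)
      show "continuous_on {a..b} (\<lambda>x. 1 / x\<^sup>2)"
        using ab by (intro continuous_intros) auto
    qed (use ab in auto)
    have e1: "ennreal (indicat_real E x * indicat_real F x) = ennreal (indicat_real E x) * indicator F x" for x F
      by (simp split: split_indicator)
    have e2: "ennreal (indicat_real E (- 1 / x) * (1 / x\<^sup>2) * indicat_real F x)
       = ennreal (indicat_real E (- 1 / x) * (1 / x\<^sup>2)) * indicator F x" for x F
      by (simp split: split_indicator)
    from * show ?thesis unfolding e1 e2 .
  qed
  have ind: "ennreal (indicat_real E x * c) = indicator E x * ennreal c"
     "ennreal (indicat_real E x) = indicator E x" for x c
    by (auto split: split_indicator)
  have le: "1 / real (Suc n) \<le> real (Suc n)" for n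
    by (rule order_trans[of _ 1]) auto
  have neg: "- 1 / - real (Suc n) = 1 / real (Suc n)" "- 1 / - (1 / real (Suc n)) = real (Suc n)" for n
    by (simp_all del: of_nat_Suc)
  have lim: "(\<integral>\<^sup>+u. h u * indicator (\<Union>n. F n) u \<partial>lborel) = (SUP n. \<integral>\<^sup>+u. h u * indicator (F n) u \<partial>lborel)"
    if [measurable]: "h \<in> borel_measurable borel" "\<And>n. F n \<in> sets borel" and F: "incseq F"
    for h :: "real \<Rightarrow> ennreal" and F :: "nat \<Rightarrow> real set"
  proof -
    have "emeasure (density lborel h) (\<Union>n. F n) = (SUP n. emeasure (density lborel h) (F n))"
      by (intro SUP_emeasure_incseq[symmetric]) (use F in auto)
    then show ?thesis by (simp add: emeasure_density)
  qed
  define P where "P n = {1 / real (Suc n)..real (Suc n)}" for n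
  define Q where "Q n = {- real (Suc n)..- (1 / real (Suc n))}" for n
  have [measurable]: "P n \<in> sets borel" "Q n \<in> sets borel" for n by (auto simp: P_def Q_def)
  have iP: "incseq P" "incseq Q"
    unfolding P_def Q_def by (auto simp: incseq_def frac_le intro: order_trans[rotated])
  have UP: "(\<Union>n. P n) = {0<..}"
  proof (safe; simp)
    show "0 < x" if "x \<in> P n" for x n using that by (auto simp: P_def intro: less_le_trans[rotated])
    show "\<exists>n. x \<in> P n" if "0 < x" for x
    proof -
      obtain n where "max x (1 / x) < real n" using reals_Archimedean2 by blast
      then show ?thesis using that by (intro exI[of _ n]) (auto simp: P_def field_simps)
    qed
  qed
  have UQ: "(\<Union>n. Q n) = {..<0}"
  proof (safe; simp)
    show "x < 0" if "x \<in> Q n" for x n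
    proof -
      have "x \<le> - (1 / real (Suc n))" using that by (auto simp: Q_def)
      also have "\<dots> < 0" by simp
      finally show ?thesis .
    qed
    show "\<exists>n. x \<in> Q n" if "x < 0" for x
    proof -
      obtain n where "max (- x) (- 1 / x) < real n" using reals_Archimedean2 by blast
      then show ?thesis using that by (intro exI[of _ n]) (auto simp: Q_def field_simps)
    qed
  qed
  have sP: "(\<integral>\<^sup>+u. indicator E (- 1 / u) * ennreal (1 / u\<^sup>2) * indicator (P n) u \<partial>lborel) =
     (\<integral>\<^sup>+u. indicator E u * indicator (Q n) u \<partial>lborel)" for n
    using sub[of "1 / real (Suc n)" "real (Suc n)", OF le] unfolding ind P_def Q_def by simp
  have sQ: "(\<integral>\<^sup>+u. indicator E (- 1 / u) * ennreal (1 / u\<^sup>2) * indicator (Q n) u \<partial>lborel) =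
     (\<integral>\<^sup>+u. indicator E u * indicator (P n) u \<partial>lborel)" for n
    using sub[of "- real (Suc n)" "- (1 / real (Suc n))", OF le[THEN le_imp_neg_le]]
    unfolding ind P_def Q_def neg by simp
  have em: "(\<integral>\<^sup>+u. indicator E u * indicator F u \<partial>lborel) = emeasure lborel (E \<inter> F)"
    if [measurable]: "F \<in> sets borel" for F :: "real set"
    by (simp add: indicator_inter_arith[symmetric])
  show ?A
    using lim[of "\<lambda>u. indicator E (- 1 / u) * ennreal (1 / u\<^sup>2)" P] lim[of "indicator E" Q]
    by (simp add: iP sP[simplified] UP UQ em)
  show ?B
    using lim[of "\<lambda>u. indicator E (- 1 / u) * ennreal (1 / u\<^sup>2)" Q] lim[of "indicator E" P]
    by (simp add: iP sQ[simplified] UP UQ em)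
qed

lemma nn_integral_inversion:
  fixes f :: "real \<Rightarrow> ennreal"
  assumes [measurable]: "f \<in> borel_measurable borel"
  shows "(\<integral>\<^sup>+u. f (- 1 / u) * ennreal (1 / u\<^sup>2) \<partial>lborel) = (\<integral>\<^sup>+u. f u \<partial>lborel)"
proof -
  let ?M = "distr (density lborel (\<lambda>u. ennreal (1 / u\<^sup>2))) borel (\<lambda>u. - 1 / u) :: real measure"
  have "?M = lborel"
  proof (rule measure_eqI)
    fix E assume "E \<in> sets ?M"
    then have [measurable]: "E \<in> sets borel" by simp
    have "emeasure ?M E = (\<integral>\<^sup>+u. indicator E (- 1 / u) * ennreal (1 / u\<^sup>2) \<partial>lborel)"
      by (simp add: emeasure_distr emeasure_density indicator_vimage[symmetric] vimage_def indicator_def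
            mult.commute)
    also have "\<dots> = (\<integral>\<^sup>+u. indicator E (- 1 / u) * ennreal (1 / u\<^sup>2) * indicator {0<..} u +
        indicator E (- 1 / u) * ennreal (1 / u\<^sup>2) * indicator {..<0} u \<partial>lborel)"
      by (intro nn_integral_cong) (auto split: split_indicator)
    also have "\<dots> = emeasure lborel (E \<inter> {..<0}) + emeasure lborel (E \<inter> {0<..})"
      by (subst nn_integral_add) (simp_all add: nn_integral_inversion_half[simplified])
    also have "\<dots> = emeasure lborel ((E \<inter> {..<0}) \<union> (E \<inter> {0<..}))"
      by (intro plus_emeasure) auto
    also have "\<dots> = emeasure lborel E"
    proof (rule emeasure_eq_AE)
      have "AE x in lborel. x \<noteq> (0::real)" by (rule AE_lborel_singleton)
      then show "AE x in lborel. (x \<in> (E \<inter> {..<0}) \<union> (E \<inter> {0<..})) = (x \<in> E)"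
        by eventually_elim auto
    qed auto
    finally show "emeasure ?M E = emeasure lborel E" .
  qed simp
  then have "(\<integral>\<^sup>+u. f u \<partial>lborel) = (\<integral>\<^sup>+u. f u \<partial>?M)" by simp
  then show ?thesis by (simp add: nn_integral_distr nn_integral_density mult.commute)
qed

text \<open>For \<open>c \<noteq> 0\<close> and determinant 1 the map equals
  \<open>d / c - 1 / (c * (a + c * t))\<close>, an inversion between two affine maps, and its
  derivative is the weight. At the pole the weight is 0, because division by 0 gives 0.\<close>

lemma nn_integral_moebius:
  fixes f :: "real \<Rightarrow> ennreal" and a b c d :: real
  assumes [measurable]: "f \<in> borel_measurable borel" and det: "a * d - b * c = 1"
  shows "(\<integral>\<^sup>+t. f ((b + d * t) / (a + c * t)) * ennreal (1 / (a + c * t)\<^sup>2) \<partial>lborel) = (\<integral>\<^sup>+t. f t \<partial>lborel)"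
proof (cases "c = 0")
  case True
  then have ad: "d = 1 / a" "a \<noteq> 0" using det by (auto simp: eq_divide_eq mult.commute)
  have "(\<integral>\<^sup>+t. f t \<partial>lborel) = ennreal \<bar>1 / a\<^sup>2\<bar> * (\<integral>\<^sup>+t. f (b / a + (1 / a\<^sup>2) * t) \<partial>lborel)"
    by (rule nn_integral_real_affine) (use ad in auto)
  also have "\<dots> = (\<integral>\<^sup>+t. f ((b + d * t) / (a + c * t)) * ennreal (1 / (a + c * t)\<^sup>2) \<partial>lborel)"
    using True ad by (simp add: nn_integral_multc add_divide_distrib power2_eq_square mult.commute[of "ennreal _"])
  finally show ?thesis ..
next
  case False
  have "(\<integral>\<^sup>+t. f t \<partial>lborel) = ennreal \<bar>1 / c\<bar> * (\<integral>\<^sup>+t. f (d / c + (1 / c) * t) \<partial>lborel)"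
    by (rule nn_integral_real_affine) (use False in auto)
  also have "\<dots> = ennreal \<bar>1 / c\<bar> * (\<integral>\<^sup>+u. f (d / c + (1 / c) * (- 1 / u)) * ennreal (1 / u\<^sup>2) \<partial>lborel)"
    by (subst nn_integral_inversion[where f = "\<lambda>t. f (d / c + (1 / c) * t)"]) auto
  also have "\<dots> = ennreal \<bar>1 / c\<bar> * (ennreal \<bar>c\<bar> *
      (\<integral>\<^sup>+t. f (d / c + (1 / c) * (- 1 / (a + c * t))) * ennreal (1 / (a + c * t)\<^sup>2) \<partial>lborel))"
    by (subst nn_integral_real_affine[where t = a and c = c]) (use False in auto)
  also have "\<dots> = (\<integral>\<^sup>+t. f (d / c + (1 / c) * (- 1 / (a + c * t))) * ennreal (1 / (a + c * t)\<^sup>2) \<partial>lborel)"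
    using False by (simp add: mult.assoc[symmetric] ennreal_mult[symmetric])
  also have "\<dots> = (\<integral>\<^sup>+t. f ((b + d * t) / (a + c * t)) * ennreal (1 / (a + c * t)\<^sup>2) \<partial>lborel)"
  proof (rule nn_integral_cong)
    fix t :: real
    show "f (d / c + (1 / c) * (- 1 / (a + c * t))) * ennreal (1 / (a + c * t)\<^sup>2) =
      f ((b + d * t) / (a + c * t)) * ennreal (1 / (a + c * t)\<^sup>2)"
    proof (cases "a + c * t = 0")
      case nz: False
      have "d / c + (1 / c) * (- 1 / (a + c * t)) = (d * (a + c * t) - 1) / (c * (a + c * t))"
        using nz by (simp add: diff_divide_distrib)
      also have "d * (a + c * t) - 1 = c * (b + d * t)" using det by (simp add: algebra_simps)
      finally show ?thesis using False by simp
    qed simp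
  qed
  finally show ?thesis ..
qed

section \<open>A Schur test for Moebius maps of the projective line\<close>

lemma ennreal_sum_Cauchy_Schwarz:
  fixes f g :: "'k \<Rightarrow> ennreal"
  assumes "finite K"
  shows "(\<Sum>k\<in>K. f k * g k)\<^sup>2 \<le> (\<Sum>k\<in>K. (f k)\<^sup>2) * (\<Sum>k\<in>K. (g k)\<^sup>2)"
  using Cauchy_Schwarz_nn_integral[of f "count_space K" g] assms
  by (simp add: nn_integral_count_space_finite)

text \<open>Schur's test with the weight \<open>1 / sqrt (1 + t\<^sup>2)\<close>, the rotation invariant half-density in the
  affine chart \<open>t\<close> of the projective line. The family of Moebius maps is closed under inversion
  (\<open>iv\<close>), so the averaged operator is self-adjoint.\<close>

lemma moebius_schur_test:
  fixes g :: "real \<Rightarrow> ennreal" and a b c d :: "'k \<Rightarrow> real" and L :: real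
  assumes [measurable]: "g \<in> borel_measurable borel" and K: "finite K"
    and det: "\<And>k. k \<in> K \<Longrightarrow> a k * d k - b k * c k = 1"
    and inv: "bij_betw iv K K"
      "\<And>k. k \<in> K \<Longrightarrow> a (iv k) = d k \<and> d (iv k) = a k \<and> b (iv k) = - b k \<and> c (iv k) = - c k"
    and weight: "\<And>t. (\<Sum>k\<in>K. 1 / sqrt ((a k + c k * t)\<^sup>2 + (b k + d k * t)\<^sup>2)) \<le> L / sqrt (1 + t\<^sup>2)"
    and L: "0 \<le> L"
  shows "(\<integral>\<^sup>+t. (\<Sum>k\<in>K. ennreal (1 / \<bar>a k + c k * t\<bar>) * g ((b k + d k * t) / (a k + c k * t)))\<^sup>2 \<partial>lborel)
    \<le> ennreal (L\<^sup>2) * (\<integral>\<^sup>+t. (g t)\<^sup>2 \<partial>lborel)"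
proof -
  define n where "n k t = sqrt ((a k + c k * t)\<^sup>2 + (b k + d k * t)\<^sup>2)" for k t
  define m where "m k t = sqrt ((d k - c k * t)\<^sup>2 + (- b k + a k * t)\<^sup>2)" for k t
  define w where "w t = sqrt (1 + t\<^sup>2)" for t :: real
  define s where "s k t = (b k + d k * t) / (a k + c k * t)" for k t
  have [measurable]: "(\<lambda>t. n k t) \<in> borel_measurable borel" "(\<lambda>t. s k t) \<in> borel_measurable borel"
    "(\<lambda>t. m k t) \<in> borel_measurable borel"  "w \<in> borel_measurable borel" for k
    unfolding n_def s_def m_def w_def by measurable
  have w0: "w t > 0" for t unfolding w_def by (simp add: add_pos_nonneg)
  have npos: "n k t > 0" if "k \<in> K" for k t
  proof -
    have "a k + c k * t \<noteq> 0 \<or> b k + d k * t \<noteq> 0"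
    proof (rule ccontr)
      assume "\<not> ?thesis"
      then have z: "a k = - (c k * t)" "b k = - (d k * t)" by auto
      have "a k * d k - b k * c k = 0" unfolding z by simp
      with det[OF that] show False by simp
    qed
    then show ?thesis unfolding n_def by (simp add: sum_power2_gt_zero_iff)
  qed
  have m_n: "m k t = n (iv k) t" if "k \<in> K" for k t
    using inv(2)[OF that] by (simp add: m_def n_def)
  have invK: "iv k \<in> K" if "k \<in> K" for k using inv(1) that by (auto simp: bij_betw_def)
  have mpos: "m k t > 0" if "k \<in> K" for k t using m_n[OF that] npos[OF invK[OF that]] by simp
  \<comment> \<open>Cauchy--Schwarz with the summands split into \<open>1 / sqrt n\<close> and the
    rest; \<open>weight\<close> bounds the sum of the \<open>1 / n\<close>.\<close>
  have pt: "(\<Sum>k\<in>K. ennreal (1 / \<bar>a k + c k * t\<bar>) * g (s k t))\<^sup>2 \<le>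
      (\<Sum>k\<in>K. ennreal L * (ennreal (w (s k t) / m k (s k t)) * (g (s k t))\<^sup>2 * ennreal (1 / (a k + c k * t)\<^sup>2)))"
    (is "?l \<le> ?r") for t
  proof -
    have "?l = (\<Sum>k\<in>K. ennreal (1 / sqrt (n k t)) * (ennreal (sqrt (n k t) / \<bar>a k + c k * t\<bar>) * g (s k t)))\<^sup>2"
    proof (intro arg_cong[where f="\<lambda>x. x\<^sup>2"] sum.cong refl)
      fix k assume "k \<in> K"
      from npos[OF this, of t]
      show "ennreal (1 / \<bar>a k + c k * t\<bar>) * g (s k t) =
          ennreal (1 / sqrt (n k t)) * (ennreal (sqrt (n k t) / \<bar>a k + c k * t\<bar>) * g (s k t))"
        by (simp add: mult.assoc[symmetric] ennreal_mult[symmetric])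
    qed
    also have "\<dots> \<le> (\<Sum>k\<in>K. (ennreal (1 / sqrt (n k t)))\<^sup>2) *
        (\<Sum>k\<in>K. (ennreal (sqrt (n k t) / \<bar>a k + c k * t\<bar>) * g (s k t))\<^sup>2)"
      by (rule ennreal_sum_Cauchy_Schwarz[OF K])
    also have "(\<Sum>k\<in>K. (ennreal (1 / sqrt (n k t)))\<^sup>2) = ennreal (\<Sum>k\<in>K. 1 / n k t)"
      using npos[of _ t] by (subst sum_ennreal[symmetric])
        (auto simp: ennreal_power power_divide less_imp_le intro!: sum.cong)
    also have "\<dots> \<le> ennreal (L / w t)"
      using weight[of t] by (intro ennreal_leI) (simp add: n_def w_def)
    also have "(\<Sum>k\<in>K. (ennreal (sqrt (n k t) / \<bar>a k + c k * t\<bar>) * g (s k t))\<^sup>2) =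
       (\<Sum>k\<in>K. ennreal (n k t / (a k + c k * t)\<^sup>2) * (g (s k t))\<^sup>2)"
      using npos[of _ t]
      by (intro sum.cong refl) (auto simp: power_mult_distrib ennreal_power power_divide less_imp_le)
    finally have "?l \<le> ennreal (L / w t) * (\<Sum>k\<in>K. ennreal (n k t / (a k + c k * t)\<^sup>2) * (g (s k t))\<^sup>2)"
      by (simp add: mult_right_mono)
    also have "\<dots> = ?r"
      unfolding sum_distrib_left
    proof (rule sum.cong[OF refl])
      fix k assume k: "k \<in> K"
      \<comment> \<open>Cocycle identity: at the image point \<open>s k t\<close> the weight
        \<open>w\<close> is \<open>n\<close> divided by the modulus of the denominator, and the norm
        \<open>m\<close> of the inverse map is \<open>w\<close> at \<open>t\<close> divided by the
        same modulus.\<close>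
      have e1: "L / w t * (n k t / (a k + c k * t)\<^sup>2) = L * (w (s k t) / m k (s k t)) * (1 / (a k + c k * t)\<^sup>2)"
      proof (cases "a k + c k * t = 0")
        case False
        let ?c = "a k + c k * t"
        have "1 + (s k t)\<^sup>2 = (?c\<^sup>2 + (b k + d k * t)\<^sup>2) / ?c\<^sup>2"
          using False by (simp add: s_def power_divide) (simp add: add_divide_distrib)
        then have 1: "w (s k t) = n k t / \<bar>?c\<bar>"
          by (simp add: w_def n_def real_sqrt_divide)
        have "d k * ?c - c k * (b k + d k * t) = 1" "- b k * ?c + a k * (b k + d k * t) = t"
          using det[OF k] by algebra+
        then have "d k - c k * s k t = 1 / ?c" "- b k + a k * s k t = t / ?c"
          using False by (simp_all add: s_def field_simps)
        then have 2: "m k (s k t) = w t / \<bar>?c\<bar>"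
          by (simp add: m_def w_def power_divide add_divide_distrib[symmetric] real_sqrt_divide)
        show ?thesis unfolding 1 2 using False by simp
      qed simp
      have e2: "ennreal (L / w t) * (ennreal X * G) = ennreal (L / w t * X) * G" if "0 \<le> X" for X G
        using L w0[of t] that by (subst ennreal_mult) (auto simp: mult.assoc)
      have e3: "ennreal L * (ennreal Y * G * ennreal Z) = ennreal (L * Y * Z) * G"
        if "0 \<le> Y" "0 \<le> Z" for Y Z G
        using L that by (simp only: ennreal_mult mult_nonneg_nonneg) (simp only: ac_simps)
      have "0 \<le> n k t / (a k + c k * t)\<^sup>2" "0 \<le> w (s k t) / m k (s k t)" "0 \<le> 1 / (a k + c k * t)\<^sup>2"
        using npos[OF k, of t] mpos[OF k, of "s k t"] w0[of "s k t"] by (auto simp: less_imp_le)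
      then show "ennreal (L / w t) * (ennreal (n k t / (a k + c k * t)\<^sup>2) * (g (s k t))\<^sup>2) =
        ennreal L * (ennreal (w (s k t) / m k (s k t)) * (g (s k t))\<^sup>2 * ennreal (1 / (a k + c k * t)\<^sup>2))"
        by (simp only: e2 e3 e1)
    qed
    finally show ?thesis .
  qed
  have "(\<integral>\<^sup>+t. (\<Sum>k\<in>K. ennreal (1 / \<bar>a k + c k * t\<bar>) * g (s k t))\<^sup>2 \<partial>lborel) \<le>
     (\<integral>\<^sup>+t. (\<Sum>k\<in>K. ennreal L * (ennreal (w (s k t) / m k (s k t)) * (g (s k t))\<^sup>2 *
        ennreal (1 / (a k + c k * t)\<^sup>2))) \<partial>lborel)"
    by (intro nn_integral_mono pt)
  also have "\<dots> = (\<Sum>k\<in>K. ennreal L * (\<integral>\<^sup>+t. ennreal (w (s k t) / m k (s k t)) * (g (s k t))\<^sup>2 *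
        ennreal (1 / (a k + c k * t)\<^sup>2) \<partial>lborel))"
    by (subst nn_integral_sum) (auto intro!: sum.cong nn_integral_cmult)
  \<comment> \<open>The change of variables moves the evaluation point from \<open>s k t\<close> to
    \<open>t\<close>. What remains is the weight of the inverse maps, so that \<open>weight\<close>
    applies a second time after reindexing by \<open>iv\<close>.\<close>
  also have "\<dots> = (\<Sum>k\<in>K. ennreal L * (\<integral>\<^sup>+t. ennreal (w t / m k t) * (g t)\<^sup>2 \<partial>lborel))"
    unfolding s_def
    by (intro sum.cong refl arg_cong2[where f = "(*)"] nn_integral_moebius[where f = "\<lambda>t. ennreal (w t / m k t) * (g t)\<^sup>2" for k] det) auto
  also have "\<dots> = (\<integral>\<^sup>+t. ennreal L * ((\<Sum>k\<in>K. ennreal (w t / m k t)) * (g t)\<^sup>2) \<partial>lborel)"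
    by (simp add: nn_integral_cmult nn_integral_sum sum_distrib_left sum_distrib_right)
  also have "\<dots> \<le> (\<integral>\<^sup>+t. ennreal (L\<^sup>2) * (g t)\<^sup>2 \<partial>lborel)"
  proof (rule nn_integral_mono)
    fix t
    have "(\<Sum>k\<in>K. ennreal (w t / m k t)) = ennreal (\<Sum>k\<in>K. w t / m k t)"
      using mpos[of _ t] w0[of t] by (intro sum_ennreal) (auto intro: less_imp_le)
    also have "(\<Sum>k\<in>K. w t / m k t) = w t * (\<Sum>k\<in>K. 1 / n (iv k) t)"
      by (simp add: sum_distrib_left m_n)
    also have "(\<Sum>k\<in>K. 1 / n (iv k) t) = (\<Sum>k\<in>K. 1 / n k t)"
      by (rule sum.reindex_bij_betw[OF inv(1)])
    also have "w t * \<dots> \<le> w t * (L / w t)"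
      using weight[of t] w0[of t] by (intro mult_left_mono) (auto simp: n_def w_def)
    also have "\<dots> = L" using w0[of t] by simp
    finally have "(\<Sum>k\<in>K. ennreal (w t / m k t)) \<le> ennreal L" by (simp add: ennreal_leI)
    then have "ennreal L * ((\<Sum>k\<in>K. ennreal (w t / m k t)) * (g t)\<^sup>2) \<le> ennreal L * (ennreal L * (g t)\<^sup>2)"
      by (intro mult_left_mono mult_right_mono) auto
    also have "\<dots> = ennreal (L\<^sup>2) * (g t)\<^sup>2"
      using L by (simp add: mult.assoc[symmetric] ennreal_mult[symmetric] power2_eq_square)
    finally show "ennreal L * ((\<Sum>k\<in>K. ennreal (w t / m k t)) * (g t)\<^sup>2) \<le> ennreal (L\<^sup>2) * (g t)\<^sup>2" .
  qed
  finally show ?thesis by (simp add: nn_integral_cmult s_def)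
qed

text \<open>With \<open>A = cosh r\<close> and \<open>B = sinh r\<close> the four terms belong to
  the stretchings by \<open>exp r\<close> along two axes at 45 degrees and to their inverses. On its
  own axis one pair contributes \<open>2 * cosh r > 2\<close> times the weight; the other pair more
  than compensates, with a net gain of second order in \<open>r\<close>.\<close>

lemma hyperbolic_average_bound:
  fixes A B t :: real
  assumes AB: "A\<^sup>2 - B\<^sup>2 = 1" and A: "0 < A" and m: "4 * A\<^sup>2 * B\<^sup>2 \<le> 1 / 5"
  shows "1 / sqrt ((A + B)\<^sup>2 + ((A - B) * t)\<^sup>2) + 1 / sqrt ((A - B)\<^sup>2 + ((A + B) * t)\<^sup>2) +
     1 / sqrt ((A + B * t)\<^sup>2 + (B + A * t)\<^sup>2) + 1 / sqrt ((A - B * t)\<^sup>2 + (- B + A * t)\<^sup>2)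
    \<le> sqrt (16 - 4 * A\<^sup>2 * B\<^sup>2) / sqrt (1 + t\<^sup>2)"
proof -
  \<comment> \<open>For \<open>t = tan \<theta>\<close> these are
    \<open>x = cos (2 * \<theta>)\<close> and \<open>y = sin (2 * \<theta>)\<close>, while
    \<open>C = cosh (2 * r)\<close> and \<open>S = sinh (2 * r)\<close>. The squared norms of the
    pairs are then \<open>Q * (C + S * x)\<close>, \<open>Q * (C - S * x)\<close> and the same with
    \<open>y\<close>.\<close>
  define C S M Q x y where "C = A\<^sup>2 + B\<^sup>2" and "S = 2 * A * B" and "M = 4 * A\<^sup>2 * B\<^sup>2"
    and "Q = 1 + t\<^sup>2" and "x = (1 - t\<^sup>2) / Q" and "y = 2 * t / Q"
  have Q: "Q > 0" unfolding Q_def by (simp add: add_pos_nonneg)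
  have M0: "M \<ge> 0" and M5: "M \<le> 1 / 5" using m by (auto simp: M_def)
  have SM: "S\<^sup>2 = M" by (simp add: S_def M_def power_mult_distrib)
  have "C\<^sup>2 - S\<^sup>2 = (A\<^sup>2 - B\<^sup>2)\<^sup>2" unfolding C_def S_def by algebra
  then have CM: "C\<^sup>2 = 1 + M" using AB SM by simp
  have C0: "C > 0" using A unfolding C_def by (simp add: add_pos_nonneg)
  have CM2: "C \<le> 1 + M / 2"
  proof (rule power2_le_imp_le)
    show "C\<^sup>2 \<le> (1 + M / 2)\<^sup>2" unfolding CM by (simp add: power2_eq_square algebra_simps)
  qed (use M0 in simp)
  have "x\<^sup>2 + y\<^sup>2 = ((1 - t\<^sup>2)\<^sup>2 + (2 * t)\<^sup>2) / Q\<^sup>2"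
    by (simp add: x_def y_def power_divide add_divide_distrib)
  also have "(1 - t\<^sup>2)\<^sup>2 + (2 * t)\<^sup>2 = Q\<^sup>2" unfolding Q_def by algebra
  finally have xy: "x\<^sup>2 + y\<^sup>2 = 1" using Q by simp
  have Qx: "Q * x = 1 - t\<^sup>2" "Q * y = 2 * t" using Q by (auto simp: x_def y_def)
  have pos: "C + S * u > 0" "C - S * u > 0" if "u\<^sup>2 \<le> 1" for u
  proof -
    have "(S * u)\<^sup>2 \<le> M * 1"
      unfolding power_mult_distrib SM using that M0 by (intro mult_left_mono)
    then have "(S * u)\<^sup>2 < C\<^sup>2" using CM by simp
    then have "\<bar>S * u\<bar> < C" using C0 by (metis abs_of_pos abs_le_square_iff linorder_not_less abs_abs power2_abs)
    then show "C + S * u > 0" "C - S * u > 0" by auto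
  qed
  define E where "E u = 1 / sqrt (C + S * u) + 1 / sqrt (C - S * u)" for u
  \<comment> \<open>To first order in \<open>M\<close> the bound is \<open>4 + M - 3 * z\<close>.
    The values of \<open>z\<close> for \<open>x\<close> and \<open>y\<close> add up to
    \<open>M\<close>, so the sum over both axes is about \<open>8 - M\<close>.\<close>
  have E2: "(E u)\<^sup>2 \<le> (3 + M) * (1 - z + z\<^sup>2) + 1" if z: "z = M * (1 - u\<^sup>2)" and u: "u\<^sup>2 \<le> 1" for u z
  proof -
    note p = pos[OF u]
    have z0: "z \<ge> 0" unfolding z using M0 u by simp
    have prod: "(C + S * u) * (C - S * u) = 1 + z"
      using CM SM unfolding z by algebra
    have sum: "1 / (C + S * u) + 1 / (C - S * u) = 2 * C / (1 + z)"
      unfolding prod[symmetric] using p by (simp add: field_simps)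
    have "(E u)\<^sup>2 = 1 / (C + S * u) + 1 / (C - S * u) + 2 * (1 / sqrt (C + S * u) * (1 / sqrt (C - S * u)))"
      using p by (simp add: E_def power2_sum power_divide)
    also have "1 / sqrt (C + S * u) * (1 / sqrt (C - S * u)) = 1 / sqrt (1 + z)"
      by (simp add: prod[symmetric] real_sqrt_mult)
    also have "2 * (1 / sqrt (1 + z)) \<le> 1 + 1 / (1 + z)"
    proof -
      have "0 \<le> (1 - 1 / sqrt (1 + z))\<^sup>2" by simp
      also have "\<dots> = 1 + 1 / (1 + z) - 2 * (1 / sqrt (1 + z))"
        using z0 by (simp add: power2_diff power_divide)
      finally show ?thesis by simp
    qed
    finally have "(E u)\<^sup>2 \<le> (2 * C + 1) * (1 / (1 + z)) + 1"
      unfolding sum by (simp add: algebra_simps add_divide_distrib)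
    also have "\<dots> \<le> (3 + M) * (1 - z + z\<^sup>2) + 1"
    proof -
      have "1 \<le> (1 - z + z\<^sup>2) * (1 + z)"
      proof -
        have "(1 - z + z\<^sup>2) * (1 + z) = 1 + z ^ 3" by algebra
        then show ?thesis using z0 by simp
      qed
      then have "1 / (1 + z) \<le> 1 - z + z\<^sup>2" using z0 by (simp add: divide_le_eq)
      then have "(2 * C + 1) * (1 / (1 + z)) \<le> (3 + M) * (1 - z + z\<^sup>2)"
        using CM2 C0 z0 M0 by (intro mult_mono) auto
      then show ?thesis by simp
    qed
    finally show ?thesis .
  qed
  have x1: "x\<^sup>2 \<le> 1" "y\<^sup>2 \<le> 1" using xy by (smt (verit) zero_le_power2)+
  have "(E x + E y)\<^sup>2 \<le> 2 * ((E x)\<^sup>2 + (E y)\<^sup>2)"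
    using zero_le_power2[of "E x - E y"] by (simp add: power2_sum power2_diff)
  also have "(E x)\<^sup>2 + (E y)\<^sup>2 \<le> 8 - M / 2"
  proof -
    define z1 z2 where "z1 = M * (1 - x\<^sup>2)" and "z2 = M * (1 - y\<^sup>2)"
    have s: "z1 + z2 = M * (2 - (x\<^sup>2 + y\<^sup>2))" unfolding z1_def z2_def by algebra
    then have s: "z1 + z2 = M" using xy by simp
    have nn: "z1 \<ge> 0" "z2 \<ge> 0" using x1 M0 by (auto simp: z1_def z2_def)
    have "z1\<^sup>2 + z2\<^sup>2 \<le> (z1 + z2)\<^sup>2" using nn by (simp add: power2_sum)
    then have sq: "z1\<^sup>2 + z2\<^sup>2 \<le> M\<^sup>2" using s by simp
    have "(E x)\<^sup>2 + (E y)\<^sup>2 \<le> (3 + M) * (1 - z1 + z1\<^sup>2) + 1 + ((3 + M) * (1 - z2 + z2\<^sup>2) + 1)"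
      using E2[OF z1_def x1(1)] E2[OF z2_def x1(2)] by simp
    also have "\<dots> = (3 + M) * (2 - (z1 + z2) + (z1\<^sup>2 + z2\<^sup>2)) + 2" by algebra
    also have "\<dots> \<le> (3 + M) * (2 - M + M\<^sup>2) + 2"
      using s sq M0 by (intro add_right_mono mult_left_mono) auto
    \<comment> \<open>Half of the gain \<open>M\<close> is kept; the hypothesis
      \<open>M \<le> 1 / 5\<close> makes the bracket nonnegative.\<close>
    also have "\<dots> = 8 - M / 2 - M * (1 / 2 - 2 * M - M\<^sup>2)" by algebra
    also have "\<dots> \<le> 8 - M / 2"
    proof -
      have "M\<^sup>2 \<le> (1 / 5)\<^sup>2" using M0 M5 by (intro power_mono)
      then have "0 \<le> 1 / 2 - 2 * M - M\<^sup>2" using M5 by (simp add: power2_eq_square)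
      then show ?thesis using M0 by (simp del: right_diff_distrib')
    qed
    finally show ?thesis .
  qed
  finally have "(E x + E y)\<^sup>2 \<le> 16 - M" by simp
  then have fin: "E x + E y \<le> sqrt (16 - M)" by (rule real_le_rsqrt)
  have q: "(A + B)\<^sup>2 + ((A - B) * t)\<^sup>2 = Q * (C + S * x)"
    "(A - B)\<^sup>2 + ((A + B) * t)\<^sup>2 = Q * (C - S * x)"
    "(A + B * t)\<^sup>2 + (B + A * t)\<^sup>2 = Q * (C + S * y)"
    "(A - B * t)\<^sup>2 + (- B + A * t)\<^sup>2 = Q * (C - S * y)"
  proof -
    have e: "Q * (C + S * u) = Q * C + S * (Q * u)" "Q * (C - S * u) = Q * C - S * (Q * u)" for u
      by algebra+
    show "(A + B)\<^sup>2 + ((A - B) * t)\<^sup>2 = Q * (C + S * x)"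
      "(A - B)\<^sup>2 + ((A + B) * t)\<^sup>2 = Q * (C - S * x)"
      "(A + B * t)\<^sup>2 + (B + A * t)\<^sup>2 = Q * (C + S * y)"
      "(A - B * t)\<^sup>2 + (- B + A * t)\<^sup>2 = Q * (C - S * y)"
      unfolding e Qx unfolding Q_def C_def S_def by algebra+
  qed
  have "1 / sqrt (Q * (C + S * x)) + 1 / sqrt (Q * (C - S * x)) + 1 / sqrt (Q * (C + S * y)) + 1 / sqrt (Q * (C - S * y))
    = (E x + E y) / sqrt Q"
    by (simp add: E_def real_sqrt_mult add_divide_distrib mult.commute)
  also have "\<dots> \<le> sqrt (16 - M) / sqrt Q" using fin Q by (intro divide_right_mono) auto
  finally show ?thesis unfolding q by (simp add: M_def Q_def)
qed

section \<open>Contraction by averaging\<close>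

text \<open>Joint convexity of \<open>x^2 / m\<close>, by the arithmetic-geometric mean inequality
  for the cross term. It recombines the two parts of the noise law without losing a factor
  2.\<close>

lemma ennreal_square_add_le:
  fixes x y X Y :: ennreal and m n :: real
  assumes x: "x\<^sup>2 \<le> ennreal m * X" and y: "y\<^sup>2 \<le> ennreal n * Y" and m: "0 \<le> m" "0 \<le> n" "0 < m + n"
  shows "(x + y)\<^sup>2 \<le> ennreal (m + n) * (X + Y)"
proof (cases "X = \<top> \<or> Y = \<top>")
  case True
  then have "ennreal (m + n) * (X + Y) = \<top>" using m by (auto simp: ennreal_mult_top ennreal_mult_eq_top_iff)
  then show ?thesis by simp
next
  case False
  then obtain X' Y' where XY: "X = ennreal X'" "Y = ennreal Y'" "0 \<le> X'" "0 \<le> Y'"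
    by (cases X; cases Y) auto
  have "x\<^sup>2 < \<top>" "y\<^sup>2 < \<top>"
    using x y XY by (auto simp: ennreal_mult[symmetric] m intro: le_less_trans)
  then have "x \<noteq> \<top>" "y \<noteq> \<top>" by (auto simp: power2_eq_square ennreal_top_mult)
  then obtain x' y' where xy: "x = ennreal x'" "y = ennreal y'" "0 \<le> x'" "0 \<le> y'"
    by (cases x; cases y) auto
  have 1: "x'\<^sup>2 \<le> m * X'" "y'\<^sup>2 \<le> n * Y'"
    using x y m XY xy by (simp_all add: ennreal_power ennreal_mult[symmetric])
  have "(x' * y')\<^sup>2 \<le> (m * X') * (n * Y')"
    unfolding power_mult_distrib using 1 XY m by (intro mult_mono) auto
  also have "\<dots> \<le> ((m * Y' + n * X') / 2)\<^sup>2"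
  proof -
    have "0 \<le> (m * Y' - n * X')\<^sup>2" by simp
    then show ?thesis by (simp add: power2_eq_square algebra_simps)
  qed
  finally have "x' * y' \<le> (m * Y' + n * X') / 2"
    by (rule power2_le_imp_le) (use XY m in auto)
  then have "(x' + y')\<^sup>2 \<le> (m + n) * (X' + Y')"
    using 1 by (simp add: power2_sum algebra_simps)
  then show ?thesis using m XY xy
    by (simp add: ennreal_power ennreal_mult[symmetric] ennreal_plus[symmetric] del: ennreal_plus)
qed

lemma nn_integral_weighted_Cauchy_Schwarz:
  fixes w f :: "'a \<Rightarrow> ennreal"
  assumes [measurable]: "w \<in> borel_measurable M" "f \<in> borel_measurable M"
  shows "(\<integral>\<^sup>+x. w x * f x \<partial>M)\<^sup>2 \<le> (\<integral>\<^sup>+x. w x \<partial>M) * (\<integral>\<^sup>+x. w x * (f x)\<^sup>2 \<partial>M)"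
proof -
  have "emeasure (density M w) (space M) = (\<integral>\<^sup>+x. w x \<partial>M)"
    by (auto simp: emeasure_density intro!: nn_integral_cong)
  then show ?thesis
    using Cauchy_Schwarz_nn_integral[of "\<lambda>_. 1" "density M w" f] by (simp add: nn_integral_density)
qed

text \<open>The uniform distribution on \<open>C\<close> dominates a multiple of the average over \<open>k\<close> of the image
  under \<open>\<tau> k\<close> of the uniform distribution on \<open>C'\<close>; the remainder contributes with operator norm at
  most 1. The set \<open>C''\<close> only serves to bound the Jacobians of the affine maps \<open>\<tau> k\<close>.\<close>

lemma averaging_contraction:
  fixes F :: "'a::euclidean_space \<Rightarrow> real \<Rightarrow> ennreal" and \<tau> :: "'k \<Rightarrow> 'a \<Rightarrow> 'a"
    and C C' C'' :: "'a set" and B L :: real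
  assumes F[measurable]: "(\<lambda>(x, t). F x t) \<in> borel_measurable (borel \<Otimes>\<^sub>M borel)"
    and C[measurable]: "C \<in> sets borel" "C' \<in> sets borel" "C'' \<in> sets borel"
    and fin: "emeasure lborel C \<noteq> \<infinity>" "0 < measure lborel C''" and sub: "C'' \<subseteq> C'" "C' \<subseteq> C"
    and K: "finite K" "K \<noteq> {}"
    and \<tau>[measurable]: "\<And>k. \<tau> k \<in> borel_measurable borel"
    and equi: "\<And>k u. k \<in> K \<Longrightarrow> \<exists>v. \<forall>x. \<tau> k x + u = \<tau> k (x + v)"
    and iv: "\<And>k. k \<in> K \<Longrightarrow> iv k \<in> K" "\<And>k x. k \<in> K \<Longrightarrow> \<tau> (iv k) (\<tau> k x) = x" "\<And>k x. k \<in> K \<Longrightarrow> \<tau> k (\<tau> (iv k) x) = x"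
    and maps: "\<And>k. k \<in> K \<Longrightarrow> \<tau> k ` C' \<subseteq> C" "\<And>k. k \<in> K \<Longrightarrow> \<tau> k ` C'' \<subseteq> C'"
    and B: "\<And>x. (\<integral>\<^sup>+t. (F x t)\<^sup>2 \<partial>lborel) \<le> ennreal B" "0 \<le> B"
    and L: "\<And>x. (\<integral>\<^sup>+t. (\<Sum>k\<in>K. F (\<tau> k x) t)\<^sup>2 \<partial>lborel) \<le> ennreal (L * B)" "0 \<le> L"
  shows "(\<integral>\<^sup>+t. (\<integral>\<^sup>+x. indicator C x * F x t \<partial>lborel)\<^sup>2 \<partial>lborel) \<le>
    ennreal (measure lborel C * (measure lborel C - measure lborel C'' * (1 - L / (real (card K))\<^sup>2)) * B)"
proof -
  define n where "n = real (card K)"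
  have n: "n > 0" using K by (simp add: n_def card_gt_0_iff)
  have fin': "emeasure lborel C' \<noteq> \<infinity>" "emeasure lborel C'' \<noteq> \<infinity>"
    using fin(1) sub emeasure_mono[OF sub(1), of lborel] emeasure_mono[OF sub(2), of lborel] C
    by (auto simp: top_unique)
  define v v' v'' where "v = measure lborel C" and "v' = measure lborel C'" and "v'' = measure lborel C''"
  have ev: "emeasure lborel C = ennreal v" "emeasure lborel C' = ennreal v'" "emeasure lborel C'' = ennreal v''"
    using fin(1) fin' by (simp_all add: v_def v'_def v''_def emeasure_eq_ennreal_measure)
  have v: "0 < v''" "v'' \<le> v'" "v' \<le> v"
  proof -
    show "0 < v''" using fin by (simp add: v''_def)
    have "ennreal v'' \<le> ennreal v'" "ennreal v' \<le> ennreal v"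
      unfolding ev[symmetric] using sub C by (auto intro!: emeasure_mono)
    then show "v'' \<le> v'" "v' \<le> v" by (auto simp: v_def v'_def)
  qed
  \<comment> \<open>The quotient \<open>e k / v''\<close> is the inverse of the Jacobian of
    \<open>\<tau> k\<close>, expressed through volumes instead of a determinant. The bound
    \<open>e k \<le> v'\<close> holds because \<open>\<tau> (iv k)\<close> maps \<open>C''\<close>
    into \<open>C'\<close>.\<close>
  define e where "e k = measure lborel {x. \<tau> k x \<in> C''}" for k
  have e: "emeasure lborel {x. \<tau> k x \<in> C''} = ennreal (e k)" "e k \<le> v'" if "k \<in> K" for k
  proof -
    have "{x. \<tau> k x \<in> C''} \<subseteq> C'"
      using maps(2)[OF iv(1)[OF that]] iv(2)[OF that] by force
    then have le: "emeasure lborel {x. \<tau> k x \<in> C''} \<le> ennreal v'"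
      unfolding ev[symmetric] by (intro emeasure_mono) auto
    then show "emeasure lborel {x. \<tau> k x \<in> C''} = ennreal (e k)"
      unfolding e_def by (intro emeasure_eq_ennreal_measure) (auto simp: top_unique)
    with le show "e k \<le> v'" using v by simp
  qed
  have e0: "0 \<le> e k" for k by (simp add: e_def)
  \<comment> \<open>Density of the average of the images under \<open>\<tau> k\<close> of the
    uniform law on \<open>C'\<close>, scaled to total mass \<open>v''\<close>. At this scale
    \<open>e k \<le> v'\<close> ensures that \<open>w\<close> stays below the indicator of
    \<open>C\<close>.\<close>
  define w where "w x = (\<Sum>k\<in>K. e k * indicator C' (\<tau> (iv k) x)) / (n * v')" for x
  have [measurable]: "w \<in> borel_measurable borel" unfolding w_def by measurable
  have w0: "0 \<le> w x" for x
    unfolding w_def using v n e0 by (intro divide_nonneg_nonneg sum_nonneg) auto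
  have w1: "w x \<le> indicator C x" for x
  proof -
    have "(\<Sum>k\<in>K. e k * indicator C' (\<tau> (iv k) x)) \<le> (\<Sum>k\<in>K. v' * indicator C x)"
    proof (rule sum_mono)
      fix k assume k: "k \<in> K"
      have "x \<in> C" if "\<tau> (iv k) x \<in> C'" using maps(1)[OF k] iv(3)[OF k] that by force
      then show "e k * indicator C' (\<tau> (iv k) x) \<le> v' * indicator C x"
        using e(2)[OF k] e0[of k] v by (auto split: split_indicator)
    qed
    also have "\<dots> = n * v' * indicator C x" by (simp add: n_def)
    finally show ?thesis unfolding w_def using n v by (simp add: divide_le_eq mult.commute)
  qed
  have transfer: "(\<integral>\<^sup>+x. ennreal (w x) * h x \<partial>lborel) =
      ennreal (v'' / (n * v')) * (\<integral>\<^sup>+x. indicator C' x * (\<Sum>k\<in>K. h (\<tau> k x)) \<partial>lborel)"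
    if [measurable]: "h \<in> borel_measurable borel" for h :: "'a \<Rightarrow> ennreal"
  proof -
    have 1: "ennreal (e k) * (\<integral>\<^sup>+x. indicator C' (\<tau> (iv k) x) * h x \<partial>lborel) =
        ennreal v'' * (\<integral>\<^sup>+x. indicator C' x * h (\<tau> k x) \<partial>lborel)" if k: "k \<in> K" for k
    proof -
      have *: "(\<integral>\<^sup>+x. indicator C' (\<tau> (iv k) (\<tau> k x)) * h (\<tau> k x) \<partial>lborel) * (\<integral>\<^sup>+x. indicator C'' x \<partial>lborel) =
         (\<integral>\<^sup>+x. indicator C'' (\<tau> k x) \<partial>lborel) * (\<integral>\<^sup>+x. indicator C' (\<tau> (iv k) x) * h x \<partial>lborel)"
        by (rule nn_integral_lborel_affine_tonelli[where f = "\<lambda>x. indicator C' (\<tau> (iv k) x) * h x" and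
              g = "indicator C''" and T = "\<tau> k"]) (use equi[OF k] in measurable)
      have "(\<integral>\<^sup>+x. indicator C'' (\<tau> k x) \<partial>lborel) = (\<integral>\<^sup>+x. indicator {x. \<tau> k x \<in> C''} x \<partial>lborel)"
        by (intro nn_integral_cong) (auto split: split_indicator)
      also have "\<dots> = emeasure lborel {x. \<tau> k x \<in> C''}" by (rule nn_integral_indicator) measurable
      finally show ?thesis using * iv(2)[OF k] ev(3) e(1)[OF k] by (simp add: mult.commute)
    qed
    have "ennreal (w x) = (\<Sum>k\<in>K. ennreal (1 / (n * v')) * (ennreal (e k) * indicator C' (\<tau> (iv k) x)))" for x
    proof -
      have "(\<Sum>k\<in>K. ennreal (1 / (n * v')) * (ennreal (e k) * indicator C' (\<tau> (iv k) x))) =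
         (\<Sum>k\<in>K. ennreal (1 / (n * v') * (e k * indicator C' (\<tau> (iv k) x))))"
        using n v e0 by (intro sum.cong refl) (auto simp: ennreal_mult[symmetric] split: split_indicator)
      also have "\<dots> = ennreal (\<Sum>k\<in>K. 1 / (n * v') * (e k * indicator C' (\<tau> (iv k) x)))"
        using n v e0 by (intro sum_ennreal) auto
      finally show ?thesis by (simp add: w_def sum_divide_distrib)
    qed
    then have "(\<integral>\<^sup>+x. ennreal (w x) * h x \<partial>lborel) =
       (\<integral>\<^sup>+x. (\<Sum>k\<in>K. ennreal (1 / (n * v')) * (ennreal (e k) * (indicator C' (\<tau> (iv k) x) * h x))) \<partial>lborel)"
      by (simp add: sum_distrib_right mult.assoc)
    also have "\<dots> = (\<Sum>k\<in>K. ennreal (1 / (n * v')) * (ennreal (e k) * (\<integral>\<^sup>+x. indicator C' (\<tau> (iv k) x) * h x \<partial>lborel)))"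
      by (simp add: nn_integral_sum nn_integral_cmult)
    also have "\<dots> = (\<Sum>k\<in>K. ennreal (1 / (n * v')) * (ennreal v'' * (\<integral>\<^sup>+x. indicator C' x * h (\<tau> k x) \<partial>lborel)))"
      using 1 by simp
    also have "\<dots> = ennreal (v'' / (n * v')) * (\<Sum>k\<in>K. \<integral>\<^sup>+x. indicator C' x * h (\<tau> k x) \<partial>lborel)"
      using n v by (simp add: sum_distrib_left[symmetric] mult.assoc[symmetric] ennreal_mult[symmetric])
    also have "(\<Sum>k\<in>K. \<integral>\<^sup>+x. indicator C' x * h (\<tau> k x) \<partial>lborel) =
        (\<integral>\<^sup>+x. indicator C' x * (\<Sum>k\<in>K. h (\<tau> k x)) \<partial>lborel)"
      by (simp add: nn_integral_sum sum_distrib_left)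
    finally show ?thesis .
  qed
  have int_w: "(\<integral>\<^sup>+x. ennreal (w x) \<partial>lborel) = ennreal v''"
  proof -
    have "(\<integral>\<^sup>+x. ennreal (w x) \<partial>lborel) = ennreal (v'' / (n * v')) * (\<integral>\<^sup>+x. indicator C' x * ennreal n \<partial>lborel)"
      using transfer[of "\<lambda>_. 1"] by (simp add: n_def ennreal_of_nat_eq_real_of_nat)
    also have "\<dots> = ennreal (v'' / (n * v')) * (ennreal v' * ennreal n)"
      by (simp add: nn_integral_multc ev)
    also have "\<dots> = ennreal v''" using n v by (simp add: ennreal_mult[symmetric])
    finally show ?thesis .
  qed
  define u where "u x = indicator C x - w x" for x
  have [measurable]: "u \<in> borel_measurable borel" unfolding u_def by measurable
  have u0: "0 \<le> u x" for x using w1[of x] by (simp add: u_def)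
  have uw: "ennreal (u x) + ennreal (w x) = indicator C x" for x
    using u0[of x] w0[of x] by (simp add: ennreal_plus[symmetric] u_def del: ennreal_plus split: split_indicator)
  have int_u: "(\<integral>\<^sup>+x. ennreal (u x) \<partial>lborel) = ennreal (v - v'')"
  proof -
    have "(\<integral>\<^sup>+x. ennreal (u x) \<partial>lborel) + ennreal v'' = (\<integral>\<^sup>+x. ennreal (u x) + ennreal (w x) \<partial>lborel)"
      by (subst nn_integral_add) (auto simp: int_w)
    also have "\<dots> = ennreal v" unfolding uw by (simp add: ev)
    also have "\<dots> = ennreal (v - v'') + ennreal v''"
      using v by (simp add: ennreal_plus[symmetric] del: ennreal_plus)
    finally show ?thesis by simp
  qed
  define G where "G x t = (\<Sum>k\<in>K. F (\<tau> k x) t)" for x t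
  have [measurable]: "(\<lambda>x. F x t) \<in> borel_measurable borel" for t
    using measurable_compose[OF measurable_Pair2'[of t borel borel] F] by simp
  have [measurable]: "(\<lambda>t. F x t) \<in> borel_measurable borel" for x
    using measurable_compose[OF measurable_Pair1'[of x borel borel] F] by simp
  have FG: "(\<lambda>(x, t). F (\<tau> k x) t) \<in> borel_measurable (borel \<Otimes>\<^sub>M borel)" for k
  proof -
    have "(\<lambda>z. (\<tau> k (fst z), snd z)) \<in> (borel \<Otimes>\<^sub>M borel) \<rightarrow>\<^sub>M (borel \<Otimes>\<^sub>M borel)" by measurable
    from measurable_compose[OF this F] show ?thesis by (simp add: case_prod_beta)
  qed
  have Gm[measurable]: "(\<lambda>(x, t). G x t) \<in> borel_measurable (borel \<Otimes>\<^sub>M borel)"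
    unfolding G_def using FG by (simp add: case_prod_beta)
  have [measurable]: "(\<lambda>x. G x t) \<in> borel_measurable borel" for t
    using measurable_compose[OF measurable_Pair2'[of t borel borel] Gm] by simp
  have [measurable]: "(\<lambda>t. G x t) \<in> borel_measurable borel" for x
    using measurable_compose[OF measurable_Pair1'[of x borel borel] Gm] by simp
  define \<beta> where "\<beta> = v'' / v'"
  have \<beta>: "0 < \<beta>" "\<beta> * v' = v''" using v by (auto simp: \<beta>_def)
  \<comment> \<open>Cauchy--Schwarz is applied separately to the remainder, of mass
    \<open>v - v''\<close>, and to the dominated part, of mass \<open>v''\<close>. In the latter the
    sum over \<open>k\<close> stays inside the square, which is the form that \<open>L\<close>
    controls.\<close>
  have bnd: "(\<integral>\<^sup>+x. indicator C x * F x t \<partial>lborel)\<^sup>2 \<le> ennreal v *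
     ((\<integral>\<^sup>+x. ennreal (u x) * (F x t)\<^sup>2 \<partial>lborel) + (\<integral>\<^sup>+x. ennreal (\<beta> / n\<^sup>2) * indicator C' x * (G x t)\<^sup>2 \<partial>lborel))" for t
  proof -
    have "(\<integral>\<^sup>+x. indicator C x * F x t \<partial>lborel) = (\<integral>\<^sup>+x. ennreal (u x) * F x t \<partial>lborel) + (\<integral>\<^sup>+x. ennreal (w x) * F x t \<partial>lborel)"
      unfolding uw[symmetric] distrib_right by (rule nn_integral_add) auto
    moreover have "(\<integral>\<^sup>+x. ennreal (u x) * F x t \<partial>lborel)\<^sup>2 \<le> ennreal (v - v'') * (\<integral>\<^sup>+x. ennreal (u x) * (F x t)\<^sup>2 \<partial>lborel)"
      using nn_integral_weighted_Cauchy_Schwarz[of "\<lambda>x. ennreal (u x)" lborel "\<lambda>x. F x t"] by (simp add: int_u)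
    moreover have "(\<integral>\<^sup>+x. ennreal (w x) * F x t \<partial>lborel)\<^sup>2 \<le>
       ennreal v'' * (\<integral>\<^sup>+x. ennreal (\<beta> / n\<^sup>2) * indicator C' x * (G x t)\<^sup>2 \<partial>lborel)"
    proof -
      have "(\<integral>\<^sup>+x. ennreal (w x) * F x t \<partial>lborel) = ennreal (\<beta> / n) * (\<integral>\<^sup>+x. indicator C' x * G x t \<partial>lborel)"
        by (subst transfer) (auto simp: G_def \<beta>_def mult.commute)
      then have "(\<integral>\<^sup>+x. ennreal (w x) * F x t \<partial>lborel)\<^sup>2 = ennreal ((\<beta> / n)\<^sup>2) * (\<integral>\<^sup>+x. indicator C' x * G x t \<partial>lborel)\<^sup>2"
        using \<beta> n by (simp add: power_mult_distrib ennreal_power)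
      also have "\<dots> \<le> ennreal ((\<beta> / n)\<^sup>2) * (ennreal v' * (\<integral>\<^sup>+x. indicator C' x * (G x t)\<^sup>2 \<partial>lborel))"
        using nn_integral_weighted_Cauchy_Schwarz[of "indicator C'" lborel "\<lambda>x. G x t"]
        by (intro mult_left_mono) (simp_all add: ev)
      also have "\<dots> = ennreal ((\<beta> / n)\<^sup>2 * v') * (\<integral>\<^sup>+x. indicator C' x * (G x t)\<^sup>2 \<partial>lborel)"
        using v by (simp add: ennreal_mult mult.assoc)
      also have "(\<beta> / n)\<^sup>2 * v' = v'' * (\<beta> / n\<^sup>2)"
        by (simp add: power2_eq_square \<beta>(2)[symmetric])
      also have "ennreal (v'' * (\<beta> / n\<^sup>2)) * (\<integral>\<^sup>+x. indicator C' x * (G x t)\<^sup>2 \<partial>lborel) =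
         ennreal v'' * (\<integral>\<^sup>+x. ennreal (\<beta> / n\<^sup>2) * indicator C' x * (G x t)\<^sup>2 \<partial>lborel)"
        using v \<beta> n by (subst ennreal_mult) (auto simp: mult.assoc nn_integral_cmult)
      finally show ?thesis .
    qed
    ultimately show ?thesis
      using ennreal_square_add_le[where m = "v - v''" and n = "v''"] v by simp
  qed
  have "(\<integral>\<^sup>+t. (\<integral>\<^sup>+x. indicator C x * F x t \<partial>lborel)\<^sup>2 \<partial>lborel) \<le> (\<integral>\<^sup>+t. ennreal v *
     ((\<integral>\<^sup>+x. ennreal (u x) * (F x t)\<^sup>2 \<partial>lborel) + (\<integral>\<^sup>+x. ennreal (\<beta> / n\<^sup>2) * indicator C' x * (G x t)\<^sup>2 \<partial>lborel)) \<partial>lborel)"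
    by (intro nn_integral_mono bnd)
  also have "\<dots> = ennreal v * ((\<integral>\<^sup>+t. (\<integral>\<^sup>+x. ennreal (u x) * (F x t)\<^sup>2 \<partial>lborel) \<partial>lborel) +
      (\<integral>\<^sup>+t. (\<integral>\<^sup>+x. ennreal (\<beta> / n\<^sup>2) * indicator C' x * (G x t)\<^sup>2 \<partial>lborel) \<partial>lborel))"
    by (subst nn_integral_cmult, measurable, subst nn_integral_add, measurable)
  also have "(\<integral>\<^sup>+t. (\<integral>\<^sup>+x. ennreal (u x) * (F x t)\<^sup>2 \<partial>lborel) \<partial>lborel) =
     (\<integral>\<^sup>+x. (\<integral>\<^sup>+t. ennreal (u x) * (F x t)\<^sup>2 \<partial>lborel) \<partial>lborel)"
    by (rule lborel_pair.Fubini') measurable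
  also have "\<dots> \<le> (\<integral>\<^sup>+x. ennreal (u x) * ennreal B \<partial>lborel)"
    using B(1) by (intro nn_integral_mono) (simp add: nn_integral_cmult mult_left_mono)
  also have "\<dots> = ennreal ((v - v'') * B)"
    using v B(2) by (simp add: nn_integral_multc int_u ennreal_mult)
  also have "(\<integral>\<^sup>+t. (\<integral>\<^sup>+x. ennreal (\<beta> / n\<^sup>2) * indicator C' x * (G x t)\<^sup>2 \<partial>lborel) \<partial>lborel) =
     (\<integral>\<^sup>+x. (\<integral>\<^sup>+t. ennreal (\<beta> / n\<^sup>2) * indicator C' x * (G x t)\<^sup>2 \<partial>lborel) \<partial>lborel)"
    by (rule lborel_pair.Fubini') measurable
  also have "\<dots> \<le> (\<integral>\<^sup>+x. ennreal (\<beta> / n\<^sup>2) * indicator C' x * ennreal (L * B) \<partial>lborel)"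
    using L(1) by (intro nn_integral_mono) (simp add: nn_integral_cmult mult_left_mono G_def)
  also have "\<dots> = ennreal (\<beta> / n\<^sup>2) * ennreal v' * ennreal (L * B)"
    by (simp add: nn_integral_multc nn_integral_cmult ev)
  also have "\<dots> = ennreal (\<beta> / n\<^sup>2 * v' * (L * B))"
  proof -
    have "0 \<le> \<beta> / n\<^sup>2" "0 \<le> v'" "0 \<le> L * B" using v B(2) L(2) \<beta> n by auto
    then show ?thesis by (simp only: ennreal_mult mult_nonneg_nonneg)
  qed
  also have "ennreal v * (ennreal ((v - v'') * B) + ennreal (\<beta> / n\<^sup>2 * v' * (L * B))) =
     ennreal (v * ((v - v'') * B + \<beta> / n\<^sup>2 * v' * (L * B)))"
    using v B(2) L(2) \<beta> n by (simp add: ennreal_mult[symmetric] ennreal_plus[symmetric] del: ennreal_plus)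
  also have "v * ((v - v'') * B + \<beta> / n\<^sup>2 * v' * (L * B)) = v * (v - v'' * (1 - L / n\<^sup>2)) * B"
    using n by (simp add: \<beta>(2)[symmetric] field_simps)
  finally show ?thesis
    by (simp add: v_def v''_def n_def add_mono mult_left_mono)
qed

section \<open>The flag bundle and half-densities\<close>

lemma continuous_matrix_mult: "continuous_on UNIV (\<lambda>(M::real^'n^'m, Z::real^'k^'n). M ** Z)"
  unfolding matrix_matrix_mult_def case_prod_beta by (intro continuous_intros)

lemma measurable_matrix_mult [measurable (raw)]:
  fixes f :: "'a \<Rightarrow> real^'n^'m" and g :: "'a \<Rightarrow> real^'k^'n"
  assumes [measurable]: "f \<in> borel_measurable M" "g \<in> borel_measurable M"
  shows "(\<lambda>x. f x ** g x) \<in> borel_measurable M"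
proof -
  have "(\<lambda>(M::real^'n^'m, Z::real^'k^'n). M ** Z) \<in> borel_measurable (borel \<Otimes>\<^sub>M borel)"
    unfolding borel_prod by (rule borel_measurable_continuous_onI[OF continuous_matrix_mult])
  from measurable_compose[OF _ this, of "\<lambda>x. (f x, g x)"] show ?thesis by simp
qed

lemma matrix_add_scaleR_vector: "(A + c *\<^sub>R (B::real^'n^'m)) *v x = A *v x + c *\<^sub>R (B *v x)"
  by (simp add: matrix_vector_mult_add_rdistrib scaleR_matrix_vector_assoc[symmetric])

text \<open>The coordinate subspace spanned by \<open>I\<close> and the two further directions \<open>p\<close>, \<open>q\<close> encode a
  partial flag \<open>V \<subseteq> V + \<langle>p, q\<rangle>\<close>. A matrix \<open>Z\<close> moves this flag; the fibre over it is the projective line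
  of \<open>\<langle>Z e\<^sub>p, Z e\<^sub>q\<rangle>\<close> modulo \<open>Z V\<close>, and \<open>shear\<close> is its affine chart.\<close>

locale partial_flag =
  fixes I :: "'d::finite set" and p q :: 'd
  assumes pI: "p \<notin> I" and qI: "q \<notin> I" and pq: "p \<noteq> q"
begin

abbreviation ep :: "real^'d" where "ep \<equiv> axis p 1"
abbreviation eq :: "real^'d" where "eq \<equiv> axis q 1"

definition V :: "(real^'d) set" where "V = {v. \<forall>i. i \<notin> I \<longrightarrow> v $ i = 0}"

lemma subspace_V: "subspace V" by (auto simp: V_def subspace_def)
lemma V_add: "u \<in> V \<Longrightarrow> v \<in> V \<Longrightarrow> u + v \<in> V" using subspace_V by (rule subspace_add)
lemma V_diff: "u \<in> V \<Longrightarrow> v \<in> V \<Longrightarrow> u - v \<in> V" using subspace_V by (rule subspace_diff)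
lemma V_scale: "u \<in> V \<Longrightarrow> c *\<^sub>R u \<in> V" using subspace_V by (rule subspace_scale)
lemma V_0 [simp]: "0 \<in> V" using subspace_V by (rule subspace_0)
lemma V_pq: "v \<in> V \<Longrightarrow> v $ p = 0" "v \<in> V \<Longrightarrow> v $ q = 0" using pI qI by (auto simp: V_def)

text \<open>The component of \<open>Z w\<close> orthogonal to \<open>Z V\<close>, in other words the
  shortest vector of the coset of \<open>Z w\<close> modulo \<open>Z V\<close>. The description
  never inverts \<open>Z\<close>, so it also serves singular matrices.\<close>

definition pr :: "real^'d^'d \<Rightarrow> real^'d \<Rightarrow> real^'d" where
  "pr Z w = (SOME y. (\<exists>v\<in>V. y = Z *v (w + v)) \<and> (\<forall>u\<in>V. y \<bullet> (Z *v u) = 0))"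

lemma pr_ex: "\<exists>v\<in>V. pr Z w = Z *v (w + v)" and pr_orth: "u \<in> V \<Longrightarrow> pr Z w \<bullet> (Z *v u) = 0"
proof -
  have sub: "subspace ((*v) Z ` V)"
    by (intro linear_subspace_image subspace_V matrix_vector_mul_linear)
  obtain y z where y: "y \<in> span ((*v) Z ` V)" and z: "\<And>w. w \<in> span ((*v) Z ` V) \<Longrightarrow> orthogonal z w"
    and yz: "Z *v w = y + z"
    using orthogonal_subspace_decomp_exists[of "(*v) Z ` V" "Z *v w"] by blast
  from y sub have "y \<in> (*v) Z ` V" by (simp add: span_eq_iff[THEN iffD2])
  then obtain v where v: "v \<in> V" "y = Z *v v" by auto
  have "z = Z *v (w + - v)"
    using yz v(2) by (simp add: matrix_vector_mult_diff_distrib)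
  moreover have "- v \<in> V" using V_scale[OF v(1), of "-1"] by simp
  moreover have "z \<bullet> (Z *v u) = 0" if "u \<in> V" for u
    using z[of "Z *v u"] that sub by (auto simp: orthogonal_def span_eq_iff[THEN iffD2])
  ultimately have "(\<exists>v\<in>V. z = Z *v (w + v)) \<and> (\<forall>u\<in>V. z \<bullet> (Z *v u) = 0)" by blast
  then have "(\<exists>v\<in>V. pr Z w = Z *v (w + v)) \<and> (\<forall>u\<in>V. pr Z w \<bullet> (Z *v u) = 0)"
    unfolding pr_def by (rule someI)
  then show "\<exists>v\<in>V. pr Z w = Z *v (w + v)" "u \<in> V \<Longrightarrow> pr Z w \<bullet> (Z *v u) = 0" by auto
qed

lemma pr_eqI:
  assumes v: "v \<in> V" and y: "y = Z *v (w + v)" and o: "\<And>u. u \<in> V \<Longrightarrow> y \<bullet> (Z *v u) = 0"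
  shows "pr Z w = y"
proof -
  obtain v' where v': "v' \<in> V" "pr Z w = Z *v (w + v')" using pr_ex by blast
  have d: "pr Z w - y = Z *v (v' - v)"
    unfolding v' y by (simp add: matrix_vector_right_distrib matrix_vector_mult_diff_distrib)
  have "(pr Z w - y) \<bullet> (Z *v (v' - v)) = 0"
    using pr_orth[of "v' - v" Z w] o[of "v' - v"] V_diff[OF v'(1) v] by (simp add: inner_diff_left)
  then show ?thesis unfolding d[symmetric] by simp
qed

text \<open>A change of frame that fixes \<open>V\<close> pointwise keeps the image of
  \<open>V\<close> and its orthogonal complement, so only the class of the argument modulo
  \<open>V\<close> counts.\<close>

lemma pr_change:
  assumes V: "\<And>v. v \<in> V \<Longrightarrow> Z' *v v = Z *v v" and v0: "v0 \<in> V" "Z' *v w = Z *v (w' + v0)"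
  shows "pr Z' w = pr Z w'"
proof -
  obtain v where v: "v \<in> V" "pr Z w' = Z *v (w' + v)" using pr_ex by blast
  show ?thesis
  proof (rule pr_eqI)
    show "v - v0 \<in> V" using V_diff v v0 by auto
    then show "pr Z w' = Z' *v (w + (v - v0))"
      using V v0 v by (simp add: matrix_vector_right_distrib matrix_vector_mult_diff_distrib)
    show "pr Z w' \<bullet> (Z' *v u) = 0" if "u \<in> V" for u using pr_orth that V by simp
  qed
qed

lemma pr_lin: "pr Z (\<alpha> *\<^sub>R w + \<beta> *\<^sub>R w') = \<alpha> *\<^sub>R pr Z w + \<beta> *\<^sub>R pr Z w'"
proof -
  obtain v v' where v: "v \<in> V" "pr Z w = Z *v (w + v)" "v' \<in> V" "pr Z w' = Z *v (w' + v')"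
    using pr_ex by metis
  show ?thesis
  proof (rule pr_eqI)
    show "\<alpha> *\<^sub>R v + \<beta> *\<^sub>R v' \<in> V" using v V_add V_scale by auto
    show "\<alpha> *\<^sub>R pr Z w + \<beta> *\<^sub>R pr Z w' = Z *v (\<alpha> *\<^sub>R w + \<beta> *\<^sub>R w' + (\<alpha> *\<^sub>R v + \<beta> *\<^sub>R v'))"
      unfolding v by (simp add: matrix_vector_right_distrib matrix_vector_mult_scaleR scaleR_add_right)
    show "(\<alpha> *\<^sub>R pr Z w + \<beta> *\<^sub>R pr Z w') \<bullet> (Z *v u) = 0" if "u \<in> V" for u
      using that pr_orth by (simp add: inner_add_left)
  qed
qed

lemma norm_pr_le: "v \<in> V \<Longrightarrow> norm (pr Z w) \<le> norm (Z *v (w + v))"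
proof -
  assume v: "v \<in> V"
  obtain v' where v': "v' \<in> V" "pr Z w = Z *v (w + v')" using pr_ex by blast
  have "Z *v (w + v) = pr Z w + Z *v (v - v')"
    unfolding v' by (simp add: matrix_vector_right_distrib matrix_vector_mult_diff_distrib)
  moreover have "pr Z w \<bullet> (Z *v (v - v')) = 0" by (rule pr_orth[OF V_diff[OF v v'(1)]])
  ultimately have "(norm (Z *v (w + v)))\<^sup>2 = (norm (pr Z w))\<^sup>2 + (norm (Z *v (v - v')))\<^sup>2"
    by (simp add: norm_add_Pythagorean orthogonal_def)
  then have "(norm (pr Z w))\<^sup>2 \<le> (norm (Z *v (w + v)))\<^sup>2" by simp
  then show ?thesis by (rule power2_le_imp_le) simp
qed

text \<open>The vector \<open>pr Z w\<close> can jump where \<open>Z\<close> loses rank on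
  \<open>V\<close>, but its norm is an infimum of continuous functions of \<open>Z\<close>, hence
  upper semicontinuous.\<close>

lemma measurable_norm_pr [measurable]: "(\<lambda>Z. norm (pr Z w)) \<in> borel_measurable borel"
proof (rule borel_measurable_iff_less[THEN iffD2], rule allI)
  fix r :: real
  have "{Z. norm (pr Z w) < r} = (\<Union>v\<in>V. {Z. norm (Z *v (w + v)) < r})"
  proof safe
    fix Z :: "real^'d^'d" assume "norm (pr Z w) < r"
    then show "Z \<in> (\<Union>v\<in>V. {Z. norm (Z *v (w + v)) < r})" using pr_ex[of Z w] by auto
  next
    fix Z :: "real^'d^'d" and v assume "v \<in> V" "norm (Z *v (w + v)) < r"
    then show "norm (pr Z w) < r" using norm_pr_le[of v Z w] by simp
  qed
  moreover have "open {Z. norm (Z *v (w + v)) < r}" for v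
  proof -
    have "linear (\<lambda>Z. Z *v (w + v))"
      by (rule linearI) (simp_all add: matrix_vector_mult_add_rdistrib scaleR_matrix_vector_assoc)
    then have "continuous_on UNIV (\<lambda>Z. Z *v (w + v))"
      by (intro linear_continuous_on) (simp add: linear_conv_bounded_linear)
    then show ?thesis by (intro open_Collect_less continuous_intros)
  qed
  ultimately have "open {Z. norm (pr Z w) < r}" by auto
  then show "{Z \<in> space borel. norm (pr Z w) < r} \<in> sets borel" by simp
qed

text \<open>Square root of the Gram determinant of the two projections. In terms of the volume
  growths \<open>G\<close> of the overview, and for \<open>Z\<close> injective on \<open>V\<close>,
  it is \<open>G_{j+1} / G_{j-1}\<close>, while \<open>norm (pr Z ep)\<close> is
  \<open>G_j / G_{j-1}\<close>.\<close>

definition area :: "real^'d^'d \<Rightarrow> real" where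
  "area Z = sqrt ((norm (pr Z ep))\<^sup>2 * (norm (pr Z eq))\<^sup>2 - (pr Z ep \<bullet> pr Z eq)\<^sup>2)"

lemma area_nonneg: "0 \<le> area Z"
  unfolding area_def using Cauchy_Schwarz_ineq[of "pr Z ep" "pr Z eq"]
  by (simp add: power2_norm_eq_inner)

lemma area_change:
  assumes a: "pr Z' ep = \<alpha> *\<^sub>R pr Z ep + \<beta> *\<^sub>R pr Z eq" and b: "pr Z' eq = \<gamma> *\<^sub>R pr Z ep + \<delta> *\<^sub>R pr Z eq"
  shows "area Z' = \<bar>\<alpha> * \<delta> - \<beta> * \<gamma>\<bar> * area Z"
proof -
  have "(norm (pr Z' ep))\<^sup>2 * (norm (pr Z' eq))\<^sup>2 - (pr Z' ep \<bullet> pr Z' eq)\<^sup>2 =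
    (\<alpha> * \<delta> - \<beta> * \<gamma>)\<^sup>2 * ((norm (pr Z ep))\<^sup>2 * (norm (pr Z eq))\<^sup>2 - (pr Z ep \<bullet> pr Z eq)\<^sup>2)"
  proof -
    define A B C where "A = pr Z ep \<bullet> pr Z ep" and "B = pr Z eq \<bullet> pr Z eq" and "C = pr Z ep \<bullet> pr Z eq"
    have "pr Z' ep \<bullet> pr Z' ep = \<alpha> * \<alpha> * A + 2 * \<alpha> * \<beta> * C + \<beta> * \<beta> * B"
      "pr Z' eq \<bullet> pr Z' eq = \<gamma> * \<gamma> * A + 2 * \<gamma> * \<delta> * C + \<delta> * \<delta> * B"
      "pr Z' ep \<bullet> pr Z' eq = \<alpha> * \<gamma> * A + (\<alpha> * \<delta> + \<beta> * \<gamma>) * C + \<beta> * \<delta> * B"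
      unfolding a b A_def B_def C_def
      by (simp_all add: inner_add_left inner_add_right inner_commute[of "pr Z eq" "pr Z ep"] algebra_simps)
    then show ?thesis
      unfolding power2_norm_eq_inner A_def[symmetric] B_def[symmetric] C_def[symmetric]
      by (simp add: power2_eq_square algebra_simps)
  qed
  then show ?thesis by (simp add: area_def real_sqrt_mult)
qed

text \<open>Expressed as the vanishing of a projected combination, degeneracy visibly survives
  multiplication from the left, even by a singular matrix.\<close>

lemma area_zero_iff: "area Z = 0 \<longleftrightarrow> (\<exists>\<alpha> \<beta>. (\<alpha> \<noteq> 0 \<or> \<beta> \<noteq> 0) \<and> pr Z (\<alpha> *\<^sub>R ep + \<beta> *\<^sub>R eq) = 0)"
proof
  let ?a = "pr Z ep" and ?b = "pr Z eq"
  assume "area Z = 0"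
  then have z: "(?a \<bullet> ?a) * (?b \<bullet> ?b) = (?a \<bullet> ?b)\<^sup>2" by (simp add: area_def power2_norm_eq_inner)
  show "\<exists>\<alpha> \<beta>. (\<alpha> \<noteq> 0 \<or> \<beta> \<noteq> 0) \<and> pr Z (\<alpha> *\<^sub>R ep + \<beta> *\<^sub>R eq) = 0"
  proof (cases "?b = 0")
    case True
    then show ?thesis by (intro exI[of _ 0] exI[of _ 1]) (simp add: pr_lin[of Z 0 _ 1, simplified] )
  next
    case False
    define r where "r = (?b \<bullet> ?b) *\<^sub>R ?a + (- (?a \<bullet> ?b)) *\<^sub>R ?b"
    have "r \<bullet> r = (?b \<bullet> ?b) * ((?a \<bullet> ?a) * (?b \<bullet> ?b) - (?a \<bullet> ?b)\<^sup>2)"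
      unfolding r_def by (simp add: inner_add_left inner_add_right inner_diff_left inner_diff_right
        inner_commute[of ?b ?a] power2_eq_square algebra_simps)
    then have "r = 0" unfolding z by simp
    then have "pr Z ((?b \<bullet> ?b) *\<^sub>R ep + (- (?a \<bullet> ?b)) *\<^sub>R eq) = 0" unfolding pr_lin r_def .
    then show ?thesis using False by (intro exI[of _ "?b \<bullet> ?b"] exI[of _ "- (?a \<bullet> ?b)"]) auto
  qed
next
  let ?a = "pr Z ep" and ?b = "pr Z eq"
  assume "\<exists>\<alpha> \<beta>. (\<alpha> \<noteq> 0 \<or> \<beta> \<noteq> 0) \<and> pr Z (\<alpha> *\<^sub>R ep + \<beta> *\<^sub>R eq) = 0"
  then obtain \<alpha> \<beta> where n: "\<alpha> \<noteq> 0 \<or> \<beta> \<noteq> 0" and "pr Z (\<alpha> *\<^sub>R ep + \<beta> *\<^sub>R eq) = 0" by blast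
  then have z: "\<alpha> *\<^sub>R ?a + \<beta> *\<^sub>R ?b = 0" by (simp only: pr_lin)
  have e: "\<alpha> * (x \<bullet> ?a) + \<beta> * (x \<bullet> ?b) = 0" for x
  proof -
    have "x \<bullet> (\<alpha> *\<^sub>R ?a + \<beta> *\<^sub>R ?b) = 0" unfolding z by simp
    then show ?thesis by (simp add: inner_add_right)
  qed
  have "(?a \<bullet> ?a) * (?b \<bullet> ?b) - (?a \<bullet> ?b)\<^sup>2 = 0"
  proof (cases "\<alpha> = 0")
    case True
    then have "?b = 0" using n z by simp
    then show ?thesis by simp
  next
    case False
    have "\<alpha> * ((?a \<bullet> ?a) * (?b \<bullet> ?b) - (?a \<bullet> ?b)\<^sup>2) =
       (\<alpha> * (?a \<bullet> ?a) + \<beta> * (?a \<bullet> ?b)) * (?b \<bullet> ?b) - (\<alpha> * (?b \<bullet> ?a) + \<beta> * (?b \<bullet> ?b)) * (?a \<bullet> ?b)"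
      by (simp add: power2_eq_square algebra_simps inner_commute[of ?b ?a])
    then have "\<alpha> * ((?a \<bullet> ?a) * (?b \<bullet> ?b) - (?a \<bullet> ?b)\<^sup>2) = 0" unfolding e by simp
    then show ?thesis using False by simp
  qed
  then show "area Z = 0" by (simp add: area_def power2_norm_eq_inner)
qed

lemma area_mult_zero: "area Z = 0 \<Longrightarrow> area (M ** Z) = 0"
proof -
  assume "area Z = 0"
  then obtain \<alpha> \<beta> where n: "\<alpha> \<noteq> 0 \<or> \<beta> \<noteq> 0" and z: "pr Z (\<alpha> *\<^sub>R ep + \<beta> *\<^sub>R eq) = 0"
    unfolding area_zero_iff by blast
  obtain v where v: "v \<in> V" "pr Z (\<alpha> *\<^sub>R ep + \<beta> *\<^sub>R eq) = Z *v (\<alpha> *\<^sub>R ep + \<beta> *\<^sub>R eq + v)" using pr_ex by blast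
  have "pr (M ** Z) (\<alpha> *\<^sub>R ep + \<beta> *\<^sub>R eq) = 0"
  proof (rule pr_eqI[OF v(1)])
    show "0 = M ** Z *v (\<alpha> *\<^sub>R ep + \<beta> *\<^sub>R eq + v)"
      using z v(2) by (simp add: matrix_vector_mul_assoc[symmetric])
  qed simp
  then show ?thesis using n unfolding area_zero_iff by blast
qed

text \<open>Measurability is available for norms of \<open>pr\<close> only, so the inner product is
  recovered by polarisation.\<close>

lemma measurable_area [measurable]: "area \<in> borel_measurable borel"
proof -
  have "area Z = sqrt ((norm (pr Z ep))\<^sup>2 * (norm (pr Z eq))\<^sup>2 -
      (((norm (pr Z (1 *\<^sub>R ep + 1 *\<^sub>R eq)))\<^sup>2 - (norm (pr Z (1 *\<^sub>R ep + (-1) *\<^sub>R eq)))\<^sup>2) / 4)\<^sup>2)" for Z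
  proof -
    have "((norm (pr Z (1 *\<^sub>R ep + 1 *\<^sub>R eq)))\<^sup>2 - (norm (pr Z (1 *\<^sub>R ep + (-1) *\<^sub>R eq)))\<^sup>2) / 4 = pr Z ep \<bullet> pr Z eq"
      unfolding pr_lin power2_norm_eq_inner
      by (simp add: inner_add_left inner_add_right inner_diff_left inner_diff_right inner_commute)
    then show ?thesis unfolding area_def by simp
  qed
  then show ?thesis by (subst cong[OF refl ext]) measurable
qed

text \<open>The square root of the Jacobian of the fibre map at the line of \<open>e\<^sub>p\<close>.\<close>

definition phi :: "real^'d^'d \<Rightarrow> ennreal" where
  "phi Z = ennreal (sqrt (area Z) / norm (pr Z ep))"

text \<open>On the flag, \<open>Z'\<close> is \<open>Z\<close> times a matrix that fixes
  \<open>V\<close> pointwise, preserves the line of \<open>ep\<close> modulo \<open>V\<close> and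
  has diagonal entries \<open>\<alpha>\<close>, \<open>\<beta>\<close> there. The relation is stated
  through images because \<open>Z\<close> may be singular; it leaves the coordinates outside the
  flag unconstrained.\<close>

definition parabolic :: "real^'d^'d \<Rightarrow> real^'d^'d \<Rightarrow> real \<Rightarrow> real \<Rightarrow> bool" where
  "parabolic Z Z' \<alpha> \<beta> \<longleftrightarrow> \<alpha> \<noteq> 0 \<and> \<beta> \<noteq> 0 \<and> (\<forall>v\<in>V. Z' *v v = Z *v v) \<and>
    (\<exists>v\<in>V. Z' *v ep = Z *v (\<alpha> *\<^sub>R ep + v)) \<and> (\<exists>\<gamma>. \<exists>v\<in>V. Z' *v eq = Z *v (\<gamma> *\<^sub>R ep + \<beta> *\<^sub>R eq + v))"

text \<open>The character of a half-density on the fibre: the square of \<open>f\<close> changes by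
  the Jacobian of the change of fibre coordinate, so its integral does not depend on the frame. The
  value 0 at degenerate \<open>Z\<close> makes these frames trivial in every estimate.\<close>

definition half_density :: "(real^'d^'d \<Rightarrow> ennreal) \<Rightarrow> bool" where
  "half_density f \<longleftrightarrow> f \<in> borel_measurable borel \<and>
     (\<forall>Z Z' \<alpha> \<beta>. parabolic Z Z' \<alpha> \<beta> \<longrightarrow> f Z' = ennreal (sqrt (\<bar>\<beta>\<bar> / \<bar>\<alpha>\<bar>)) * f Z) \<and>
     (\<forall>Z. area Z = 0 \<longrightarrow> f Z = 0)"

lemma parabolic_mult: "parabolic Z Z' \<alpha> \<beta> \<Longrightarrow> parabolic (M ** Z) (M ** Z') \<alpha> \<beta>"
  unfolding parabolic_def by (auto simp: matrix_vector_mul_assoc[symmetric]) metis+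

lemma half_density_measurable: "half_density f \<Longrightarrow> f \<in> borel_measurable borel"
  by (simp add: half_density_def)

text \<open>Under a parabolic change the area scales by the product of the moduli of
  \<open>\<alpha>\<close> and \<open>\<beta>\<close>, the length of the projected \<open>ep\<close>
  by the modulus of \<open>\<alpha>\<close> alone.\<close>

lemma half_density_phi: "half_density phi"
  unfolding half_density_def
proof (intro conjI allI impI)
  show "phi \<in> borel_measurable borel" unfolding phi_def by measurable
  show "phi Z = 0" if "area Z = 0" for Z using that by (simp add: phi_def)
  fix Z Z' \<alpha> \<beta> assume r: "parabolic Z Z' \<alpha> \<beta>"
  then have V: "\<And>v. v \<in> V \<Longrightarrow> Z' *v v = Z *v v" and nz: "\<alpha> \<noteq> 0" "\<beta> \<noteq> 0" by (auto simp: parabolic_def)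
  obtain v where "v \<in> V" "Z' *v ep = Z *v (\<alpha> *\<^sub>R ep + v)" using r by (auto simp: parabolic_def)
  from pr_change[OF V this] have a: "pr Z' ep = \<alpha> *\<^sub>R pr Z ep + 0 *\<^sub>R pr Z eq"
    using pr_lin[of Z \<alpha> ep 0 eq] by simp
  obtain \<gamma> v where "v \<in> V" "Z' *v eq = Z *v (\<gamma> *\<^sub>R ep + \<beta> *\<^sub>R eq + v)" using r by (auto simp: parabolic_def)
  from pr_change[OF V this] have b: "pr Z' eq = \<gamma> *\<^sub>R pr Z ep + \<beta> *\<^sub>R pr Z eq" by (simp only: pr_lin)
  have ar: "area Z' = \<bar>\<alpha>\<bar> * \<bar>\<beta>\<bar> * area Z" using area_change[OF a b] by (simp add: abs_mult)
  have "\<bar>\<alpha>\<bar> * \<bar>\<beta>\<bar> = \<bar>\<alpha>\<bar>\<^sup>2 * (\<bar>\<beta>\<bar> / \<bar>\<alpha>\<bar>)" 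
    using nz by (simp add: power2_eq_square del: abs_mult_self_eq)
  then have al: "sqrt (area Z') = \<bar>\<alpha>\<bar> * sqrt (\<bar>\<beta>\<bar> / \<bar>\<alpha>\<bar>) * sqrt (area Z)"
    unfolding ar by (simp only: real_sqrt_mult) simp
  have "sqrt (area Z') / norm (pr Z' ep) = sqrt (\<bar>\<beta>\<bar> / \<bar>\<alpha>\<bar>) * (sqrt (area Z) / norm (pr Z ep))"
    unfolding al a using nz by simp
  then show "phi Z' = ennreal (sqrt (\<bar>\<beta>\<bar> / \<bar>\<alpha>\<bar>)) * phi Z"
    unfolding phi_def by (simp add: ennreal_mult[symmetric] area_nonneg)
qed

text \<open>The columns of the block are \<open>(a, b)\<close> and \<open>(c, d)\<close>. In
  particular \<open>shear t\<close> sends \<open>ep\<close> to \<open>ep + t *\<^sub>R eq\<close>,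
  so \<open>t\<close> is the slope of a line in the fibre.\<close>

definition blk :: "real \<Rightarrow> real \<Rightarrow> real \<Rightarrow> real \<Rightarrow> real^'d^'d" where
  "blk a b c d = matrix (\<lambda>x. x + ((a - 1) * x $ p + c * x $ q) *\<^sub>R ep + (b * x $ p + (d - 1) * x $ q) *\<^sub>R eq)"

lemma blk_mult: "blk a b c d *v x = x + ((a - 1) * x $ p + c * x $ q) *\<^sub>R ep + (b * x $ p + (d - 1) * x $ q) *\<^sub>R eq"
  unfolding blk_def
  by (rule matrix_works, unfold linear_matrix_vector_mul_eq) (auto intro!: linearI simp: algebra_simps)

lemma blk_V: "v \<in> V \<Longrightarrow> blk a b c d *v v = v" by (simp add: blk_mult V_pq)

lemma blk_ep: "blk a b c d *v ep = a *\<^sub>R ep + b *\<^sub>R eq"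
  using pq by (simp add: blk_mult axis_def vec_eq_iff)

lemma blk_eq: "blk a b c d *v eq = c *\<^sub>R ep + d *\<^sub>R eq"
  using pq by (simp add: blk_mult axis_def vec_eq_iff)

abbreviation "shear t \<equiv> blk 1 t 0 1"

lemma pr_shear: "pr (Z ** shear t) ep = 1 *\<^sub>R pr Z ep + t *\<^sub>R pr Z eq"
  by (subst pr_lin[symmetric], rule pr_change[OF _ V_0])
     (auto simp: matrix_vector_mul_assoc[symmetric] blk_V blk_ep)

lemma area_shear: "area (Z ** shear t) = area Z"
proof -
  have *: "pr (Z ** shear t) eq = 0 *\<^sub>R pr Z ep + 1 *\<^sub>R pr Z eq"
    by (subst pr_lin[symmetric], rule pr_change[OF _ V_0])
       (auto simp: matrix_vector_mul_assoc[symmetric] blk_V blk_eq)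
  show ?thesis using area_change[OF pr_shear *] by simp
qed

text \<open>Squared norm in \<open>L^2\<close> of the fibre over \<open>Z\<close>, in a chart that
  misses only the line of \<open>eq\<close>, a null set.\<close>

definition mass :: "(real^'d^'d \<Rightarrow> ennreal) \<Rightarrow> real^'d^'d \<Rightarrow> ennreal" where
  "mass f Z = (\<integral>\<^sup>+t. (f (Z ** shear t))\<^sup>2 \<partial>lborel)"

lemma shear_eq: "shear t = mat 1 + t *\<^sub>R (shear 1 - mat 1)"
  by (simp add: matrix_eq matrix_add_scaleR_vector blk_mult matrix_vector_mult_diff_rdistrib)

lemma measurable_shear [measurable]: "shear \<in> borel_measurable borel"
  by (subst ext[OF shear_eq]) measurable

lemma mass_degenerate: "half_density f \<Longrightarrow> area Z = 0 \<Longrightarrow> mass f Z = 0"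
  unfolding mass_def half_density_def by (simp add: area_shear)

end

section \<open>Uniform noise on the cube and its averaging operator\<close>

definition cube :: "real \<Rightarrow> (real^'d^'d) set" where
  "cube r = {X. \<forall>i j. \<bar>X $ i $ j\<bar> \<le> r}"

lemma cube_cbox: "cube r = cbox (\<chi> i j. - r) (\<chi> i j. r)"
  by (auto simp: cube_def mem_box Basis_vec_def inner_axis abs_le_iff) (metis minus_le_iff)+

lemma cube_borel [measurable]: "cube r \<in> sets borel"
  unfolding cube_cbox by simp

lemma emeasure_cube_finite: "emeasure lborel (cube r) \<noteq> \<infinity>"
  unfolding cube_cbox using emeasure_lborel_cbox_finite by (metis infinity_ennreal_def less_irrefl)

lemma measure_cube_pos: "0 < r \<Longrightarrow> 0 < measure lborel (cube r)"
  unfolding cube_cbox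
  by (rule content_pos_lt) (auto simp: Basis_vec_def inner_axis)

lemma cube_mono: "r \<le> s \<Longrightarrow> cube r \<subseteq> cube s"
  unfolding cube_def by (auto intro: order_trans)

lemma prob_space_uniform_cube: "prob_space (uniform_measure lborel (cube 1 :: (real^'d^'d) set))"
proof (rule prob_space_uniform_measure)
  show "emeasure lborel (cube 1 :: (real^'d^'d) set) \<noteq> 0"
  proof
    assume "emeasure lborel (cube 1 :: (real^'d^'d) set) = 0"
    then have "measure lborel (cube 1 :: (real^'d^'d) set) = 0" by (simp add: measure_def)
    moreover have "0 < measure lborel (cube 1 :: (real^'d^'d) set)" by (rule measure_cube_pos) simp
    ultimately show False by simp
  qed
qed (use emeasure_cube_finite in simp)

text \<open>Transition operator of one step. The random factor acts on the left and therefore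
  commutes with changes of frame, which act on the right; this is why half-densities are
  preserved.\<close>

definition noise_avg :: "real^'d^'d \<Rightarrow> real \<Rightarrow> (real^'d^'d \<Rightarrow> ennreal) \<Rightarrow> real^'d^'d \<Rightarrow> ennreal" where
  "noise_avg A \<epsilon> f Z = (\<integral>\<^sup>+X. f ((A + \<epsilon> *\<^sub>R X) ** Z) \<partial>uniform_measure lborel (cube 1))"

lemma measurable_noise_avg:
  assumes [measurable]: "f \<in> borel_measurable borel"
  shows "noise_avg A \<epsilon> f \<in> borel_measurable borel"
proof -
  interpret prob_space "uniform_measure lborel (cube 1) :: (real^'a^'a) measure"
    by (rule prob_space_uniform_cube)
  show ?thesis unfolding noise_avg_def by measurable
qed

context partial_flag
begin

lemma half_density_noise_avg:
  assumes f: "half_density f"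
  shows "half_density (noise_avg A \<epsilon> f)"
proof -
  have [measurable]: "f \<in> borel_measurable borel" using f by (rule half_density_measurable)
  show ?thesis
    unfolding half_density_def
  proof (intro conjI allI impI)
    show "noise_avg A \<epsilon> f \<in> borel_measurable borel" by (rule measurable_noise_avg) fact
    fix Z Z' \<alpha> \<beta> assume "parabolic Z Z' \<alpha> \<beta>"
    then have "f (M ** Z') = ennreal (sqrt (\<bar>\<beta>\<bar> / \<bar>\<alpha>\<bar>)) * f (M ** Z)" for M
      using f parabolic_mult unfolding half_density_def by blast
    then show "noise_avg A \<epsilon> f Z' = ennreal (sqrt (\<bar>\<beta>\<bar> / \<bar>\<alpha>\<bar>)) * noise_avg A \<epsilon> f Z"
      unfolding noise_avg_def by (simp add: nn_integral_cmult)
  next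
    fix Z assume "area Z = 0"
    then have "f (M ** Z) = 0" for M using f area_mult_zero unfolding half_density_def by blast
    then show "noise_avg A \<epsilon> f Z = 0" unfolding noise_avg_def by simp
  qed
qed

text \<open>Gram--Schmidt in the fibre, keeping the line of \<open>eq\<close>: the chart parameter
  then changes affinely, to \<open>\<delta> + (rB / rA) * t\<close>, and the half-density law
  supplies exactly the Jacobian. Hence an orthonormal frame may be assumed whenever a mass is
  estimated.\<close>

lemma normal_form:
  assumes nz: "area Z \<noteq> 0"
  obtains Z' where "\<And>f. half_density f \<Longrightarrow> mass f Z' = mass f Z"
    "norm (Z' *v ep) = 1" "norm (Z' *v eq) = 1" "(Z' *v ep) \<bullet> (Z' *v eq) = 0"
    "\<And>v. v \<in> V \<Longrightarrow> (Z' *v ep) \<bullet> (Z' *v v) = 0" "\<And>v. v \<in> V \<Longrightarrow> (Z' *v eq) \<bullet> (Z' *v v) = 0"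
proof -
  define a b where "a = pr Z ep" and "b = pr Z eq"
  have b0: "b \<noteq> 0" using nz unfolding area_def b_def by auto
  define \<delta> where "\<delta> = - (a \<bullet> b) / (b \<bullet> b)"
  define a' where "a' = a + \<delta> *\<^sub>R b"
  have ab: "a' \<bullet> b = 0" using b0 by (simp add: a'_def \<delta>_def inner_diff_left)
  have a0: "a' \<noteq> 0"
  proof
    assume "a' = 0"
    then have "pr Z (1 *\<^sub>R ep + \<delta> *\<^sub>R eq) = 0" unfolding pr_lin by (simp add: a'_def a_def b_def)
    then show False using nz area_zero_iff[of Z] by (metis zero_neq_one)
  qed
  define rA rB where "rA = 1 / norm a'" and "rB = 1 / norm b"
  have r: "rA > 0" "rB > 0" using a0 b0 by (auto simp: rA_def rB_def)
  obtain va where va: "va \<in> V" "a = Z *v (ep + va)" using pr_ex a_def by metis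
  obtain vb where vb: "vb \<in> V" "b = Z *v (eq + vb)" using pr_ex b_def by metis
  define Z' where "Z' = matrix (\<lambda>x. Z *v (x - x $ p *\<^sub>R ep - x $ q *\<^sub>R eq) + (x $ p * rA) *\<^sub>R a' + (x $ q * rB) *\<^sub>R b)"
  have Z': "Z' *v x = Z *v (x - x $ p *\<^sub>R ep - x $ q *\<^sub>R eq) + (x $ p * rA) *\<^sub>R a' + (x $ q * rB) *\<^sub>R b" for x
    unfolding Z'_def
    by (rule matrix_works, unfold linear_matrix_vector_mul_eq)
       (auto intro!: linearI simp: algebra_simps matrix_vector_right_distrib matrix_vector_mult_diff_distrib
          matrix_vector_mult_scaleR)
  have Zv: "Z' *v v = Z *v v" if "v \<in> V" for v using that by (simp add: Z' V_pq)
  have Zp: "Z' *v ep = rA *\<^sub>R a'" and Zq: "Z' *v eq = rB *\<^sub>R b"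
    using pq by (simp_all add: Z' axis_def)
  have orth: "a' \<bullet> (Z *v v) = 0" "b \<bullet> (Z *v v) = 0" if "v \<in> V" for v
    using that pr_orth by (simp_all add: a'_def a_def b_def inner_add_left)
  show ?thesis
  proof (rule that[of Z'])
    show "norm (Z' *v ep) = 1" "norm (Z' *v eq) = 1" "(Z' *v ep) \<bullet> (Z' *v eq) = 0"
      using a0 b0 ab by (simp_all add: Zp Zq rA_def rB_def)
    show "(Z' *v ep) \<bullet> (Z' *v v) = 0" "(Z' *v eq) \<bullet> (Z' *v v) = 0" if "v \<in> V" for v
      using orth that by (simp_all add: Zp Zq Zv)
    fix f assume f: "half_density f"
    then have [measurable]: "f \<in> borel_measurable borel" by (rule half_density_measurable)
    have "f (Z' ** shear t) = ennreal (sqrt (rB / rA)) * f (Z ** shear (\<delta> + (rB / rA) * t))" for t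
    proof -
      define s where "s = \<delta> + (rB / rA) * t"
      have s: "rA * s = rA * \<delta> + rB * t" using r by (simp add: s_def field_simps)
      have "parabolic (Z ** shear s) (Z' ** shear t) rA rB"
        unfolding parabolic_def
      proof (intro conjI ballI)
        show "rA \<noteq> 0" "rB \<noteq> 0" using r by auto
        show "Z' ** shear t *v v = Z ** shear s *v v" if "v \<in> V" for v
          using that by (simp add: matrix_vector_mul_assoc[symmetric] blk_V Zv)
        show "\<exists>v\<in>V. Z' ** shear t *v ep = Z ** shear s *v (rA *\<^sub>R ep + v)"
        proof
          let ?v = "rA *\<^sub>R va + (rA * s) *\<^sub>R vb"
          show V: "?v \<in> V" using va vb V_add V_scale by auto
          show "Z' ** shear t *v ep = Z ** shear s *v (rA *\<^sub>R ep + ?v)"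
            unfolding s using s
            by (simp add: matrix_vector_mul_assoc[symmetric] blk_ep Zp Zq a'_def va(2) vb(2)
                matrix_vector_right_distrib matrix_vector_mult_scaleR blk_V va(1) vb(1) algebra_simps)
        qed
        show "\<exists>\<gamma>. \<exists>v\<in>V. Z' ** shear t *v eq = Z ** shear s *v (\<gamma> *\<^sub>R ep + rB *\<^sub>R eq + v)"
          by (rule exI[of _ 0], rule bexI[of _ "rB *\<^sub>R vb"])
             (auto simp: V_scale vb(1) matrix_vector_mul_assoc[symmetric] blk_eq blk_V Zp Zq vb(2)
                matrix_vector_right_distrib matrix_vector_mult_scaleR algebra_simps)
      qed
      then show ?thesis using f r unfolding half_density_def s_def by auto
    qed
    then have "mass f Z' = (\<integral>\<^sup>+t. ennreal \<bar>rB / rA\<bar> * (f (Z ** shear (\<delta> + (rB / rA) * t)))\<^sup>2 \<partial>lborel)"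
      unfolding mass_def using r by (simp add: power_mult_distrib ennreal_power)
    also have "\<dots> = ennreal \<bar>rB / rA\<bar> * (\<integral>\<^sup>+t. (f (Z ** shear (\<delta> + (rB / rA) * t)))\<^sup>2 \<partial>lborel)"
      by (rule nn_integral_cmult) measurable
    also have "\<dots> = mass f Z"
      unfolding mass_def by (rule nn_integral_real_affine[symmetric]) (use r in auto)
    finally show "mass f Z' = mass f Z" .
  qed
qed

text \<open>In an orthonormal frame \<open>phi\<close> is the rotation invariant half-density, with
  square \<open>1 / (1 + t^2)\<close>; all nondegenerate frames have this same mass.\<close>

lemma mass_phi_le:
  "mass phi Z \<le> (\<integral>\<^sup>+t. ennreal (1 / (1 + t\<^sup>2)) \<partial>lborel)"
proof (cases "area Z = 0")
  case True
  then show ?thesis using mass_degenerate half_density_phi by simp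
next
  case False
  then obtain Z' where m: "mass phi Z' = mass phi Z"
    and n: "norm (Z' *v ep) = 1" "norm (Z' *v eq) = 1" "(Z' *v ep) \<bullet> (Z' *v eq) = 0"
    "\<And>v. v \<in> V \<Longrightarrow> (Z' *v ep) \<bullet> (Z' *v v) = 0" "\<And>v. v \<in> V \<Longrightarrow> (Z' *v eq) \<bullet> (Z' *v v) = 0"
    using normal_form half_density_phi by metis
  have p: "pr Z' ep = Z' *v ep" "pr Z' eq = Z' *v eq"
    using n(4,5) by (auto intro!: pr_eqI[OF V_0])
  have "phi (Z' ** shear t) = ennreal (1 / sqrt (1 + t\<^sup>2))" for t
  proof -
    have "area (Z' ** shear t) = 1" unfolding area_shear using p n by (simp add: area_def)
    moreover have "norm (pr (Z' ** shear t) ep) = sqrt (1 + t\<^sup>2)"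
      unfolding pr_shear p norm_eq_sqrt_inner using n
      by (simp add: inner_add_left inner_add_right norm_eq_1 inner_commute power2_eq_square)
    ultimately show ?thesis by (simp add: phi_def)
  qed
  then have "mass phi Z' = (\<integral>\<^sup>+t. ennreal (1 / (1 + t\<^sup>2)) \<partial>lborel)"
    unfolding mass_def by (simp add: ennreal_power power_divide)
  then show ?thesis using m by simp
qed

end

section \<open>Contraction by the noise\<close>

lemma matrix_mult_entry_bound:
  fixes Y E :: "real^'d^'d"
  assumes Y: "\<And>i l. \<bar>Y $ i $ l\<bar> \<le> y" and E: "\<And>l j. \<bar>E $ l $ j\<bar> \<le> e" and "0 \<le> y"
  shows "\<bar>(Y ** E) $ i $ j\<bar> \<le> real CARD('d) * (y * e)"
proof -
  have "\<bar>(Y ** E) $ i $ j\<bar> \<le> (\<Sum>l\<in>UNIV. \<bar>Y $ i $ l * E $ l $ j\<bar>)"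
    unfolding matrix_matrix_mult_def by (simp add: sum_abs)
  also have "\<dots> \<le> (\<Sum>l\<in>(UNIV::'d set). y * e)"
    using assms by (intro sum_mono) (auto simp: abs_mult intro!: mult_mono)
  finally show ?thesis by simp
qed

context partial_flag
begin

text \<open>The matrices \<open>R k\<close> act by elements of \<open>SL_2\<close> on the
  orthonormal pair \<open>u\<close>, \<open>w\<close> and fix its orthogonal complement, hence
  \<open>Z V\<close>. As right factors of \<open>A + \<epsilon> *\<^sub>R X\<close> they amount to
  the affine maps \<open>\<tau> k\<close> of the noise; seen in the fibre they are Moebius maps to
  which Schur's test applies.\<close>

lemma mass_noise_avg_le_normal:
  fixes A Z :: "real^'d^'d" and \<epsilon> a0 b0 B :: real
  assumes f: "half_density f" and mB: "\<And>Y. mass f Y \<le> ennreal B" and B: "0 \<le> B"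
    and A: "\<And>i j. \<bar>A $ i $ j\<bar> \<le> 1" and \<epsilon>: "0 < \<epsilon>"
    and ab: "a0\<^sup>2 - b0\<^sup>2 = 1" "0 < a0" "4 * a0\<^sup>2 * b0\<^sup>2 \<le> 1 / 5"
    and small: "real CARD('d) * ((1 + 1 / \<epsilon>) * (2 * \<bar>a0 - 1\<bar> + 2 * \<bar>b0\<bar>)) \<le> 1 / 4"
    and n: "norm (Z *v ep) = 1" "norm (Z *v eq) = 1" "(Z *v ep) \<bullet> (Z *v eq) = 0"
      "\<And>v. v \<in> V \<Longrightarrow> (Z *v ep) \<bullet> (Z *v v) = 0" "\<And>v. v \<in> V \<Longrightarrow> (Z *v eq) \<bullet> (Z *v v) = 0"
  shows "mass (noise_avg A \<epsilon> f) Z \<le>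
    ennreal ((1 - measure lborel (cube (1/4) :: (real^'d^'d) set) / measure lborel (cube 1 :: (real^'d^'d) set) *
      (a0\<^sup>2 * b0\<^sup>2 / 4)) * B)"
proof -
  have [measurable]: "f \<in> borel_measurable borel" using f by (rule half_density_measurable)
  define u w where "u = Z *v ep" and "w = Z *v eq"
  have uw: "u \<bullet> u = 1" "w \<bullet> w = 1" "u \<bullet> w = 0" "w \<bullet> u = 0"
    using n by (simp_all add: u_def w_def norm_eq_1 inner_commute)
  \<comment> \<open>Symmetric matrices with diagonal \<open>Sa\<close>, \<open>Sd\<close> and
    off-diagonal entry \<open>Sb\<close>; \<open>a0\<close> and \<open>b0\<close> play the roles of
    cosh and sinh. The indices 0 and 1 are inverse to each other, and so are 2 and 3.\<close>
  define Sa Sd Sb :: "nat \<Rightarrow> real" and iv :: "nat \<Rightarrow> nat" where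
    "Sa k = (if k = 0 then a0 + b0 else if k = 1 then a0 - b0 else a0)" and
    "Sd k = (if k = 0 then a0 - b0 else if k = 1 then a0 + b0 else a0)" and
    "Sb k = (if k = 2 then b0 else if k = 3 then - b0 else 0)" and
    "iv k = (if k = 0 then 1 else if k = 1 then 0 else if k = 2 then 3 else 2)" for k
  note S_defs = Sa_def Sb_def Sd_def iv_def
  let ?K = "{0, 1, 2, 3 :: nat}"
  have det: "Sa k * Sd k - Sb k * Sb k = 1" if "k \<in> ?K" for k
    using that ab(1) by (auto simp: S_defs power2_eq_square algebra_simps)
  have iv: "iv k \<in> ?K" "iv (iv k) = k" "Sa (iv k) = Sd k" "Sd (iv k) = Sa k" "Sb (iv k) = - Sb k" if "k \<in> ?K" for k
    using that by (auto simp: S_defs)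
  define R where "R k = matrix (\<lambda>x. x + ((Sa k - 1) * (u \<bullet> x) + Sb k * (w \<bullet> x)) *\<^sub>R u +
      (Sb k * (u \<bullet> x) + (Sd k - 1) * (w \<bullet> x)) *\<^sub>R w)" for k
  have R: "R k *v x = x + ((Sa k - 1) * (u \<bullet> x) + Sb k * (w \<bullet> x)) *\<^sub>R u +
      (Sb k * (u \<bullet> x) + (Sd k - 1) * (w \<bullet> x)) *\<^sub>R w" for k x
    unfolding R_def
    by (rule matrix_works, unfold linear_matrix_vector_mul_eq)
       (auto intro!: linearI simp: algebra_simps inner_add_right)
  have RV: "R k *v (Z *v v) = Z *v v" if "v \<in> V" for k v
    using n(4,5)[OF that] by (simp add: R u_def w_def)
  have Ru: "R k *v u = Sa k *\<^sub>R u + Sb k *\<^sub>R w" and Rw: "R k *v w = Sb k *\<^sub>R u + Sd k *\<^sub>R w" for k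
    unfolding R using uw by (simp_all add: algebra_simps)
  have RR: "R k ** R (iv k) = mat 1" if k: "k \<in> ?K" for k
  proof -
    have "R k *v (R (iv k) *v x) = x" for x
    proof -
      have 1: "u \<bullet> (R (iv k) *v x) = Sd k * (u \<bullet> x) - Sb k * (w \<bullet> x)"
        "w \<bullet> (R (iv k) *v x) = - Sb k * (u \<bullet> x) + Sa k * (w \<bullet> x)"
        unfolding R iv[OF k] using uw by (simp_all add: inner_add_right algebra_simps)
      have "R k *v (R (iv k) *v x) = x +
         ((Sd k - 1) * (u \<bullet> x) - Sb k * (w \<bullet> x) + ((Sa k - 1) * (Sd k * (u \<bullet> x) - Sb k * (w \<bullet> x)) +
            Sb k * (- Sb k * (u \<bullet> x) + Sa k * (w \<bullet> x)))) *\<^sub>R u +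
         (- Sb k * (u \<bullet> x) + (Sa k - 1) * (w \<bullet> x) + (Sb k * (Sd k * (u \<bullet> x) - Sb k * (w \<bullet> x)) +
            (Sd k - 1) * (- Sb k * (u \<bullet> x) + Sa k * (w \<bullet> x)))) *\<^sub>R w"
        unfolding R[of k "R (iv k) *v x"] 1 unfolding R iv[OF k] by (simp add: scaleR_add_left)
      also have "(Sd k - 1) * (u \<bullet> x) - Sb k * (w \<bullet> x) + ((Sa k - 1) * (Sd k * (u \<bullet> x) - Sb k * (w \<bullet> x)) +
            Sb k * (- Sb k * (u \<bullet> x) + Sa k * (w \<bullet> x))) = (Sa k * Sd k - Sb k * Sb k - 1) * (u \<bullet> x)"
        by (simp add: algebra_simps)
      also have "- Sb k * (u \<bullet> x) + (Sa k - 1) * (w \<bullet> x) + (Sb k * (Sd k * (u \<bullet> x) - Sb k * (w \<bullet> x)) +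
            (Sd k - 1) * (- Sb k * (u \<bullet> x) + Sa k * (w \<bullet> x))) = (Sa k * Sd k - Sb k * Sb k - 1) * (w \<bullet> x)"
        by (simp add: algebra_simps)
      finally show ?thesis using det[OF k] by simp
    qed
    then show ?thesis by (simp add: matrix_eq matrix_vector_mul_assoc[symmetric])
  qed
  have RR': "R (iv k) ** R k = mat 1" if k: "k \<in> ?K" for k
    using RR[OF iv(1)[OF k]] iv(2)[OF k] by simp
  define \<tau> where "\<tau> k X = X ** R k + (1 / \<epsilon>) *\<^sub>R (A ** R k - A)" for k and X :: "real^'d^'d"
  have \<tau>: "A + \<epsilon> *\<^sub>R \<tau> k X = (A + \<epsilon> *\<^sub>R X) ** R k" for k X
    using \<epsilon> by (simp add: \<tau>_def matrix_eq matrix_vector_mul_assoc[symmetric] matrix_vector_mult_add_rdistrib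
      scaleR_matrix_vector_assoc[symmetric] matrix_vector_mult_diff_rdistrib algebra_simps)
  have \<tau>_iv: "\<tau> (iv k) (\<tau> k X) = X" "\<tau> k (\<tau> (iv k) X) = X" if k: "k \<in> ?K" for k X
  proof -
    have "A + \<epsilon> *\<^sub>R \<tau> (iv k) (\<tau> k X) = A + \<epsilon> *\<^sub>R X"
      unfolding \<tau> by (simp add: matrix_mul_assoc[symmetric] RR[OF k])
    then show "\<tau> (iv k) (\<tau> k X) = X" using \<epsilon> by simp
    have "A + \<epsilon> *\<^sub>R \<tau> k (\<tau> (iv k) X) = A + \<epsilon> *\<^sub>R X"
      unfolding \<tau> by (simp add: matrix_mul_assoc[symmetric] RR'[OF k])
    then show "\<tau> k (\<tau> (iv k) X) = X" using \<epsilon> by simp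
  qed
  have \<tau>_equi: "\<exists>T. \<forall>X. \<tau> k X + U = \<tau> k (X + T)" if k: "k \<in> ?K" for k U
  proof (intro exI allI)
    fix X
    have "U = U ** R (iv k) ** R k" by (simp add: matrix_mul_assoc[symmetric] RR'[OF k])
    then show "\<tau> k X + U = \<tau> k (X + U ** R (iv k))"
      by (simp add: \<tau>_def matrix_eq matrix_vector_mul_assoc[symmetric] matrix_vector_mult_add_rdistrib)
  qed
  have unit: "\<bar>u $ i\<bar> \<le> 1" "\<bar>w $ i\<bar> \<le> 1" for i
    using component_le_norm_cart[of u i] component_le_norm_cart[of w i] n by (simp_all add: u_def w_def)
  define \<eta> where "\<eta> = 2 * \<bar>a0 - 1\<bar> + 2 * \<bar>b0\<bar>"
  have R_entry: "\<bar>(R k - mat 1) $ l $ j\<bar> \<le> \<eta>" for k l j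
  proof -
    have "(R k - mat 1) $ l $ j = ((R k - mat 1) *v axis j 1) $ l"
      by (simp add: matrix_vector_mult_basis column_def)
    also have "\<dots> = ((Sa k - 1) * u $ j + Sb k * w $ j) * u $ l + (Sb k * u $ j + (Sd k - 1) * w $ j) * w $ l"
      by (simp add: matrix_vector_mult_diff_rdistrib R inner_axis)
    also have "\<bar>\<dots>\<bar> \<le> (\<bar>Sa k - 1\<bar> * 1 + \<bar>Sb k\<bar> * 1) * 1 + (\<bar>Sb k\<bar> * 1 + \<bar>Sd k - 1\<bar> * 1) * 1"
    proof -
      have "\<bar>(x * u $ j + y * w $ j) * z\<bar> \<le> (\<bar>x\<bar> * 1 + \<bar>y\<bar> * 1) * 1" if "\<bar>z\<bar> \<le> 1" for x y z
        unfolding abs_mult using unit that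
        by (intro mult_mono order_trans[OF abs_triangle_ineq] add_mono) (auto simp: abs_mult intro!: mult_left_le)
      from this[OF unit(1)] this[OF unit(2)] show ?thesis
        by (intro order_trans[OF abs_triangle_ineq] add_mono)
    qed
    also have "\<dots> \<le> \<eta>"
    proof -
      have "\<bar>a0 + b0 - 1\<bar> \<le> \<bar>a0 - 1\<bar> + \<bar>b0\<bar>" "\<bar>a0 - b0 - 1\<bar> \<le> \<bar>a0 - 1\<bar> + \<bar>b0\<bar>" by linarith+
      then show ?thesis by (auto simp: S_defs \<eta>_def)
    qed
    finally show ?thesis .
  qed
  \<comment> \<open>The displacement is \<open>X + (1 / \<epsilon>) *\<^sub>R A\<close> times
    \<open>R k - mat 1\<close>. As it is at most 1/4 in each entry, the cubes of radius 1/4, 1/2 and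
    1 can serve as \<open>C''\<close>, \<open>C'\<close> and \<open>C\<close>.\<close>
  have close: "\<bar>(\<tau> k X - X) $ i $ j\<bar> \<le> 1 / 4" if X: "X \<in> cube 1" for k X i j
  proof -
    have "\<tau> k X - X = (X + (1 / \<epsilon>) *\<^sub>R A) ** (R k - mat 1)"
      by (simp add: \<tau>_def matrix_eq matrix_vector_mul_assoc[symmetric] matrix_vector_mult_add_rdistrib
        scaleR_matrix_vector_assoc[symmetric] matrix_vector_mult_diff_rdistrib matrix_vector_mult_diff_distrib
        algebra_simps)
    moreover have "\<bar>(X + (1 / \<epsilon>) *\<^sub>R A) $ i $ l\<bar> \<le> 1 + 1 / \<epsilon>" for i l
    proof -
      have "\<bar>X $ i $ l\<bar> \<le> 1" using X by (simp add: cube_def)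
      moreover have "\<bar>(1 / \<epsilon>) * A $ i $ l\<bar> \<le> 1 / \<epsilon> * 1"
        unfolding abs_mult using A[of i l] \<epsilon> by (intro mult_mono) auto
      ultimately show ?thesis
        using abs_triangle_ineq[of "X $ i $ l" "(1 / \<epsilon>) * A $ i $ l"] by simp
    qed
    ultimately have "\<bar>(\<tau> k X - X) $ i $ j\<bar> \<le> real CARD('d) * ((1 + 1 / \<epsilon>) * \<eta>)"
      using matrix_mult_entry_bound[of "X + (1 / \<epsilon>) *\<^sub>R A" "1 + 1 / \<epsilon>" "R k - mat 1" \<eta>] R_entry[of k] \<epsilon> by simp
    also have "\<dots> \<le> 1 / 4" using small by (simp add: \<eta>_def)
    finally show ?thesis .
  qed
  have maps: "\<tau> k ` cube r \<subseteq> cube s" if "r \<le> 1" "r + 1 / 4 \<le> s" for k r s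
  proof safe
    fix X :: "real^'d^'d" assume X: "X \<in> cube r"
    then have X1: "X \<in> cube 1" using cube_mono[OF that(1)] by auto
    show "\<tau> k X \<in> cube s"
      unfolding cube_def
    proof safe
      fix i j
      have "\<bar>X $ i $ j\<bar> \<le> r" using X by (simp add: cube_def)
      with close[OF X1, of k i j] that(2) show "\<bar>\<tau> k X $ i $ j\<bar> \<le> s"
        unfolding vector_minus_component by linarith
    qed
  qed
  define F where "F X t = f ((A + \<epsilon> *\<^sub>R X) ** (Z ** shear t))" for X t
  have Fm: "(\<lambda>(X, t). F X t) \<in> borel_measurable (borel \<Otimes>\<^sub>M borel)"
    unfolding F_def case_prod_beta by measurable
  \<comment> \<open>Applying \<open>R k\<close> to the frame sheared by \<open>t\<close> gives the
    frame sheared by \<open>s\<close>, up to a parabolic change with diagonal \<open>c\<close> and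
    \<open>1 / c\<close>; these are reciprocal because the determinant is 1. The half-density law
    turns them into the factor \<open>1 / \<bar>c\<bar>\<close>.\<close>
  have moeb: "F (\<tau> k X) t = ennreal (1 / \<bar>Sa k + Sb k * t\<bar>) *
      f ((A + \<epsilon> *\<^sub>R X) ** Z ** shear ((Sb k + Sd k * t) / (Sa k + Sb k * t)))"
    if k: "k \<in> ?K" and c: "Sa k + Sb k * t \<noteq> 0" for k X t
  proof -
    define c s where "c = Sa k + Sb k * t" and "s = (Sb k + Sd k * t) / (Sa k + Sb k * t)"
    have c0: "c \<noteq> 0" using that by (simp add: c_def)
    have cs: "c * s = Sb k + Sd k * t" using c0 by (simp add: s_def c_def)
    have "c * (Sb k * s + 1 / c) = Sb k * (c * s) + 1" using c0 by (simp add: algebra_simps)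
    also have "\<dots> = c * Sd k" unfolding cs unfolding c_def using det[OF k] by (simp add: algebra_simps)
    finally have ds: "Sb k * s + 1 / c = Sd k" using c0 by simp
    have "parabolic (Z ** shear s) (R k ** (Z ** shear t)) c (1 / c)"
      unfolding parabolic_def
    proof (intro conjI ballI)
      show "c \<noteq> 0" "1 / c \<noteq> 0" using c0 by auto
      show "R k ** (Z ** shear t) *v v = Z ** shear s *v v" if "v \<in> V" for v
        using that by (simp add: matrix_vector_mul_assoc[symmetric] blk_V RV)
      have "R k ** (Z ** shear t) *v ep = c *\<^sub>R u + (c * s) *\<^sub>R w"
        unfolding cs unfolding c_def
        by (simp add: matrix_vector_mul_assoc[symmetric] blk_ep matrix_vector_right_distrib matrix_vector_mult_scaleR
            u_def[symmetric] w_def[symmetric] Ru Rw algebra_simps)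
      also have "\<dots> = Z ** shear s *v (c *\<^sub>R ep + 0)"
        by (simp add: matrix_vector_mul_assoc[symmetric] blk_ep matrix_vector_right_distrib matrix_vector_mult_scaleR
            u_def[symmetric] w_def[symmetric] algebra_simps)
      finally show "\<exists>v\<in>V. R k ** (Z ** shear t) *v ep = Z ** shear s *v (c *\<^sub>R ep + v)" using V_0 by blast
      have "R k ** (Z ** shear t) *v eq = Sb k *\<^sub>R u + (Sb k * s + 1 / c) *\<^sub>R w"
        unfolding ds by (simp add: matrix_vector_mul_assoc[symmetric] blk_eq w_def[symmetric] Rw)
      also have "\<dots> = Z ** shear s *v (Sb k *\<^sub>R ep + (1 / c) *\<^sub>R eq + 0)"
        by (simp add: matrix_vector_mul_assoc[symmetric] blk_ep blk_eq matrix_vector_right_distrib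
            matrix_vector_mult_scaleR u_def[symmetric] w_def[symmetric] scaleR_add_left scaleR_add_right)
      finally show "\<exists>\<gamma>. \<exists>v\<in>V. R k ** (Z ** shear t) *v eq = Z ** shear s *v (\<gamma> *\<^sub>R ep + (1 / c) *\<^sub>R eq + v)"
        using V_0 by blast
    qed
    then have "parabolic ((A + \<epsilon> *\<^sub>R X) ** (Z ** shear s)) ((A + \<epsilon> *\<^sub>R X) ** (R k ** (Z ** shear t))) c (1 / c)"
      by (rule parabolic_mult)
    then have "F (\<tau> k X) t = ennreal (sqrt (\<bar>1 / c\<bar> / \<bar>c\<bar>)) * f ((A + \<epsilon> *\<^sub>R X) ** (Z ** shear s))"
      using f unfolding half_density_def F_def \<tau> by (simp add: matrix_mul_assoc)
    also have "sqrt (\<bar>1 / c\<bar> / \<bar>c\<bar>) = 1 / \<bar>c\<bar>"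
      by (simp add: real_sqrt_divide)
    finally show ?thesis by (simp add: c_def s_def matrix_mul_assoc)
  qed
  define L where "L = sqrt (16 - 4 * a0\<^sup>2 * b0\<^sup>2)"
  have L2: "L\<^sup>2 = 16 - 4 * a0\<^sup>2 * b0\<^sup>2" unfolding L_def using ab(3) by simp
  have L0: "0 \<le> L" unfolding L_def using ab(3) by simp
  have avg: "(\<integral>\<^sup>+t. (\<Sum>k\<in>?K. F (\<tau> k X) t)\<^sup>2 \<partial>lborel) \<le> ennreal (L\<^sup>2 * B)" for X
  proof -
    define g where "g t = f ((A + \<epsilon> *\<^sub>R X) ** Z ** shear t)" for t
    have [measurable]: "g \<in> borel_measurable borel" unfolding g_def by measurable
    \<comment> \<open>The excluded slope is the pole, which is sent to the line of \<open>eq\<close>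
      outside the chart.\<close>
    have ae: "AE t in lborel. Sa k + Sb k * t \<noteq> 0" if k: "k \<in> ?K" for k
    proof (cases "Sb k = 0")
      case True
      then have "Sa k \<noteq> 0" using det[OF k] by auto
      then show ?thesis using True by simp
    next
      case False
      have "AE t in lborel. t \<noteq> - Sa k / Sb k" by (rule AE_lborel_singleton)
      then show ?thesis by eventually_elim (use False in \<open>auto simp: field_simps\<close>)
    qed
    have aeK: "AE t in lborel. \<forall>k\<in>?K. Sa k + Sb k * t \<noteq> 0"
      by (rule AE_ball_countable'[OF ae]) auto
    have "(\<integral>\<^sup>+t. (\<Sum>k\<in>?K. F (\<tau> k X) t)\<^sup>2 \<partial>lborel) =
       (\<integral>\<^sup>+t. (\<Sum>k\<in>?K. ennreal (1 / \<bar>Sa k + Sb k * t\<bar>) * g ((Sb k + Sd k * t) / (Sa k + Sb k * t)))\<^sup>2 \<partial>lborel)"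
    proof (rule nn_integral_cong_AE, use aeK in eventually_elim)
      case (elim t)
      have "F (\<tau> k X) t = ennreal (1 / \<bar>Sa k + Sb k * t\<bar>) * g ((Sb k + Sd k * t) / (Sa k + Sb k * t))"
        if "k \<in> ?K" for k
        unfolding g_def by (rule moeb) (use elim that in blast)+
      then show ?case by (intro arg_cong[where f = "\<lambda>x. x\<^sup>2"] sum.cong refl)
    qed
    also have "\<dots> \<le> ennreal (L\<^sup>2) * (\<integral>\<^sup>+t. (g t)\<^sup>2 \<partial>lborel)"
    proof (rule moebius_schur_test[where iv = iv])
      show "bij_betw iv ?K ?K"
        by (rule bij_betwI[where g = iv]) (use iv in auto)
      show "(\<Sum>k\<in>?K. 1 / sqrt ((Sa k + Sb k * t)\<^sup>2 + (Sb k + Sd k * t)\<^sup>2)) \<le> L / sqrt (1 + t\<^sup>2)" for t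
        using hyperbolic_average_bound[OF ab, of t] by (simp add: S_defs L_def)
    qed (use det iv L0 in auto)
    also have "\<dots> \<le> ennreal (L\<^sup>2) * ennreal B"
      using mB[of "(A + \<epsilon> *\<^sub>R X) ** Z"] by (intro mult_left_mono) (simp_all add: mass_def g_def)
    finally show ?thesis using B by (simp add: ennreal_mult)
  qed
  let ?c = "\<lambda>r. measure lborel (cube r :: (real^'d^'d) set)"
  have "(\<integral>\<^sup>+t. (\<integral>\<^sup>+X. indicator (cube 1) X * F X t \<partial>lborel)\<^sup>2 \<partial>lborel) \<le>
     ennreal (?c 1 * (?c 1 - ?c (1/4) * (1 - L\<^sup>2 / (real (card ?K))\<^sup>2)) * B)"
  proof (rule averaging_contraction[where C' = "cube (1/2)" and \<tau> = \<tau> and iv = iv])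
    show "(\<lambda>(X, t). F X t) \<in> borel_measurable (borel \<Otimes>\<^sub>M borel)" by fact
    show "0 < ?c (1/4)" by (rule measure_cube_pos) simp
    show "\<tau> k \<in> borel_measurable borel" for k unfolding \<tau>_def by measurable
    show "(\<integral>\<^sup>+t. (F X t)\<^sup>2 \<partial>lborel) \<le> ennreal B" for X
      using mB[of "(A + \<epsilon> *\<^sub>R X) ** Z"] by (simp add: mass_def F_def matrix_mul_assoc)
    show "\<tau> k ` cube (1/2) \<subseteq> cube 1" "\<tau> k ` cube (1/4) \<subseteq> cube (1/2)" for k by (rule maps, simp, simp)+
    show "cube (1/4) \<subseteq> (cube (1/2) :: (real^'d^'d) set)" "cube (1/2) \<subseteq> (cube 1 :: (real^'d^'d) set)"
      by (rule cube_mono, simp)+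
    show "emeasure lborel (cube 1 :: (real^'d^'d) set) \<noteq> \<infinity>" by (rule emeasure_cube_finite)
  qed (use avg \<tau>_equi \<tau>_iv iv B in auto)
  also have "1 - L\<^sup>2 / (real (card ?K))\<^sup>2 = a0\<^sup>2 * b0\<^sup>2 / 4"
    unfolding L2 by (simp add: diff_divide_distrib)
  finally have main: "(\<integral>\<^sup>+t. (\<integral>\<^sup>+X. indicator (cube 1) X * F X t \<partial>lborel)\<^sup>2 \<partial>lborel) \<le>
     ennreal (?c 1 * (?c 1 - ?c (1/4) * (a0\<^sup>2 * b0\<^sup>2 / 4)) * B)" .
  have c1: "?c 1 > 0" by (rule measure_cube_pos) simp
  have ec: "emeasure lborel (cube 1 :: (real^'d^'d) set) = ennreal (?c 1)"
    by (rule emeasure_eq_ennreal_measure) (use emeasure_cube_finite in simp)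
  have [measurable]: "(\<lambda>X. F X t) \<in> borel_measurable borel" for t unfolding F_def by measurable
  have Fm2[measurable]: "(\<lambda>t. \<integral>\<^sup>+X. indicator (cube 1) X * F X t \<partial>lborel) \<in> borel_measurable borel"
  proof -
    have "(\<lambda>(t, X). indicator (cube 1) X * F X t) \<in> borel_measurable (borel \<Otimes>\<^sub>M borel)"
      unfolding F_def case_prod_beta by measurable
    then show ?thesis by measurable
  qed
  have na: "noise_avg A \<epsilon> f (Z ** shear t) = (\<integral>\<^sup>+X. indicator (cube 1) X * F X t \<partial>lborel) * ennreal (1 / ?c 1)" for t
  proof -
    have "noise_avg A \<epsilon> f (Z ** shear t) = (\<integral>\<^sup>+X. F X t * indicator (cube 1) X \<partial>lborel) / ennreal (?c 1)"
      unfolding noise_avg_def ec[symmetric] F_def[symmetric] by (rule nn_integral_uniform_measure) auto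
    then show ?thesis using c1 by (simp add: divide_ennreal_def inverse_ennreal mult.commute inverse_eq_divide)
  qed
  have "mass (noise_avg A \<epsilon> f) Z = ennreal ((1 / ?c 1)\<^sup>2) *
      (\<integral>\<^sup>+t. (\<integral>\<^sup>+X. indicator (cube 1) X * F X t \<partial>lborel)\<^sup>2 \<partial>lborel)"
  proof -
    have "mass (noise_avg A \<epsilon> f) Z = (\<integral>\<^sup>+t. ennreal ((1 / ?c 1)\<^sup>2) *
        (\<integral>\<^sup>+X. indicator (cube 1) X * F X t \<partial>lborel)\<^sup>2 \<partial>lborel)"
      unfolding mass_def na power_mult_distrib using c1
      by (intro nn_integral_cong) (simp only: ennreal_power[OF less_imp_le[OF divide_pos_pos[OF zero_less_one]]] mult.commute)
    then show ?thesis by (simp only:) (rule nn_integral_cmult, measurable)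
  qed
  also have "\<dots> \<le> ennreal ((1 / ?c 1)\<^sup>2) * ennreal (?c 1 * (?c 1 - ?c (1/4) * (a0\<^sup>2 * b0\<^sup>2 / 4)) * B)"
    by (intro mult_left_mono main) simp
  also have "\<dots> = ennreal ((1 / ?c 1)\<^sup>2 * (?c 1 * (?c 1 - ?c (1/4) * (a0\<^sup>2 * b0\<^sup>2 / 4)) * B))"
    by (rule ennreal_mult'[symmetric]) simp
  also have "(1 / ?c 1)\<^sup>2 * (?c 1 * (?c 1 - ?c (1/4) * (a0\<^sup>2 * b0\<^sup>2 / 4)) * B) =
     (1 - ?c (1/4) / ?c 1 * (a0\<^sup>2 * b0\<^sup>2 / 4)) * B"
    using c1 by (simp add: field_simps power2_eq_square)
  finally show ?thesis .
qed

end

lemma (in partial_flag) mass_noise_avg_le: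
  fixes A Z :: "real^'d^'d" and \<epsilon> a0 b0 B :: real
  assumes f: "half_density f" and mB: "\<And>Y. mass f Y \<le> ennreal B" and B: "0 \<le> B"
    and A: "\<And>i j. \<bar>A $ i $ j\<bar> \<le> 1" and \<epsilon>: "0 < \<epsilon>"
    and ab: "a0\<^sup>2 - b0\<^sup>2 = 1" "0 < a0" "4 * a0\<^sup>2 * b0\<^sup>2 \<le> 1 / 5"
    and small: "real CARD('d) * ((1 + 1 / \<epsilon>) * (2 * \<bar>a0 - 1\<bar> + 2 * \<bar>b0\<bar>)) \<le> 1 / 4"
  shows "mass (noise_avg A \<epsilon> f) Z \<le>
    ennreal ((1 - measure lborel (cube (1/4) :: (real^'d^'d) set) / measure lborel (cube 1 :: (real^'d^'d) set) *
      (a0\<^sup>2 * b0\<^sup>2 / 4)) * B)"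
proof (cases "area Z = 0")
  case True
  then show ?thesis using mass_degenerate half_density_noise_avg[OF f] by simp
next
  case False
  then obtain Z' where Z': "\<And>f. half_density f \<Longrightarrow> mass f Z' = mass f Z"
    "norm (Z' *v ep) = 1" "norm (Z' *v eq) = 1" "(Z' *v ep) \<bullet> (Z' *v eq) = 0"
    "\<And>v. v \<in> V \<Longrightarrow> (Z' *v ep) \<bullet> (Z' *v v) = 0" "\<And>v. v \<in> V \<Longrightarrow> (Z' *v eq) \<bullet> (Z' *v v) = 0"
    using normal_form by blast
  show ?thesis
    unfolding Z'(1)[OF half_density_noise_avg[OF f], symmetric]
    by (rule mass_noise_avg_le_normal[OF f mB B A \<epsilon> ab small Z'(2-6)])
qed

lemma cauchy_density_finite: "\<exists>B>0. (\<integral>\<^sup>+t. ennreal (1 / (1 + t\<^sup>2)) \<partial>lborel) \<le> ennreal B"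
proof -
  have i: "integrable lborel (\<lambda>t::real. 1 / (1 + t\<^sup>2))"
    using integrable_inverse_1_plus_square by (simp add: set_integrable_def inverse_eq_divide)
  have "(\<integral>\<^sup>+t. ennreal (1 / (1 + t\<^sup>2)) \<partial>lborel) = ennreal (\<integral>t. 1 / (1 + t\<^sup>2) \<partial>lborel)"
    by (rule nn_integral_eq_integral[OF i]) simp
  also have "\<dots> \<le> ennreal (max 1 (\<integral>t. 1 / (1 + t\<^sup>2) \<partial>lborel))" by (rule ennreal_leI) simp
  finally show ?thesis by (intro exI[of _ "max 1 (\<integral>t. 1 / (1 + t\<^sup>2) \<partial>lborel)"]) simp
qed

text \<open>The rate is fixed before the flag, the matrix, the half-density and the frame. Of the
  matrix only the bound 1 on its entries enters, through the size of the hyperbolic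
  elements.\<close>

lemma uniform_contraction:
  fixes \<epsilon> :: real
  assumes \<epsilon>: "0 < \<epsilon>"
  obtains \<rho> where "0 < \<rho>" "\<rho> < 1"
    "\<And>(I :: 'd::finite set) p q A f B Z. partial_flag I p q \<Longrightarrow> partial_flag.half_density I p q f \<Longrightarrow>
       (\<And>Y. partial_flag.mass p q f Y \<le> ennreal B) \<Longrightarrow> 0 \<le> B \<Longrightarrow> (\<And>i j. \<bar>A $ i $ j\<bar> \<le> 1) \<Longrightarrow>
       partial_flag.mass p q (noise_avg A \<epsilon> f) Z \<le> ennreal (\<rho> * B)"
proof -
  let ?d = "real CARD('d)"
  let ?c = "\<lambda>r. measure lborel (cube r :: (real^'d^'d) set)"
  \<comment> \<open>Since \<open>a0 - 1 \<le> b0\<close>, the last factor in \<open>small\<close> is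
    at most \<open>4 * b0\<close>; the 16 in the denominator turns this into the bound 1/4.\<close>
  define b0 a0 where "b0 = 1 / (16 * (?d * (1 + 1 / \<epsilon>)))" and "a0 = sqrt (1 + b0\<^sup>2)"
  have d1: "?d \<ge> 1" by (simp add: Suc_le_eq)
  then have "1 * 1 \<le> ?d * (1 + 1 / \<epsilon>)" using \<epsilon> by (intro mult_mono) auto
  then have g: "?d * (1 + 1 / \<epsilon>) \<ge> 1" by simp
  then have b0: "0 < b0" "b0 \<le> 1 / 16" unfolding b0_def by (simp, simp add: divide_le_eq)
  have a2: "a0\<^sup>2 = 1 + b0\<^sup>2" unfolding a0_def by simp
  have a0: "1 \<le> a0" by (simp add: a0_def)
  have a0': "a0 \<le> 1 + b0"
    by (rule power2_le_imp_le) (use b0 in \<open>auto simp: a2 power2_sum\<close>)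
  have b2: "b0\<^sup>2 \<le> (1/16)\<^sup>2" using b0 by (intro power_mono) auto
  have "a0\<^sup>2 * b0\<^sup>2 \<le> (1 + (1/16)\<^sup>2) * (1/16)\<^sup>2"
    unfolding a2 using b2 by (intro mult_mono) auto
  then have m: "4 * a0\<^sup>2 * b0\<^sup>2 \<le> 1 / 5" by (simp add: power2_eq_square)
  have "?d * ((1 + 1 / \<epsilon>) * (2 * \<bar>a0 - 1\<bar> + 2 * \<bar>b0\<bar>)) \<le> ?d * ((1 + 1 / \<epsilon>) * (4 * b0))"
    using a0 a0' b0 \<epsilon> by (intro mult_left_mono) auto
  also have "\<dots> = 4 * ((?d * (1 + 1 / \<epsilon>)) * b0)" by simp
  also have "(?d * (1 + 1 / \<epsilon>)) * b0 = 1 / 16" unfolding b0_def using g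
  proof -
    have "G * (1 / (16 * G)) = 1 / 16" if "1 \<le> G" for G :: real using that by simp
    from this[OF g] show "?d * (1 + 1 / \<epsilon>) * (1 / (16 * (?d * (1 + 1 / \<epsilon>)))) = 1 / 16" .
  qed
  finally have small: "?d * ((1 + 1 / \<epsilon>) * (2 * \<bar>a0 - 1\<bar> + 2 * \<bar>b0\<bar>)) \<le> 1 / 4" by simp
  define \<rho> where "\<rho> = 1 - ?c (1/4) / ?c 1 * (a0\<^sup>2 * b0\<^sup>2 / 4)"
  have c: "0 < ?c (1/4)" "0 < ?c 1" by (rule measure_cube_pos, simp)+
  have "?c (1/4) \<le> ?c 1"
    by (rule measure_mono_fmeasurable[OF cube_mono])
       (auto simp: fmeasurable_def emeasure_cube_finite less_top[symmetric] emeasure_cube_finite[simplified])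
  then have q: "0 < ?c (1/4) / ?c 1" "?c (1/4) / ?c 1 \<le> 1" using c by auto
  have "0 < a0\<^sup>2 * b0\<^sup>2" using a0 b0 by simp
  then have pos: "0 < a0\<^sup>2 * b0\<^sup>2 / 4" "a0\<^sup>2 * b0\<^sup>2 / 4 < 1" using m by auto
  have "?c (1/4) / ?c 1 * (a0\<^sup>2 * b0\<^sup>2 / 4) \<le> 1 * (a0\<^sup>2 * b0\<^sup>2 / 4)"
    using q pos by (intro mult_right_mono) auto
  moreover have "0 < ?c (1/4) / ?c 1 * (a0\<^sup>2 * b0\<^sup>2 / 4)" by (rule mult_pos_pos[OF q(1) pos(1)])
  ultimately have \<rho>: "0 < \<rho>" "\<rho> < 1" unfolding \<rho>_def using pos(2) by linarith+
  show ?thesis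
  proof (rule that[OF \<rho>])
    fix I :: "'d set" and p q f B and A Z :: "real^'d^'d"
    assume F: "partial_flag I p q" and f: "partial_flag.half_density I p q f"
      and B: "\<And>Y. partial_flag.mass p q f Y \<le> ennreal B" "0 \<le> B" and A: "\<And>i j. \<bar>A $ i $ j\<bar> \<le> 1"
    interpret partial_flag I p q by (rule F)
    show "mass (noise_avg A \<epsilon> f) Z \<le> ennreal (\<rho> * B)"
      unfolding \<rho>_def
      by (rule mass_noise_avg_le[OF f B A \<epsilon> _ _ m small]) (use a0 a2 in auto)
  qed
qed

text \<open>The average belonging to the last matrix is applied to \<open>f\<close> first, because
  this factor stands leftmost in the product. The value at \<open>Z\<close> is the expectation of
  \<open>f\<close> at the random product times \<open>Z\<close>.\<close>

primrec iterated_avg :: "(nat \<Rightarrow> real^'d^'d) \<Rightarrow> real \<Rightarrow> nat \<Rightarrow> (real^'d^'d \<Rightarrow> ennreal) \<Rightarrow> real^'d^'d \<Rightarrow> ennreal" where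
  "iterated_avg A \<epsilon> 0 f = f"
| "iterated_avg A \<epsilon> (Suc n) f = iterated_avg A \<epsilon> n (noise_avg (A (Suc n)) \<epsilon> f)"

lemma (in partial_flag) half_density_iterated_avg:
  "half_density f \<Longrightarrow> half_density (iterated_avg A \<epsilon> n f)"
  by (induction n arbitrary: f) (auto intro: half_density_noise_avg)

text \<open>Each factor moves the frame to one that is not controlled, so the induction carries a
  bound on the supremum of the masses over all frames; this supremum shrinks by the same factor in
  every step.\<close>

lemma iterated_avg_phi_decay:
  fixes \<epsilon> :: real
  assumes \<epsilon>: "0 < \<epsilon>"
  obtains \<rho> B where "0 < \<rho>" "\<rho> < 1" "0 < B"
    "\<And>(I :: 'd::finite set) p q A n Z. partial_flag I p q \<Longrightarrow> (\<And>n i j. 1 \<le> n \<Longrightarrow> \<bar>A n $ i $ j\<bar> \<le> 1) \<Longrightarrow>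
       partial_flag.mass p q (iterated_avg A \<epsilon> n (partial_flag.phi I p q)) Z \<le> ennreal (\<rho> ^ n * B)"
proof -
  obtain \<rho> where \<rho>: "0 < \<rho>" "\<rho> < 1" and
    step: "\<And>(I :: 'd set) p q A f B Z. partial_flag I p q \<Longrightarrow> partial_flag.half_density I p q f \<Longrightarrow>
       (\<And>Y. partial_flag.mass p q f Y \<le> ennreal B) \<Longrightarrow> 0 \<le> B \<Longrightarrow> (\<And>i j. \<bar>A $ i $ j\<bar> \<le> 1) \<Longrightarrow>
       partial_flag.mass p q (noise_avg A \<epsilon> f) Z \<le> ennreal (\<rho> * B)"
    using uniform_contraction[OF \<epsilon>, where ?'d = 'd] by metis
  obtain B where B: "0 < B" "(\<integral>\<^sup>+t. ennreal (1 / (1 + t\<^sup>2)) \<partial>lborel) \<le> ennreal B"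
    using cauchy_density_finite by blast
  show ?thesis
  proof (rule that[OF \<rho> B(1)])
    fix I :: "'d set" and p q n and A :: "nat \<Rightarrow> real^'d^'d" and Z
    assume F: "partial_flag I p q" and A: "\<And>n i j. 1 \<le> n \<Longrightarrow> \<bar>A n $ i $ j\<bar> \<le> 1"
    interpret partial_flag I p q by (rule F)
    have "mass (iterated_avg A \<epsilon> n f) Z \<le> ennreal (\<rho> ^ n * b)"
      if "half_density f" "\<And>Y. mass f Y \<le> ennreal b" "0 \<le> b" for f b
      using that
    proof (induction n arbitrary: f b)
      case (Suc n)
      have "mass (noise_avg (A (Suc n)) \<epsilon> f) Y \<le> ennreal (\<rho> * b)" for Y
        by (rule step[OF F Suc.prems]) (use A in auto)
      from Suc.IH[OF half_density_noise_avg[OF Suc.prems(1)] this] show ?case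
        using Suc.prems \<rho> by (simp add: mult.assoc mult.left_commute)
    qed simp
    from this[OF half_density_phi order_trans[OF mass_phi_le B(2)]] B(1)
    show "mass (iterated_avg A \<epsilon> n phi) Z \<le> ennreal (\<rho> ^ n * B)" by simp
  qed
qed

lemma ennreal_power2_le_imp_le:
  fixes x :: ennreal
  assumes "x\<^sup>2 \<le> ennreal (r\<^sup>2)" "0 \<le> r"
  shows "x \<le> ennreal r"
proof (cases x)
  case (real y)
  then have "ennreal (y\<^sup>2) \<le> ennreal (r\<^sup>2)" using assms by (simp add: ennreal_power)
  then have "y\<^sup>2 \<le> r\<^sup>2" by (simp add: ennreal_le_iff)
  then show ?thesis using real assms(2) by (auto intro!: ennreal_leI power2_le_imp_le)
next
  case top
  then show ?thesis using assms(1) by (simp add: power2_eq_square ennreal_mult_eq_top_iff top_unique)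
qed

text \<open>Cauchy--Schwarz on a parameter interval of length 1. Passing to the integral of
  \<open>f\<close> itself costs half of the exponential rate.\<close>

lemma (in partial_flag) integral_shear_le:
  assumes f: "half_density f" and m: "mass f Z \<le> ennreal (r\<^sup>2)" and r: "0 \<le> r"
  shows "(\<integral>\<^sup>+t. indicator {0..1} t * f (Z ** shear t) \<partial>lborel) \<le> ennreal r"
proof -
  have [measurable]: "f \<in> borel_measurable borel" using f by (rule half_density_measurable)
  let ?x = "\<integral>\<^sup>+t. indicator {0..1} t * f (Z ** shear t) \<partial>lborel"
  have "?x\<^sup>2 \<le> (\<integral>\<^sup>+t. indicator {0..1::real} t \<partial>lborel) * (\<integral>\<^sup>+t. indicator {0..1} t * (f (Z ** shear t))\<^sup>2 \<partial>lborel)"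
    by (rule nn_integral_weighted_Cauchy_Schwarz) measurable
  also have "\<dots> = (\<integral>\<^sup>+t. indicator {0..1} t * (f (Z ** shear t))\<^sup>2 \<partial>lborel)" by simp
  also have "\<dots> \<le> mass f Z"
    unfolding mass_def by (intro nn_integral_mono) (auto split: split_indicator)
  also note m
  finally have le: "?x\<^sup>2 \<le> ennreal (r\<^sup>2)" .
  show ?thesis by (rule ennreal_power2_le_imp_le[OF le r])
qed

section \<open>Singular values\<close>

text \<open>A maximiser of the Rayleigh quotient on the unit sphere of \<open>W\<close> is an
  eigenvector: otherwise moving in the direction of the residual \<open>r\<close> would increase the
  quotient.\<close>

lemma symmetric_eigenvector:
  fixes f :: "'a::euclidean_space \<Rightarrow> 'a"
  assumes lin: "linear f" and sym: "\<And>x y. f x \<bullet> y = x \<bullet> f y" and W: "subspace W" "f ` W \<subseteq> W" "W \<noteq> {0}"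
  obtains x c where "x \<in> W" "norm x = 1" "f x = c *\<^sub>R x"
proof -
  let ?S = "W \<inter> sphere 0 1"
  have "compact ?S" by (simp add: closed_Int_compact closed_subspace W(1))
  moreover have "?S \<noteq> {}"
  proof -
    obtain w where "w \<in> W" "w \<noteq> 0" using W(1,3) subspace_0 by blast
    then have "(1 / norm w) *\<^sub>R w \<in> ?S" using W(1) by (simp add: subspace_scale)
    then show ?thesis by blast
  qed
  moreover have "continuous_on ?S (\<lambda>x. x \<bullet> f x)"
    by (intro continuous_intros linear_continuous_on) (use lin in \<open>simp add: linear_conv_bounded_linear\<close>)
  ultimately obtain x where x: "x \<in> ?S" and max: "\<And>y. y \<in> ?S \<Longrightarrow> y \<bullet> f y \<le> x \<bullet> f x"
    using continuous_attains_sup[of ?S "\<lambda>x. x \<bullet> f x"] by blast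
  define c where "c = x \<bullet> f x"
  have le: "y \<bullet> f y \<le> c * (y \<bullet> y)" if "y \<in> W" for y
  proof (cases "y = 0")
    case False
    define z where "z = (1 / norm y) *\<^sub>R y"
    have "z \<in> ?S" using that False W(1) by (simp add: z_def subspace_scale)
    then have zc: "z \<bullet> f z \<le> c" using max by (simp add: c_def)
    have y: "y = norm y *\<^sub>R z" using False by (simp add: z_def)
    have "y \<bullet> f y = (norm y)\<^sup>2 * (z \<bullet> f z)"
      by (subst (1 2) y) (simp add: linear_scale[OF lin] power2_eq_square)
    also have "\<dots> \<le> (norm y)\<^sup>2 * c" using zc by (intro mult_left_mono) auto
    finally show ?thesis by (simp add: power2_norm_eq_inner mult.commute)
  qed (simp add: linear_0[OF lin])
  define r where "r = f x - c *\<^sub>R x"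
  have xW: "x \<in> W" and x1: "x \<bullet> x = 1" using x by (auto simp: norm_eq_1)
  have rW: "r \<in> W" unfolding r_def using xW W by (auto intro!: subspace_diff subspace_scale)
  have quad: "0 \<le> t\<^sup>2 * (c * (r \<bullet> r) - r \<bullet> f r) - 2 * t * (r \<bullet> r)" for t
  proof -
    have "x + t *\<^sub>R r \<in> W" using xW rW W(1) by (simp add: subspace_add subspace_scale)
    from le[OF this] have "0 \<le> c * ((x + t *\<^sub>R r) \<bullet> (x + t *\<^sub>R r)) - (x + t *\<^sub>R r) \<bullet> f (x + t *\<^sub>R r)" by simp
    also have "\<dots> = c * (1 + 2 * t * (r \<bullet> x) + t\<^sup>2 * (r \<bullet> r)) - (c + 2 * t * (r \<bullet> f x) + t\<^sup>2 * (r \<bullet> f r))"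
      using sym[of x r] x1
      by (simp add: linear_add[OF lin] linear_scale[OF lin] inner_add_left inner_add_right inner_commute
          c_def power2_eq_square algebra_simps)
    also have "r \<bullet> f x = r \<bullet> r + c * (r \<bullet> x)"
      by (simp add: r_def inner_diff_left inner_diff_right algebra_simps)
    finally show ?thesis by (simp add: algebra_simps)
  qed
  have "r \<bullet> r = 0"
  proof (rule ccontr)
    assume "r \<bullet> r \<noteq> 0"
    then have p: "r \<bullet> r > 0" by simp
    \<comment> \<open>A positive bound for the quadratic coefficient in \<open>quad\<close>; at the
      parameter \<open>(r \<bullet> r) / k\<close> the negative linear term prevails.\<close>
    define k where "k = \<bar>c * (r \<bullet> r) - r \<bullet> f r\<bar> + 1"
    have k: "k > 0" "c * (r \<bullet> r) - r \<bullet> f r \<le> k" by (auto simp: k_def)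
    have "0 \<le> ((r \<bullet> r) / k)\<^sup>2 * k - 2 * ((r \<bullet> r) / k) * (r \<bullet> r)"
      using quad[of "(r \<bullet> r) / k"] k by (smt (verit) mult_left_mono zero_le_power2)
    also have "\<dots> = - ((r \<bullet> r)\<^sup>2 / k)" using k by (simp add: field_simps power2_eq_square)
    also have "\<dots> < 0" using p k by simp
    finally show False by simp
  qed
  then have "f x = c *\<^sub>R x" by (simp add: r_def)
  then show ?thesis using that xW x by auto
qed

text \<open>Induction on the dimension: by symmetry the orthogonal complement of an eigenvector
  within \<open>W\<close> is again invariant.\<close>

lemma symmetric_orthonormal_eigenbasis:
  fixes f :: "'a::euclidean_space \<Rightarrow> 'a"
  assumes lin: "linear f" and sym: "\<And>x y. f x \<bullet> y = x \<bullet> f y" and W: "subspace W" "f ` W \<subseteq> W"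
  shows "\<exists>B. B \<subseteq> W \<and> pairwise orthogonal B \<and> (\<forall>b\<in>B. norm b = 1 \<and> (\<exists>c. f b = c *\<^sub>R b)) \<and> span B = W"
  using W
proof (induction "dim W" arbitrary: W rule: less_induct)
  case less
  show ?case
  proof (cases "W = {0}")
    case True
    then show ?thesis by (intro exI[of _ "{}"]) auto
  next
    case False
    obtain x c where x: "x \<in> W" "norm x = 1" "f x = c *\<^sub>R x"
      using symmetric_eigenvector[OF lin sym less.prems False] by blast
    define W' where "W' = {y \<in> W. x \<bullet> y = 0}"
    have sub: "subspace W'"
      using less.prems(1) unfolding W'_def subspace_def by (auto simp: inner_add_right)
    have inv: "f ` W' \<subseteq> W'"
      using less.prems(2) sym[of x] x(3) unfolding W'_def by (auto simp flip: sym)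
    have "x \<notin> W'" using x by (auto simp: W'_def norm_eq_1)
    moreover have "W' \<subseteq> W" unfolding W'_def by blast
    ultimately have "W' \<subset> W" using x(1) by blast
    then have "dim W' < dim W"
      using sub less.prems(1) by (metis dim_psubset span_eq_iff)
    from less.hyps[OF this sub inv] obtain B where B: "B \<subseteq> W'" "pairwise orthogonal B"
      "\<forall>b\<in>B. norm b = 1 \<and> (\<exists>c. f b = c *\<^sub>R b)" "span B = W'" by blast
    have "span (insert x B) = W"
    proof
      show "span (insert x B) \<subseteq> W"
        using B(1) x(1) less.prems(1) by (intro span_minimal) (auto simp: W'_def)
      show "W \<subseteq> span (insert x B)"
      proof
        fix y assume y: "y \<in> W"
        have "y - (x \<bullet> y) *\<^sub>R x \<in> W'"
          using y x less.prems(1) by (simp add: W'_def subspace_diff subspace_scale inner_diff_right norm_eq_1)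
        then show "y \<in> span (insert x B)" using B(4) by (auto simp: span_insert)
      qed
    qed
    moreover have "pairwise orthogonal (insert x B)"
      using B(1,2) by (auto simp: pairwise_insert W'_def orthogonal_def inner_commute)
    ultimately show ?thesis
      using B(1,3) x by (intro exI[of _ "insert x B"]) (auto simp: W'_def)
  qed
qed

section \<open>Characteristic polynomial and singular value decomposition\<close>

lemma poly_det: "poly (det A) x = det (\<chi> i j. poly (A $ i $ j) (x::'a::comm_ring_1))"
  unfolding det_def by (simp add: poly_sum poly_prod poly_of_int)

lemma poly_charpoly: "poly (charpoly M) x = det (x *\<^sub>R mat 1 - M)"
  unfolding charpoly_def poly_det
  by (intro arg_cong[where f = det]) (simp add: vec_eq_iff mat_def)

text \<open>Evaluated beyond the operator norm of \<open>M\<close>, where no eigenvalue can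
  lie.\<close>

lemma charpoly_nonzero: "charpoly (M::real^'d^'d) \<noteq> 0"
proof -
  define x where "x = onorm ((*v) M) + 1"
  have inj: "y = 0" if "(x *\<^sub>R mat 1 - M) *v y = 0" for y
  proof (rule ccontr)
    assume "y \<noteq> 0"
    have "M *v y = x *\<^sub>R y"
      using that by (simp add: matrix_vector_mult_diff_rdistrib scaleR_matrix_vector_assoc[symmetric])
    then have "\<bar>x\<bar> * norm y \<le> onorm ((*v) M) * norm y"
      using onorm[OF matrix_vector_mul_bounded_linear[of M], of y] by simp
    then have "\<bar>x\<bar> \<le> onorm ((*v) M)" using \<open>y \<noteq> 0\<close> by simp
    then show False by (simp add: x_def)
  qed
  then have "invertible (x *\<^sub>R mat 1 - M)"
    using invertible_left_inverse matrix_left_invertible_ker by blast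
  then have "poly (charpoly M) x \<noteq> 0"
    by (simp add: poly_charpoly invertible_det_nz)
  then show ?thesis by auto
qed

text \<open>Links the definition through roots with right singular vectors: the columns of
  \<open>K\<close> diagonalise \<open>transpose N ** N\<close>, so its characteristic polynomial is
  a product of linear factors with roots \<open>(\<sigma> j)^2\<close>. The index type carries no
  order; \<open>e\<close> supplies the one along which \<open>\<sigma>\<close> decreases and which
  later defines the flags.\<close>

lemma svd_basis:
  fixes N :: "real^'d^'d" and e :: "nat \<Rightarrow> 'd"
  assumes e: "bij_betw e {..<CARD('d)} UNIV"
  obtains K :: "real^'d^'d" and \<sigma> :: "'d \<Rightarrow> real" where
    "orthogonal_matrix K" "\<And>j. 0 \<le> \<sigma> j"
    "\<And>j. transpose N *v (N *v (K *v axis j 1)) = (\<sigma> j)\<^sup>2 *\<^sub>R (K *v axis j 1)"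
    "\<And>i k. i \<le> k \<Longrightarrow> k < CARD('d) \<Longrightarrow> \<sigma> (e k) \<le> \<sigma> (e i)"
    "\<And>k. k < CARD('d) \<Longrightarrow> singular_value (Suc k) N = \<sigma> (e k)"
proof -
  define f where "f x = transpose N *v (N *v x)" for x
  have f_inner: "f x \<bullet> y = (N *v x) \<bullet> (N *v y)" for x y
    unfolding f_def by (metis dot_lmul_matrix transpose_matrix_vector)
  have "linear f" unfolding f_def
    by (intro linearI) (simp_all only: matrix_vector_right_distrib matrix_vector_mult_scaleR)
  moreover have "f x \<bullet> y = x \<bullet> f y" for x y
    by (metis f_inner inner_commute)
  ultimately obtain B where B: "pairwise orthogonal B" "\<And>b. b \<in> B \<Longrightarrow> norm b = 1"
    "\<And>b. b \<in> B \<Longrightarrow> \<exists>c. f b = c *\<^sub>R b" "span B = UNIV"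
    using symmetric_orthonormal_eigenbasis[of f UNIV] by auto
  have ind: "independent B"
    using B(1,2) by (intro pairwise_orthogonal_independent) (metis norm_zero zero_neq_one)+
  have cB: "finite B" "card B = CARD('d)"
    using ind B(4) independent_bound_general[of B] dim_span[of B] dim_eq_card_independent[OF ind] by auto
  define ev where "ev b = norm (N *v b)" for b
  have ev: "f b = (ev b)\<^sup>2 *\<^sub>R b" if b: "b \<in> B" for b
  proof -
    obtain c where c: "f b = c *\<^sub>R b" using B(3)[OF b] by blast
    have "b \<bullet> b = 1" using B(2)[OF b] by (simp add: norm_eq_1)
    then have "c = f b \<bullet> b" by (simp add: c)
    also have "\<dots> = (ev b)\<^sup>2" by (simp add: f_inner ev_def power2_norm_eq_inner)
    finally show ?thesis using c by simp
  qed
  define xs where "xs = rev (sort_key ev (SOME xs. set xs = B \<and> distinct xs))"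
  have xs: "set xs = B" "distinct xs" "sorted (rev (map ev xs))"
    using someI_ex[OF finite_distinct_list[OF cB(1)]] unfolding xs_def by (auto simp: rev_map)
  then have lxs: "length xs = CARD('d)" using cB(2) distinct_card by fastforce
  define ei where "ei j = the_inv_into {..<CARD('d)} e j" for j
  have ei: "ei j < CARD('d)" "e (ei j) = j" for j
    using e the_inv_into_into[of e "{..<CARD('d)}" j "{..<CARD('d)}"] f_the_inv_into_f[of e "{..<CARD('d)}" j]
    by (auto simp: bij_betw_def ei_def)
  have ei2: "ei (e k) = k" if "k < CARD('d)" for k
    using e that by (auto simp: bij_betw_def ei_def the_inv_into_f_f)
  define K :: "real^'d^'d" where "K = (\<chi> i j. (xs ! ei j) $ i)"
  have Kc: "K *v axis j 1 = xs ! ei j" for j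
    by (simp add: matrix_vector_mult_basis K_def column_def vec_eq_iff)
  have KB: "xs ! ei j \<in> B" for j using ei(1)[of j] lxs xs(1) by (metis nth_mem)
  define \<sigma> where "\<sigma> j = ev (xs ! ei j)" for j
  have orthK: "(xs ! ei i) \<bullet> (xs ! ei j) = (if i = j then 1 else 0)" for i j
  proof (cases "i = j")
    case True
    then show ?thesis using B(2)[OF KB[of i]] by (simp add: norm_eq_1)
  next
    case False
    then have "ei i \<noteq> ei j" using ei(2) by metis
    then have "xs ! ei i \<noteq> xs ! ei j" using xs(2) ei(1) lxs by (simp add: nth_eq_iff_index_eq)
    then show ?thesis using B(1) KB False by (auto simp: pairwise_def orthogonal_def)
  qed
  have KK: "transpose K ** K = mat 1"
    using orthK by (simp add: vec_eq_iff matrix_matrix_mult_def transpose_def K_def mat_def inner_vec_def)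
  then have oK: "orthogonal_matrix K" by (simp add: orthogonal_matrix)
  have eig: "transpose N *v (N *v (K *v axis j 1)) = (\<sigma> j)\<^sup>2 *\<^sub>R (K *v axis j 1)" for j
    using ev[OF KB[of j]] by (simp add: Kc \<sigma>_def f_def)
  have sorted: "\<sigma> (e k) \<le> \<sigma> (e i)" if "i \<le> k" "k < CARD('d)" for i k
    using sorted_rev_nth_mono[OF xs(3), of i k] that lxs ei2 by (simp add: \<sigma>_def)
  have "charpoly (transpose N ** N) = (\<Prod>j\<in>UNIV. [:- ((\<sigma> j)\<^sup>2), 1:])"
  proof (rule poly_ext)
    fix x :: real
    define D :: "real^'d^'d" where "D = (\<chi> i j. if i = j then x - (\<sigma> j)\<^sup>2 else 0)"
    have Dj: "D *v axis j 1 = (x - (\<sigma> j)\<^sup>2) *\<^sub>R axis j 1" for j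
      unfolding matrix_vector_mult_basis by (auto simp: column_def D_def vec_eq_iff axis_def)
    have "(x *\<^sub>R mat 1 - transpose N ** N) ** K = K ** D"
    proof -
      have "((x *\<^sub>R mat 1 - transpose N ** N) ** K) *v axis j 1 = (K ** D) *v axis j 1" for j
        using eig[of j]
        by (simp add: matrix_vector_mul_assoc[symmetric] Dj matrix_vector_mult_diff_rdistrib
            scaleR_matrix_vector_assoc[symmetric] matrix_vector_mult_scaleR scaleR_diff_left
            matrix_vector_mult_diff_distrib del: transpose_matrix_vector)
      then have "column j ((x *\<^sub>R mat 1 - transpose N ** N) ** K) = column j (K ** D)" for j
        by (simp only: matrix_vector_mult_basis)
      then show ?thesis by (simp add: column_def vec_eq_iff)
    qed
    then have "det (x *\<^sub>R mat 1 - transpose N ** N) * det K = det K * det D"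
      by (metis det_mul)
    moreover have "det K \<noteq> 0" using det_orthogonal_matrix[OF oK] by auto
    ultimately have "det (x *\<^sub>R mat 1 - transpose N ** N) = det D" by simp
    also have "\<dots> = (\<Prod>j\<in>UNIV. x - (\<sigma> j)\<^sup>2)" by (subst det_diagonal) (auto simp: D_def)
    finally show "poly (charpoly (transpose N ** N)) x = poly (\<Prod>j\<in>UNIV. [:- ((\<sigma> j)\<^sup>2), 1:]) x"
      by (simp add: poly_charpoly poly_prod)
  qed
  then have "proots (charpoly (transpose N ** N)) = (\<Sum>j\<in>UNIV. {#(\<sigma> j)\<^sup>2#})"
    by (simp add: proots_prod)
  also have "\<dots> = image_mset (\<lambda>j. (\<sigma> j)\<^sup>2) (mset_set UNIV)"
  proof -
    have "(\<Sum>j\<in>S. {#(\<sigma> j)\<^sup>2#}) = image_mset (\<lambda>j. (\<sigma> j)\<^sup>2) (mset_set S)" if "finite S" for S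
      using that by induction auto
    then show ?thesis by simp
  qed
  finally have "image_mset sqrt (proots (charpoly (transpose N ** N))) = image_mset (\<lambda>j. sqrt ((\<sigma> j)\<^sup>2)) (mset_set UNIV)"
    by (simp add: image_mset.compositionality comp_def)
  also have "\<dots> = image_mset \<sigma> (mset_set UNIV)"
  proof -
    have "sqrt ((\<sigma> j)\<^sup>2) = \<sigma> j" for j by (simp add: \<sigma>_def ev_def)
    then show ?thesis by simp
  qed
  also have "mset_set (UNIV :: 'd set) = image_mset e (mset_set {..<CARD('d)})"
    using e by (simp add: image_mset_mset_set bij_betw_def)
  also have "image_mset \<sigma> (image_mset e (mset_set {..<CARD('d)})) = mset (map (\<lambda>k. \<sigma> (e k)) [0..<CARD('d)])"
    by (simp add: image_mset.compositionality comp_def atLeast0LessThan[symmetric])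
  finally have ms: "image_mset sqrt (proots (charpoly (transpose N ** N))) = mset (map (\<lambda>k. \<sigma> (e k)) [0..<CARD('d)])" .
  have "sort (map (\<lambda>k. \<sigma> (e k)) [0..<CARD('d)]) = rev (map (\<lambda>k. \<sigma> (e k)) [0..<CARD('d)])"
    by (rule properties_for_sort) (use sorted in \<open>auto simp: sorted_rev_iff_nth_mono\<close>)
  then have "singular_values N = map (\<lambda>k. \<sigma> (e k)) [0..<CARD('d)]"
    unfolding singular_values_def ms sorted_list_of_multiset_mset by simp
  then have "singular_value (Suc k) N = \<sigma> (e k)" if "k < CARD('d)" for k
    using that by (simp add: singular_value_def)
  then show ?thesis
    using that[OF oK _ eig sorted] by (simp add: \<sigma>_def ev_def)
qed

lemma svd_norm:
  fixes N K :: "real^'d^'d"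
  assumes K: "orthogonal_matrix K"
    and eig: "\<And>j. transpose N *v (N *v (K *v axis j 1)) = (\<sigma> j)\<^sup>2 *\<^sub>R (K *v axis j 1)"
  shows "(norm (N *v (K *v y)))\<^sup>2 = (\<Sum>j\<in>UNIV. (\<sigma> j)\<^sup>2 * (y $ j)\<^sup>2)"
proof -
  have y: "y = (\<Sum>j\<in>UNIV. y $ j *\<^sub>R axis j 1)"
    by (metis (no_types, lifting) basis_expansion scalar_mult_eq_scaleR sum.cong)
  have KK: "transpose K *v (K *v x) = x" for x
    using K by (simp add: matrix_vector_mul_assoc orthogonal_matrix del: transpose_matrix_vector)
  have adj: "(M *v x) \<bullet> z = x \<bullet> (transpose M *v z)" for M :: "real^'d^'d" and x z
    by (metis dot_lmul_matrix inner_commute transpose_matrix_vector)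
  have "transpose N *v (N *v (K *v y)) = (\<Sum>j\<in>UNIV. y $ j *\<^sub>R (transpose N *v (N *v (K *v axis j 1))))"
    by (subst y) (simp add: linear_sum[OF matrix_vector_mul_linear] matrix_vector_mult_scaleR del: transpose_matrix_vector)
  also have "\<dots> = K *v (\<Sum>j\<in>UNIV. (y $ j * (\<sigma> j)\<^sup>2) *\<^sub>R axis j 1)"
    by (simp add: eig linear_sum[OF matrix_vector_mul_linear] matrix_vector_mult_scaleR del: transpose_matrix_vector)
  finally have 1: "transpose N *v (N *v (K *v y)) = K *v (\<Sum>j\<in>UNIV. (y $ j * (\<sigma> j)\<^sup>2) *\<^sub>R axis j 1)" .
  have "(norm (N *v (K *v y)))\<^sup>2 = y \<bullet> (transpose K *v (transpose N *v (N *v (K *v y))))"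
    unfolding power2_norm_eq_inner adj[of N] adj[of K] by simp
  also have "\<dots> = y \<bullet> (\<Sum>j\<in>UNIV. (y $ j * (\<sigma> j)\<^sup>2) *\<^sub>R axis j 1)"
    unfolding 1 KK ..
  also have "\<dots> = (\<Sum>j\<in>UNIV. (\<sigma> j)\<^sup>2 * (y $ j)\<^sup>2)"
    by (simp add: inner_sum_right inner_axis power2_eq_square mult_ac)
  finally show ?thesis .
qed

lemma power2_mult_norm: "(s * norm (x::real^'d))\<^sup>2 = (\<Sum>j\<in>UNIV. s\<^sup>2 * (x $ j)\<^sup>2)"
  by (simp add: power_mult_distrib norm_vec_def L2_set_def sum_nonneg sum_distrib_left)

section \<open>Courant--Fischer bounds and their consequences\<close>

definition coord_span :: "'d::finite set \<Rightarrow> (real^'d) set" where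
  "coord_span S = {u. \<forall>i. i \<notin> S \<longrightarrow> u $ i = 0}"

lemma subspace_coord_span: "subspace (coord_span S)"
  by (auto simp: coord_span_def subspace_def)

lemma dim_coord_span: "dim (coord_span S) = card S"
  using dim_substandard_cart[of S] unfolding coord_span_def dim_vec_eq[symmetric] .

definition coord_proj :: "'d::finite set \<Rightarrow> real^'d \<Rightarrow> real^'d" where
  "coord_proj S x = (\<chi> i. if i \<in> S then x $ i else 0)"

lemma linear_coord_proj: "linear (coord_proj S)"
  by (rule linearI) (auto simp: coord_proj_def vec_eq_iff)

lemma norm_coord_proj_le: "norm (coord_proj S x) \<le> norm x"
  unfolding norm_vec_def L2_set_def coord_proj_def
  by (intro real_sqrt_le_mono sum_mono) auto

lemma orthogonal_matrix_norm: "orthogonal_matrix K \<Longrightarrow> norm (K *v x) = norm (x::real^'d)"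
  using orthogonal_transformation_matrix[of "(*v) K"] by (simp add: orthogonal_transformation)

text \<open>One half of Courant--Fischer. By counting dimensions the image under \<open>X\<close> of
  the coordinate subspace contains a nonzero vector orthogonal to the first \<open>k\<close> right
  singular vectors, on which \<open>N\<close> stretches by at most \<open>\<sigma> (e k)\<close>.
  Test subspaces are presented as such images, so that applications only have to name a
  matrix.\<close>

lemma singular_value_ge:
  fixes N X :: "real^'d^'d"
  assumes e: "bij_betw e {..<CARD('d)} UNIV" and k: "k < CARD('d)"
    and X: "\<And>u. u \<in> coord_span (e ` {..k}) \<Longrightarrow> u \<noteq> 0 \<Longrightarrow> X *v u \<noteq> 0"
    and a: "\<And>u. u \<in> coord_span (e ` {..k}) \<Longrightarrow> a * norm (X *v u) \<le> norm (N *v (X *v u))"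
  shows "a \<le> singular_value (Suc k) N"
proof -
  obtain K \<sigma> where K: "orthogonal_matrix K" "\<And>j. 0 \<le> \<sigma> j"
    "\<And>j. transpose N *v (N *v (K *v axis j 1)) = (\<sigma> j)\<^sup>2 *\<^sub>R (K *v axis j 1)"
    and \<sigma>: "\<And>i k. i \<le> k \<Longrightarrow> k < CARD('d) \<Longrightarrow> \<sigma> (e k) \<le> \<sigma> (e i)"
    "\<And>k. k < CARD('d) \<Longrightarrow> singular_value (Suc k) N = \<sigma> (e k)"
    using svd_basis[OF e, of N] by metis
  define L where "L u = coord_proj (e ` {..<k}) (transpose K *v (X *v u))" for u
  have linL: "linear L"
    unfolding L_def using linear_compose[OF matrix_vector_mul_linear linear_compose[OF matrix_vector_mul_linear linear_coord_proj]]
    by (simp add: comp_def del: transpose_matrix_vector)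
  have "inj_on e {..k}" "inj_on e {..<k}"
    using e k by (auto simp: bij_betw_def intro!: inj_on_subset[of e "{..<CARD('d)}"])
  then have c: "card (e ` {..k}) = Suc k" "card (e ` {..<k}) = k"
    by (simp_all add: card_image)
  have "\<not> inj_on L (span (coord_span (e ` {..k})))"
  proof
    assume "inj_on L (span (coord_span (e ` {..k})))"
    then have "dim (L ` coord_span (e ` {..k})) = Suc k"
      using dim_image_eq[OF linL] by (simp add: dim_coord_span c)
    moreover have "L ` coord_span (e ` {..k}) \<subseteq> coord_span (e ` {..<k})"
      by (auto simp: L_def coord_proj_def coord_span_def)
    then have "dim (L ` coord_span (e ` {..k})) \<le> k"
      using dim_subset dim_coord_span[of "e ` {..<k}"] c by metis
    ultimately show False by simp
  qed
  then obtain u where u: "u \<in> coord_span (e ` {..k})" "u \<noteq> 0" "L u = 0"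
    using linear_injective_on_subspace_0[OF linL subspace_coord_span]
    by (metis span_eq_iff subspace_coord_span)
  define y where "y = transpose K *v (X *v u)"
  have "K *v y = X *v u"
    using K(1) by (simp add: y_def matrix_vector_mul_assoc matrix_mul_assoc orthogonal_matrix_def del: transpose_matrix_vector)
  then have Ky: "norm (X *v u) = norm y" and Xu: "X *v u = K *v y"
    using orthogonal_matrix_norm[OF K(1)] by metis+
  have y0: "y $ e i = 0" if "i < k" for i
  proof -
    have "coord_proj (e ` {..<k}) y $ e i = 0" using u(3) by (simp add: L_def y_def)
    then show ?thesis using that by (simp add: coord_proj_def)
  qed
  have "(norm (N *v (X *v u)))\<^sup>2 = (\<Sum>j\<in>UNIV. (\<sigma> j)\<^sup>2 * (y $ j)\<^sup>2)"
    unfolding Xu by (rule svd_norm[OF K(1,3)])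
  also have "\<dots> \<le> (\<Sum>j\<in>UNIV. (\<sigma> (e k))\<^sup>2 * (y $ j)\<^sup>2)"
  proof (rule sum_mono)
    fix j
    obtain i where i: "i < CARD('d)" "j = e i" using e by (auto simp: bij_betw_def)
    show "(\<sigma> j)\<^sup>2 * (y $ j)\<^sup>2 \<le> (\<sigma> (e k))\<^sup>2 * (y $ j)\<^sup>2"
    proof (cases "i < k")
      case False
      then have "\<sigma> j \<le> \<sigma> (e k)" using \<sigma>(1)[of k i] i by auto
      then show ?thesis using K(2) by (intro mult_right_mono power_mono) auto
    qed (simp add: i y0)
  qed
  also have "\<dots> = (\<sigma> (e k) * norm y)\<^sup>2"
    by (rule power2_mult_norm[symmetric])
  finally have "norm (N *v (X *v u)) \<le> \<sigma> (e k) * norm y"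
    by (rule power2_le_imp_le) (simp add: K(2))
  with a[OF u(1)] have "a * norm y \<le> \<sigma> (e k) * norm y" by (simp add: Ky)
  moreover have "norm y > 0" unfolding Ky[symmetric] using X[OF u(1,2)] by simp
  ultimately show ?thesis using \<sigma>(2)[OF k] by simp
qed

text \<open>The other half of Courant--Fischer: the span of the first \<open>k + 1\<close> right
  singular vectors is extremal.\<close>

lemma singular_value_attained:
  fixes N :: "real^'d^'d"
  assumes e: "bij_betw e {..<CARD('d)} UNIV" and k: "k < CARD('d)"
  obtains K where "orthogonal_matrix K"
    "\<And>u. u \<in> coord_span (e ` {..k}) \<Longrightarrow> singular_value (Suc k) N * norm u \<le> norm (N *v (K *v u))"
    "0 \<le> singular_value (Suc k) N"
proof -
  obtain K \<sigma> where K: "orthogonal_matrix K" "\<And>j. 0 \<le> \<sigma> j"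
    "\<And>j. transpose N *v (N *v (K *v axis j 1)) = (\<sigma> j)\<^sup>2 *\<^sub>R (K *v axis j 1)"
    and \<sigma>: "\<And>i k. i \<le> k \<Longrightarrow> k < CARD('d) \<Longrightarrow> \<sigma> (e k) \<le> \<sigma> (e i)"
    "\<And>k. k < CARD('d) \<Longrightarrow> singular_value (Suc k) N = \<sigma> (e k)"
    using svd_basis[OF e, of N] by metis
  have "\<sigma> (e k) * norm u \<le> norm (N *v (K *v u))" if u: "u \<in> coord_span (e ` {..k})" for u
  proof (rule power2_le_imp_le)
    have "(\<sigma> (e k) * norm u)\<^sup>2 = (\<Sum>j\<in>UNIV. (\<sigma> (e k))\<^sup>2 * (u $ j)\<^sup>2)"
      by (rule power2_mult_norm)
    also have "\<dots> \<le> (\<Sum>j\<in>UNIV. (\<sigma> j)\<^sup>2 * (u $ j)\<^sup>2)"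
    proof (rule sum_mono)
      fix j
      show "(\<sigma> (e k))\<^sup>2 * (u $ j)\<^sup>2 \<le> (\<sigma> j)\<^sup>2 * (u $ j)\<^sup>2"
      proof (cases "j \<in> e ` {..k}")
        case True
        then have "\<sigma> (e k) \<le> \<sigma> j" using \<sigma>(1) k by auto
        then show ?thesis using K(2) by (intro mult_right_mono power_mono) auto
      next
        case False
        then show ?thesis using u by (simp add: coord_span_def)
      qed
    qed
    also have "\<dots> = (norm (N *v (K *v u)))\<^sup>2" by (rule svd_norm[OF K(1,3), symmetric])
    finally show "(\<sigma> (e k) * norm u)\<^sup>2 \<le> (norm (N *v (K *v u)))\<^sup>2" .
  qed simp
  then show ?thesis using that[OF K(1)] K(2) \<sigma>(2)[OF k] by simp
qed

lemma ex_enumeration: "\<exists>e. bij_betw e {..<CARD('d::finite)} (UNIV :: 'd set)"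
  by (metis atLeast0LessThan ex_bij_betw_nat_finite finite)

lemma norm_matrix_vector_le: "norm ((M::real^'d^'d) *v x) \<le> (real CARD('d))\<^sup>2 * norm M * norm x"
proof -
  have "\<bar>M $ i $ j\<bar> \<le> norm M" for i j
    using component_le_norm_cart[of "M $ i" j] Finite_Cartesian_Product.norm_nth_le[of M i] by linarith
  then have "onorm ((*v) M) \<le> real CARD('d) * real CARD('d) * norm M"
    by (rule onorm_le_matrix_component)
  then have "onorm ((*v) M) * norm x \<le> (real CARD('d))\<^sup>2 * norm M * norm x"
    by (intro mult_right_mono) (auto simp: power2_eq_square)
  then show ?thesis using onorm[OF matrix_vector_mul_bounded_linear[of M], of x] by linarith
qed

text \<open>The variational bound for \<open>M\<close> is tested on the extremal subspace of
  \<open>N\<close>. The constant comes from a crude entrywise estimate of the operator norm; some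
  Lipschitz constant is enough for continuity and thus for measurability.\<close>

lemma singular_value_diff_le:
  fixes M N :: "real^'d^'d"
  assumes k: "k < CARD('d)"
  shows "singular_value (Suc k) N - (real CARD('d))\<^sup>2 * norm (N - M) \<le> singular_value (Suc k) M"
proof -
  obtain e :: "nat \<Rightarrow> 'd" where e: "bij_betw e {..<CARD('d)} UNIV" using ex_enumeration by blast
  obtain K where K: "orthogonal_matrix K"
    "\<And>u. u \<in> coord_span (e ` {..k}) \<Longrightarrow> singular_value (Suc k) N * norm u \<le> norm (N *v (K *v u))"
    using singular_value_attained[OF e k] by metis
  note nK = orthogonal_matrix_norm[OF K(1)]
  show ?thesis
  proof (rule singular_value_ge[OF e k, where X = K])
    show "K *v u \<noteq> 0" if "u \<noteq> 0" for u using nK[of u] that by auto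
    fix u assume "u \<in> coord_span (e ` {..k})"
    from K(2)[OF this] have "singular_value (Suc k) N * norm u \<le> norm (M *v (K *v u) + (N - M) *v (K *v u))"
      by (simp add: matrix_vector_mult_diff_rdistrib)
    also have "\<dots> \<le> norm (M *v (K *v u)) + (real CARD('d))\<^sup>2 * norm (N - M) * norm u"
      using norm_triangle_ineq norm_matrix_vector_le[of "N - M" "K *v u"] unfolding nK by (meson add_left_mono order_trans)
    finally show "(singular_value (Suc k) N - (real CARD('d))\<^sup>2 * norm (N - M)) * norm (K *v u) \<le> norm (M *v (K *v u))"
      unfolding nK by (simp add: algebra_simps)
  qed
qed

lemma measurable_singular_value:
  assumes k: "k < CARD('d::finite)"
  shows "(singular_value (Suc k) :: real^'d^'d \<Rightarrow> real) \<in> borel_measurable borel"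
proof (rule borel_measurable_continuous_onI, rule continuous_onI)
  fix N :: "real^'d^'d" and r :: real assume r: "0 < r"
  let ?C = "(real CARD('d))\<^sup>2"
  have C: "?C > 0" by simp
  show "\<exists>d>0. \<forall>M\<in>UNIV. dist M N < d \<longrightarrow> dist (singular_value (Suc k) M) (singular_value (Suc k) N) \<le> r"
  proof (intro exI[of _ "r / ?C"] conjI ballI impI)
    show "0 < r / ?C" using r C by simp
    fix M assume "dist M N < r / ?C"
    then have "?C * norm (M - N) < r" using C by (simp add: dist_norm field_simps)
    then show "dist (singular_value (Suc k) M) (singular_value (Suc k) N) \<le> r"
      using singular_value_diff_le[OF k, of M N] singular_value_diff_le[OF k, of N M]
      by (simp add: dist_real_def norm_minus_commute)
  qed
qed

text \<open>The test subspace is the preimage under \<open>C\<close> of the extremal subspace of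
  \<open>B\<close>.\<close>

lemma singular_value_mult_ge:
  fixes B C :: "real^'d^'d"
  assumes k: "k < CARD('d)" and c: "0 < c" "\<And>x. c * norm x \<le> norm (C *v x)"
  shows "singular_value (Suc k) B * c \<le> singular_value (Suc k) (B ** C)"
proof -
  obtain e :: "nat \<Rightarrow> 'd" where e: "bij_betw e {..<CARD('d)} UNIV" using ex_enumeration by blast
  obtain K where K: "orthogonal_matrix K"
    "\<And>u. u \<in> coord_span (e ` {..k}) \<Longrightarrow> singular_value (Suc k) B * norm u \<le> norm (B *v (K *v u))"
    and s0: "0 \<le> singular_value (Suc k) B"
    using singular_value_attained[OF e k] by metis
  note nK = orthogonal_matrix_norm[OF K(1)]
  have "x = 0" if "C *v x = 0" for x
    using c(2)[of x] that c(1) by (simp add: mult_le_0_iff)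
  then have "invertible C"
    using invertible_left_inverse matrix_left_invertible_ker by blast
  then obtain C' where "C ** C' = mat 1" by (auto simp: invertible_def)
  then have C': "C *v (C' *v x) = x" for x
    by (simp add: matrix_vector_mul_assoc)
  show ?thesis
  proof (rule singular_value_ge[OF e k, where X = "C' ** K"])
    fix u assume u: "u \<in> coord_span (e ` {..k})"
    have CX: "C *v (C' ** K *v u) = K *v u"
      by (simp add: matrix_vector_mul_assoc[symmetric] C')
    show "C' ** K *v u \<noteq> 0" if "u \<noteq> 0"
    proof
      assume "C' ** K *v u = 0"
      then have "K *v u = 0" using CX by simp
      then show False using nK[of u] that by simp
    qed
    have "singular_value (Suc k) B * c * norm (C' ** K *v u) \<le> singular_value (Suc k) B * norm u"
      using c(2)[of "C' ** K *v u"] s0 unfolding CX nK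
      by (simp add: mult.assoc mult_left_mono)
    also have "\<dots> \<le> norm (B *v (K *v u))" by (rule K(2)[OF u])
    also have "\<dots> = norm (B ** C *v (C' ** K *v u))"
      unfolding matrix_vector_mul_assoc[of B C, symmetric] CX ..
    finally show "singular_value (Suc k) B * c * norm (C' ** K *v u) \<le>
      norm (B ** C *v (C' ** K *v u))" .
  qed
qed

lemma invertible_bounded_below:
  fixes N :: "real^'d^'d"
  assumes "invertible N"
  obtains c where "0 < c" "\<And>x. c * norm x \<le> norm (N *v x)"
proof -
  have "inj ((*v) N)" using assms by (simp add: invertible_left_inverse matrix_left_invertible_injective)
  then show ?thesis
    using linear_inj_bounded_below_pos[OF matrix_vector_mul_linear, of N] that by (metis mult.commute)
qed

lemma singular_value_pos:
  fixes N :: "real^'d^'d"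
  assumes k: "k < CARD('d)" and N: "invertible N"
  shows "0 < singular_value (Suc k) N"
proof -
  obtain e :: "nat \<Rightarrow> 'd" where e: "bij_betw e {..<CARD('d)} UNIV" using ex_enumeration by blast
  obtain c where c: "0 < c" "\<And>x. c * norm x \<le> norm (N *v x)" using invertible_bounded_below[OF N] by blast
  have "c \<le> singular_value (Suc k) N"
    by (rule singular_value_ge[OF e k, where X = "mat 1"]) (use c in auto)
  then show ?thesis using c by simp
qed

section \<open>From the half-density to the ratio of singular values\<close>

text \<open>Here \<open>X\<close> is close to the matrix \<open>K\<close> of right singular vectors of \<open>N\<close>, so that \<open>N X\<close> maps the
  coordinate flag to a flag on which \<open>phi\<close> sees the ratio of the two singular values.\<close>

lemma (in partial_flag) phi_ge_ratio:
  fixes N K X :: "real^'d^'d"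
  assumes K: "orthogonal_matrix K"
    and eig: "\<And>j. transpose N *v (N *v (K *v axis j 1)) = (\<sigma> j)\<^sup>2 *\<^sub>R (K *v axis j 1)"
    and \<sigma>I: "\<And>j. j \<in> I \<Longrightarrow> \<sigma> p \<le> \<sigma> j" and \<sigma>C: "\<And>j. j \<notin> I \<Longrightarrow> \<sigma> j \<le> \<sigma> p"
    and \<sigma>0: "\<And>j. 0 \<le> \<sigma> j" and q0: "0 < \<sigma> q"
    and close: "\<And>x. norm (X *v x - K *v x) \<le> norm x / 2" and t: "0 \<le> t" "t \<le> 1"
  shows "ennreal (sqrt (\<sigma> q / \<sigma> p)) \<le> 12 * phi (N ** X ** shear t)"
proof -
  \<comment> \<open>This is \<open>X\<close> in the coordinates of the right singular vectors:
    \<open>T\<close> differs from the identity by at most 1/2, and the norm of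
    \<open>N ** X *v x\<close> is a diagonal quadratic form in \<open>T x\<close>.\<close>
  define T where "T x = transpose K *v (X *v x)" for x
  have KK: "K *v (transpose K *v x) = x" "transpose K *v (K *v x) = x" for x
    using K by (simp_all add: matrix_vector_mul_assoc orthogonal_matrix_def del: transpose_matrix_vector)
  have nT: "norm (transpose K *v x) = norm x" for x
    using orthogonal_matrix_norm[OF K, of "transpose K *v x"] by (simp add: KK del: transpose_matrix_vector)
  have linT: "linear T"
    unfolding T_def by (intro linearI) (simp_all only: matrix_vector_right_distrib matrix_vector_mult_scaleR)
  have Tclose: "norm (T x - x) \<le> norm x / 2" for x
  proof -
    have "T x - x = transpose K *v (X *v x - K *v x)"
      by (simp add: T_def matrix_vector_mult_diff_distrib KK del: transpose_matrix_vector)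
    then show ?thesis using close[of x] by (simp add: nT del: transpose_matrix_vector)
  qed
  have NX: "(norm (N ** X *v x))\<^sup>2 = (\<Sum>j\<in>UNIV. (\<sigma> j)\<^sup>2 * (T x $ j)\<^sup>2)" for x
  proof -
    have "N ** X *v x = N *v (K *v T x)"
      by (simp add: T_def KK matrix_vector_mul_assoc[symmetric] del: transpose_matrix_vector)
    then show ?thesis using svd_norm[OF K eig] by simp
  qed
  \<comment> \<open>Projecting \<open>T u\<close> to the coordinates in \<open>S\<close> loses at
    most half of the norm of \<open>u\<close>.\<close>
  have lower: "s / 2 * norm u \<le> norm (N ** X *v u)"
    if u: "u \<in> coord_span S" and s: "0 \<le> s" "\<And>j. j \<in> S \<Longrightarrow> s \<le> \<sigma> j" for S u s
  proof -
    have cu: "coord_proj S u = u" using u by (auto simp: coord_proj_def coord_span_def vec_eq_iff)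
    have "norm u \<le> norm (coord_proj S (T u)) + norm (coord_proj S (u - T u))"
      using norm_triangle_ineq[of "coord_proj S (T u)" "coord_proj S (u - T u)"]
      by (simp add: linear_diff[OF linear_coord_proj] cu)
    also have "norm (coord_proj S (u - T u)) \<le> norm u / 2"
      using norm_coord_proj_le[of S "u - T u"] Tclose[of u] by (simp add: norm_minus_commute)
    finally have h: "norm u / 2 \<le> norm (coord_proj S (T u))" by simp
    have "(s * norm (coord_proj S (T u)))\<^sup>2 = (\<Sum>j\<in>UNIV. s\<^sup>2 * (coord_proj S (T u) $ j)\<^sup>2)"
      by (rule power2_mult_norm)
    also have "\<dots> \<le> (\<Sum>j\<in>UNIV. (\<sigma> j)\<^sup>2 * (T u $ j)\<^sup>2)"
      using s by (intro sum_mono) (auto simp: coord_proj_def intro!: mult_right_mono power_mono)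
    finally have "s * norm (coord_proj S (T u)) \<le> norm (N ** X *v u)"
      unfolding NX[symmetric] by (rule power2_le_imp_le) simp
    moreover have "s * (norm u / 2) \<le> s * norm (coord_proj S (T u))"
      using h s(1) by (rule mult_left_mono)
    ultimately show ?thesis by simp
  qed
  \<comment> \<open>The correction \<open>v\<close> cancels the coordinates in \<open>I\<close> of
    \<open>T (w + v)\<close>, where \<open>N\<close> may be large. It exists since \<open>Q\<close>
    perturbs the identity by norm at most 1/2, and it is no longer than \<open>w\<close>; so 3 is
    3/2 for \<open>T\<close> times 2 for \<open>w + v\<close>.\<close>
  have upper: "\<exists>v\<in>V. norm (N ** X *v (w + v)) \<le> 3 * \<sigma> p * norm w"
    if w: "\<And>i. i \<in> I \<Longrightarrow> w $ i = 0" for w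
  proof -
    define P where "P = coord_proj I"
    define E where "E x = T x - x" for x
    have linE: "linear E" unfolding E_def by (intro linear_compose_sub linT) (simp add: linear_id[unfolded id_def])
    have linP: "linear P" unfolding P_def by (rule linear_coord_proj)
    have small: "norm (P (E x)) \<le> norm x / 2" for x
      using norm_coord_proj_le[of I "E x"] Tclose[of x] by (simp add: P_def E_def)
    define Q where "Q x = x + P (E (P x))" for x
    have linQ: "linear Q"
      unfolding Q_def using linear_compose[OF linP linear_compose[OF linE linP]]
      by (intro linear_compose_add) (simp_all add: linear_id[unfolded id_def] comp_def)
    have "inj Q"
      unfolding linear_injective_0[OF linQ]
    proof (intro allI impI)
      fix x assume "Q x = 0"
      then have "norm x = norm (P (E (P x)))" by (simp add: Q_def add_eq_0_iff)
      also have "\<dots> \<le> norm (P x) / 2" by (rule small)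
      also have "\<dots> \<le> norm x / 2" using norm_coord_proj_le[of I x] by (simp add: P_def)
      finally show "x = 0" by simp
    qed
    then have "surj Q" using linear_injective_imp_surjective[OF linQ] by blast
    then obtain v where v: "Q v = - P (E w)" by (metis surjD)
    have PP: "P (P x) = P x" for x by (simp add: P_def coord_proj_def vec_eq_iff)
    have v_eq: "v = - P (E w) - P (E (P v))" using v by (simp add: Q_def eq_diff_eq)
    then have "P v = - P (P (E w)) - P (P (E (P v)))"
      by (metis linear_diff[OF linP] linear_neg[OF linP])
    then have Pv: "P v = v" unfolding PP using v_eq by simp
    then have vV: "v \<in> V" unfolding V_def P_def coord_proj_def by (auto simp: vec_eq_iff) metis
    have "norm v \<le> norm (P (E w)) + norm (P (E v))"
      using v_eq Pv norm_triangle_ineq4[of "- P (E w)" "P (E v)"] by simp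
    also have "\<dots> \<le> norm w / 2 + norm v / 2" using small[of w] small[of v] by simp
    finally have nv: "norm v \<le> norm w" by simp
    have z: "T (w + v) $ i = 0" if "i \<in> I" for i
    proof -
      have "P (T (w + v)) = P w + P v + P (E w) + P (E v)"
        by (simp add: E_def linear_add[OF linT] linear_add[OF linP] linear_diff[OF linP])
      also have "P w = 0" using w by (simp add: P_def coord_proj_def vec_eq_iff)
      also have "0 + P v + P (E w) + P (E v) = 0"
      proof -
        have "v = - (P (E w) + P (E v))" using v_eq unfolding Pv by simp
        then have "v + (P (E w) + P (E v)) = 0" by (subst eq_neg_iff_add_eq_0[symmetric])
        then show ?thesis by (simp add: Pv add.assoc)
      qed
      finally show ?thesis using that by (simp add: P_def coord_proj_def vec_eq_iff) metis
    qed
    have "(norm (N ** X *v (w + v)))\<^sup>2 \<le> (\<Sum>j\<in>UNIV. (\<sigma> p)\<^sup>2 * (T (w + v) $ j)\<^sup>2)"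
      unfolding NX
    proof (rule sum_mono)
      fix j show "(\<sigma> j)\<^sup>2 * (T (w + v) $ j)\<^sup>2 \<le> (\<sigma> p)\<^sup>2 * (T (w + v) $ j)\<^sup>2"
        using z \<sigma>C \<sigma>0 by (cases "j \<in> I") (auto intro!: mult_right_mono power_mono)
    qed
    also have "\<dots> = (\<sigma> p * norm (T (w + v)))\<^sup>2"
      by (rule power2_mult_norm[symmetric])
    finally have "norm (N ** X *v (w + v)) \<le> \<sigma> p * norm (T (w + v))"
      by (rule power2_le_imp_le) (simp add: \<sigma>0)
    also have "norm (T (w + v)) \<le> 3 * norm w"
    proof -
      have "norm (T (w + v)) \<le> norm (T (w + v) - (w + v)) + norm (w + v)"
        by (metis diff_add_cancel norm_triangle_ineq)
      also have "\<dots> \<le> 3 / 2 * norm (w + v)" using Tclose[of "w + v"] by simp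
      also have "norm (w + v) \<le> 2 * norm w" using norm_triangle_ineq[of w v] nv by simp
      finally show ?thesis by simp
    qed
    then have "\<sigma> p * norm (T (w + v)) \<le> \<sigma> p * (3 * norm w)" by (rule mult_left_mono) (rule \<sigma>0)
    finally show ?thesis using vV by (intro bexI[of _ v]) (simp_all add: mult.commute mult.left_commute)
  qed
  define Y where "Y = N ** X"
  define a b where "a = pr Y ep" and "b = pr Y eq"
  have pr_lb: "\<exists>v\<in>V. pr Y (\<alpha> *\<^sub>R ep + \<beta> *\<^sub>R eq) = N ** X *v (\<alpha> *\<^sub>R ep + \<beta> *\<^sub>R eq + v) \<and>
      \<alpha> *\<^sub>R ep + \<beta> *\<^sub>R eq + v \<in> coord_span (insert p (if \<beta> = 0 then I else insert q I)) \<and>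
      \<bar>\<alpha>\<bar> \<le> norm (\<alpha> *\<^sub>R ep + \<beta> *\<^sub>R eq + v) \<and> \<bar>\<beta>\<bar> \<le> norm (\<alpha> *\<^sub>R ep + \<beta> *\<^sub>R eq + v)" for \<alpha> \<beta>
  proof -
    obtain v where v: "v \<in> V" "pr Y (\<alpha> *\<^sub>R ep + \<beta> *\<^sub>R eq) = Y *v (\<alpha> *\<^sub>R ep + \<beta> *\<^sub>R eq + v)" using pr_ex by blast
    have "(\<alpha> *\<^sub>R ep + \<beta> *\<^sub>R eq + v) $ p = \<alpha>" "(\<alpha> *\<^sub>R ep + \<beta> *\<^sub>R eq + v) $ q = \<beta>"
      using pq V_pq[OF v(1)] by (auto simp: axis_def)
    then have "\<bar>\<alpha>\<bar> \<le> norm (\<alpha> *\<^sub>R ep + \<beta> *\<^sub>R eq + v)" "\<bar>\<beta>\<bar> \<le> norm (\<alpha> *\<^sub>R ep + \<beta> *\<^sub>R eq + v)"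
      by (metis component_le_norm_cart)+
    moreover have "\<alpha> *\<^sub>R ep + \<beta> *\<^sub>R eq + v \<in> coord_span (insert p (if \<beta> = 0 then I else insert q I))"
      using v(1) by (auto simp: coord_span_def V_def axis_def)
    ultimately show ?thesis using v unfolding Y_def by blast
  qed
  have p0: "0 < \<sigma> p" using q0 \<sigma>C[OF qI] by simp
  have "\<sigma> p / 2 \<le> norm a"
  proof -
    obtain v where v: "a = N ** X *v (ep + v)" "ep + v \<in> coord_span (insert p I)" "1 \<le> norm (ep + v)"
      using pr_lb[of 1 0] by (auto simp: a_def)
    have "\<sigma> p / 2 * 1 \<le> \<sigma> p / 2 * norm (ep + v)" using v(3) p0 by (intro mult_left_mono) auto
    also have "\<dots> \<le> norm a" unfolding v(1) using v(2) p0 \<sigma>I by (intro lower) auto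
    finally show ?thesis by simp
  qed
  note la = this
  have l2: "\<sigma> q / 2 \<le> norm (\<alpha> *\<^sub>R a + \<beta> *\<^sub>R b)" if "\<bar>\<alpha>\<bar> \<ge> 1 \<or> \<bar>\<beta>\<bar> \<ge> 1" for \<alpha> \<beta>
  proof -
    obtain v where v: "pr Y (\<alpha> *\<^sub>R ep + \<beta> *\<^sub>R eq) = N ** X *v (\<alpha> *\<^sub>R ep + \<beta> *\<^sub>R eq + v)"
      and S: "\<alpha> *\<^sub>R ep + \<beta> *\<^sub>R eq + v \<in> coord_span (insert p (if \<beta> = 0 then I else insert q I))"
      and n: "\<bar>\<alpha>\<bar> \<le> norm (\<alpha> *\<^sub>R ep + \<beta> *\<^sub>R eq + v)" "\<bar>\<beta>\<bar> \<le> norm (\<alpha> *\<^sub>R ep + \<beta> *\<^sub>R eq + v)"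
      using pr_lb[of \<alpha> \<beta>] by blast
    have v2: "\<alpha> *\<^sub>R ep + \<beta> *\<^sub>R eq + v \<in> coord_span (insert p (insert q I))"
      using S by (cases "\<beta> = 0") (auto simp: coord_span_def)
    have v3: "1 \<le> norm (\<alpha> *\<^sub>R ep + \<beta> *\<^sub>R eq + v)" using that n by linarith
    have "\<sigma> q / 2 * 1 \<le> \<sigma> q / 2 * norm (\<alpha> *\<^sub>R ep + \<beta> *\<^sub>R eq + v)" using v3 q0 by (intro mult_left_mono) auto
    also have "\<dots> \<le> norm (pr Y (\<alpha> *\<^sub>R ep + \<beta> *\<^sub>R eq))" unfolding v
    proof (rule lower[OF v2])
      show "\<sigma> q \<le> \<sigma> j" if "j \<in> insert p (insert q I)" for j
        using that \<sigma>I[of j] \<sigma>C[OF qI] by auto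
    qed (use q0 in simp)
    finally show ?thesis by (simp add: pr_lin a_def b_def)
  qed
  have a0: "a \<noteq> 0" using la p0 by auto
  \<comment> \<open>Base times height: \<open>s\<close> is the coefficient for which
    \<open>s *\<^sub>R a + b\<close> is orthogonal to \<open>a\<close>, and \<open>l2\<close> bounds
    this vector from below.\<close>
  have area_ge: "\<sigma> p * \<sigma> q / 4 \<le> area Y"
  proof -
    define s where "s = - (a \<bullet> b) / (a \<bullet> a)"
    have aa: "a \<bullet> a \<noteq> 0" using a0 by simp
    have "(norm a)\<^sup>2 * (norm b)\<^sup>2 - (a \<bullet> b)\<^sup>2 = (norm a * norm (s *\<^sub>R a + 1 *\<^sub>R b))\<^sup>2"
      unfolding power_mult_distrib power2_norm_eq_inner s_def
      using aa by (simp add: inner_add_left inner_add_right inner_diff_left inner_diff_right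
        inner_commute[of b a] power2_eq_square field_simps)
    then have "area Y = norm a * norm (s *\<^sub>R a + 1 *\<^sub>R b)"
      unfolding area_def a_def[symmetric] b_def[symmetric] by simp
    moreover have "\<sigma> p / 2 * (\<sigma> q / 2) \<le> norm a * norm (s *\<^sub>R a + 1 *\<^sub>R b)"
      using la l2[of s 1] p0 q0 by (intro mult_mono) auto
    ultimately show ?thesis by simp
  qed
  have phi_eq: "phi (Y ** shear t) = ennreal (sqrt (area Y) / norm (1 *\<^sub>R a + t *\<^sub>R b))"
    unfolding phi_def pr_shear area_shear a_def b_def ..
  have npos: "0 < norm (1 *\<^sub>R a + t *\<^sub>R b)" 
    by (rule less_le_trans[OF _ l2]) (use q0 in auto)
  have nle: "norm (1 *\<^sub>R a + t *\<^sub>R b) \<le> 6 * \<sigma> p"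
  proof -
    define w where "w = 1 *\<^sub>R ep + t *\<^sub>R eq"
    have "w $ i = 0" if "i \<in> I" for i using that pI qI by (auto simp: w_def axis_def)
    then obtain v where "v \<in> V" "norm (N ** X *v (w + v)) \<le> 3 * \<sigma> p * norm w" using upper by blast
    then have "norm (pr Y w) \<le> 3 * \<sigma> p * norm w"
      using norm_pr_le[of v Y w] by (simp add: Y_def)
    also have "norm w \<le> 2"
      unfolding w_def using norm_triangle_ineq[of "1 *\<^sub>R ep" "t *\<^sub>R eq"] t by (simp add: norm_axis_1)
    then have "3 * \<sigma> p * norm w \<le> 3 * \<sigma> p * 2" using p0 by (intro mult_left_mono) auto
    finally show ?thesis by (simp only: w_def pr_lin a_def b_def)
  qed
  \<comment> \<open>The 12 consists of a 2 from the square root of the 4 in \<open>area_ge\<close>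
    and the 6 of \<open>nle\<close>.\<close>
  have "sqrt (\<sigma> q / \<sigma> p) = sqrt (\<sigma> p * \<sigma> q / (\<sigma> p)\<^sup>2)"
    using p0 by (simp add: power2_eq_square)
  also have "\<dots> = 12 * (sqrt (\<sigma> p * \<sigma> q / 4) / (6 * \<sigma> p))"
    using p0 by (simp add: real_sqrt_divide real_sqrt_mult)
  also have "\<dots> \<le> 12 * (sqrt (area Y) / norm (1 *\<^sub>R a + t *\<^sub>R b))"
    using area_ge npos nle p0 q0 by (intro mult_left_mono frac_le real_sqrt_le_mono)
      (auto simp: area_nonneg)
  finally have "ennreal (sqrt (\<sigma> q / \<sigma> p)) \<le> ennreal (12 * (sqrt (area Y) / norm (1 *\<^sub>R a + t *\<^sub>R b)))"
    by (rule ennreal_leI)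
  also have "\<dots> = 12 * phi (Y ** shear t)"
    unfolding phi_eq by (subst ennreal_mult) (auto simp: area_nonneg)
  finally show ?thesis by (simp add: Y_def)
qed

text \<open>The matrix of right singular vectors depends on the random product, whereas the decay
  concerns a deterministic frame. Compactness of the cube provides finitely many frames that stand
  in for all orthogonal matrices.\<close>

lemma finite_orthogonal_net:
  "\<exists>F :: (real^'d^'d) set. finite F \<and>
    (\<forall>K. orthogonal_matrix K \<longrightarrow> (\<exists>X\<in>F. \<forall>x. norm (X *v x - K *v x) \<le> norm x / 2))"
proof -
  define C where "C = (real CARD('d))\<^sup>2"
  have C: "C > 0" by (simp add: C_def)
  have "compact (cube 1 :: (real^'d^'d) set)" unfolding cube_cbox by simp
  then obtain F :: "(real^'d^'d) set" where F: "finite F" "cube 1 \<subseteq> (\<Union>X\<in>F. ball X (1 / (2 * C)))"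
    using C unfolding compact_eq_totally_bounded by (metis divide_pos_pos zero_less_mult_iff zero_less_numeral zero_less_one)
  have "\<exists>X\<in>F. \<forall>x. norm (X *v x - K *v x) \<le> norm x / 2" if K: "orthogonal_matrix K" for K
  proof -
    have "\<bar>K $ i $ j\<bar> \<le> 1" for i j
      using component_le_norm_cart[of "K *v axis j 1" i] orthogonal_matrix_norm[OF K, of "axis j 1"]
      by (simp add: matrix_vector_mult_basis column_def norm_axis_1)
    then have "K \<in> cube 1" by (simp add: cube_def)
    then obtain X where X: "X \<in> F" "dist X K < 1 / (2 * C)" using F(2) by auto
    have "norm (X *v x - K *v x) \<le> norm x / 2" for x
    proof -
      have "norm (X *v x - K *v x) \<le> C * norm (X - K) * norm x"
        using norm_matrix_vector_le[of "X - K" x] by (simp add: C_def matrix_vector_mult_diff_rdistrib)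
      also have "\<dots> \<le> 1 / 2 * norm x"
        using X(2) C by (intro mult_right_mono) (auto simp: dist_norm field_simps)
      finally show ?thesis by simp
    qed
    then show ?thesis using X(1) by blast
  qed
  then show ?thesis using F(1) by blast
qed

lemma partial_flag_enumeration:
  fixes e :: "nat \<Rightarrow> 'd::finite"
  assumes e: "bij_betw e {..<CARD('d)} UNIV" and k: "Suc k < CARD('d)"
  shows "partial_flag (e ` {..<k}) (e k) (e (Suc k))"
proof -
  have inj: "e i = e i' \<longleftrightarrow> i = i'" if "i < CARD('d)" "i' < CARD('d)" for i i'
    using e that by (auto simp: bij_betw_def inj_on_def)
  show ?thesis
  proof
    show "e k \<notin> e ` {..<k}" "e (Suc k) \<notin> e ` {..<k}" "e k \<noteq> e (Suc k)"
      using k by (auto simp: inj)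
  qed
qed

text \<open>Summing over all of \<open>F\<close> removes the dependence of the suitable
  \<open>X\<close> on \<open>N\<close>. The pointwise bound is integrated over slopes in
  \<open>{0..1}\<close> because the contraction controls integrals over the fibre and not single
  lines. The \<open>j\<close> of the overview is \<open>Suc k\<close>.\<close>

lemma singular_value_ratio_le:
  fixes N :: "real^'d^'d"
  assumes e: "bij_betw e {..<CARD('d)} UNIV" and k: "Suc k < CARD('d)" and N: "invertible N"
    and F: "finite F" "\<And>K. orthogonal_matrix K \<Longrightarrow> \<exists>X\<in>F. \<forall>x. norm (X *v x - K *v x) \<le> norm x / 2"
  shows "ennreal (sqrt (singular_value (Suc (Suc k)) N / singular_value (Suc k) N)) \<le>
    (\<Sum>X\<in>F. 12 * (\<integral>\<^sup>+t. indicator {0..1} t *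
       partial_flag.phi (e ` {..<k}) (e k) (e (Suc k)) (N ** X ** partial_flag.blk (e k) (e (Suc k)) 1 t 0 1) \<partial>lborel))"
proof -
  interpret partial_flag "e ` {..<k}" "e k" "e (Suc k)" by (rule partial_flag_enumeration[OF e k])
  obtain K \<sigma> where K: "orthogonal_matrix K" "\<And>j. 0 \<le> \<sigma> j"
    "\<And>j. transpose N *v (N *v (K *v axis j 1)) = (\<sigma> j)\<^sup>2 *\<^sub>R (K *v axis j 1)"
    and \<sigma>: "\<And>i k. i \<le> k \<Longrightarrow> k < CARD('d) \<Longrightarrow> \<sigma> (e k) \<le> \<sigma> (e i)"
    "\<And>k. k < CARD('d) \<Longrightarrow> singular_value (Suc k) N = \<sigma> (e k)"
    using svd_basis[OF e, of N] by metis
  obtain X where X: "X \<in> F" "\<And>x. norm (X *v x - K *v x) \<le> norm x / 2" using F(2)[OF K(1)] by blast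
  have q0: "0 < \<sigma> (e (Suc k))" using singular_value_pos[OF k N] \<sigma>(2)[OF k] by simp
  let ?\<Phi> = "\<lambda>X t. phi (N ** X ** shear t)"
  have le: "ennreal (sqrt (\<sigma> (e (Suc k)) / \<sigma> (e k))) \<le> 12 * ?\<Phi> X t" if "t \<in> {0..1}" for t
  proof (rule phi_ge_ratio[OF K(1) K(3) _ _ K(2) q0 X(2)])
    show "\<sigma> (e k) \<le> \<sigma> j" if "j \<in> e ` {..<k}" for j using that \<sigma>(1) k by auto
    show "\<sigma> j \<le> \<sigma> (e k)" if "j \<notin> e ` {..<k}" for j
    proof -
      obtain i where i: "i < CARD('d)" "j = e i" using e by (auto simp: bij_betw_def)
      then have "k \<le> i" using that by (auto simp: not_less[symmetric])
      then show ?thesis using \<sigma>(1)[of k i] i by simp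
    qed
  qed (use that in auto)
  have [measurable]: "phi \<in> borel_measurable borel" by (rule half_density_measurable[OF half_density_phi])
  have "ennreal (sqrt (\<sigma> (e (Suc k)) / \<sigma> (e k))) =
     (\<integral>\<^sup>+t. indicator {0..1::real} t * ennreal (sqrt (\<sigma> (e (Suc k)) / \<sigma> (e k))) \<partial>lborel)"
    by (simp add: nn_integral_multc)
  also have "\<dots> \<le> (\<integral>\<^sup>+t. 12 * (indicator {0..1} t * ?\<Phi> X t) \<partial>lborel)"
    using le by (intro nn_integral_mono) (auto split: split_indicator)
  also have "\<dots> = 12 * (\<integral>\<^sup>+t. indicator {0..1} t * ?\<Phi> X t \<partial>lborel)"
    by (rule nn_integral_cmult) measurable
  also have "\<dots> \<le> (\<Sum>X\<in>F. 12 * (\<integral>\<^sup>+t. indicator {0..1} t * ?\<Phi> X t \<partial>lborel))"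
    using X(1) F(1) by (intro member_le_sum) auto
  finally show ?thesis using \<sigma>(2)[OF k] \<sigma>(2)[of k] k by simp
qed

section \<open>Products of independent matrices\<close>

lemma bij_betw_matrix_Basis: "bij_betw (\<lambda>(i, j). axis i (axis j 1)) UNIV (Basis :: (real^'d^'d) set)"
  unfolding bij_betw_def inj_on_def
  by (auto simp: Basis_vec_def axis_eq_axis axis_in_Basis_iff image_iff)

lemma emeasure_lborel_matrix_box:
  fixes l u :: "real^'d^'d"
  shows "emeasure lborel (cbox l u) = (\<Prod>(i, j)\<in>UNIV. ennreal (max 0 (u $ i $ j - l $ i $ j)))"
proof -
  have B: "(\<Prod>b\<in>Basis. h b) = (\<Prod>(i, j)\<in>UNIV. h (axis i (axis j 1)))" for h :: "real^'d^'d \<Rightarrow> ennreal"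
    using prod.reindex_bij_betw[OF bij_betw_matrix_Basis, of h] by (simp add: case_prod_beta)
  have ip: "x \<bullet> axis i (axis j 1) = x $ i $ j" for x :: "real^'d^'d" and i j
    by (simp add: inner_axis)
  show ?thesis
  proof (cases "\<forall>i j. l $ i $ j \<le> u $ i $ j")
    case True
    then have "\<forall>b\<in>Basis. l \<bullet> b \<le> u \<bullet> b" by (auto simp: Basis_vec_def ip)
    then have "emeasure lborel (cbox l u) = (\<Prod>b\<in>Basis. ennreal ((u - l) \<bullet> b))"
      by (simp add: emeasure_lborel_cbox_eq prod_ennreal inner_diff_left)
    then show ?thesis using True unfolding B by (simp add: ip max_def)
  next
    case False
    then obtain i j where ij: "u $ i $ j < l $ i $ j" by (auto simp: not_le)
    then have "cbox l u = {}" by (auto simp: mem_box Basis_vec_def ip) (meson dual_order.trans not_le)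
    moreover have "(\<Prod>(i, j)\<in>UNIV. ennreal (max 0 (u $ i $ j - l $ i $ j))) = 0"
    proof (rule prod_zero)
      show "\<exists>x\<in>UNIV. (case x of (i, j) \<Rightarrow> ennreal (max 0 (u $ i $ j - l $ i $ j))) = 0"
        using ij by (intro bexI[of _ "(i, j)"]) (simp_all add: ennreal_eq_0_iff)
    qed simp
    ultimately show ?thesis by simp
  qed
qed

text \<open>The boxes form a generator stable under intersection, and on a box both laws factor over
  the entries.\<close>

lemma distr_uniform_matrix:
  fixes X :: "'w \<Rightarrow> real^'d^'d"
  assumes P: "prob_space P" and X[measurable]: "X \<in> P \<rightarrow>\<^sub>M borel"
    and ind: "prob_space.indep_vars P (\<lambda>_. borel) (\<lambda>(i, j) \<omega>. X \<omega> $ i $ j) UNIV"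
    and unif: "\<And>i j. distr P borel (\<lambda>\<omega>. X \<omega> $ i $ j) = uniform_measure lborel {-1..1}"
  shows "distr P borel X = uniform_measure lborel (cube 1)"
proof (rule measure_eqI_generator_eq)
  interpret prob_space P by (rule P)
  have [measurable]: "(\<lambda>\<omega>. X \<omega> $ i $ j) \<in> P \<rightarrow>\<^sub>M borel" for i j
    using ind unfolding indep_vars_def by auto
  let ?E = "range (\<lambda>(a, b). cbox a b :: (real^'d^'d) set)"
  show "Int_stable ?E"
    by (auto simp: Int_stable_def Int_interval)
  show "?E \<subseteq> Pow UNIV" by simp
  have "sets borel = sigma_sets UNIV ?E"
    by (simp add: borel_eq_atLeastAtMost cbox_interval)
  then show "sets (distr P borel X) = sigma_sets UNIV ?E" "sets (uniform_measure lborel (cube 1)) = sigma_sets UNIV ?E"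
    by simp_all
  let ?A = "\<lambda>n::nat. cbox (- (real n *\<^sub>R One)) (real n *\<^sub>R One) :: (real^'d^'d) set"
  show "range ?A \<subseteq> ?E" by auto
  have "(\<Union>n::nat. box (- (real n *\<^sub>R One)) (real n *\<^sub>R One) :: (real^'d^'d) set) = UNIV"
    by (rule UN_box_eq_UNIV)
  then show "(\<Union>n. ?A n) = UNIV" using box_subset_cbox by blast
  show "emeasure (distr P borel X) (?A n) \<noteq> \<infinity>" for n
    by (simp add: emeasure_distr emeasure_eq_measure)
  fix S assume "S \<in> ?E"
  then obtain l u where S: "S = cbox l u" by auto
  define h where "h i j = max 0 (min (u $ i $ j) 1 - max (l $ i $ j) (- 1))" for i j
  have one: "prob ((\<lambda>\<omega>. X \<omega> $ i $ j) -` {l $ i $ j..u $ i $ j} \<inter> space P) = h i j / 2" for i j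
  proof -
    have "emeasure P ((\<lambda>\<omega>. X \<omega> $ i $ j) -` {l $ i $ j..u $ i $ j} \<inter> space P) =
       emeasure (uniform_measure lborel {-1..1}) {l $ i $ j..u $ i $ j}"
      unfolding unif[of i j, symmetric] by (simp add: emeasure_distr)
    also have "\<dots> = emeasure lborel ({-1..1} \<inter> {l $ i $ j..u $ i $ j}) / ennreal 2"
      by (subst emeasure_uniform_measure) auto
    also have "emeasure lborel ({-1..1} \<inter> {l $ i $ j..u $ i $ j}) = ennreal (h i j)"
      by (auto simp: h_def max_def min_def emeasure_lborel_Icc_eq)
    also have "ennreal (h i j) / ennreal 2 = ennreal (h i j / 2)"
      by (rule divide_ennreal) (auto simp: h_def)
    finally show ?thesis by (simp add: emeasure_eq_measure h_def)
  qed
  have "emeasure (distr P borel X) S = emeasure P (X -` S \<inter> space P)"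
    unfolding S by (simp add: emeasure_distr)
  also have "X -` S \<inter> space P = (\<Inter>ij\<in>UNIV. (\<lambda>\<omega>. X \<omega> $ fst ij $ snd ij) -` {l $ fst ij $ snd ij..u $ fst ij $ snd ij} \<inter> space P)"
    by (auto simp: S mem_box Basis_vec_def inner_axis)
  also have "emeasure P \<dots> = ennreal (\<Prod>ij\<in>UNIV. h (fst ij) (snd ij) / 2)"
    unfolding emeasure_eq_measure
    using indep_varsD_finite[OF ind, of "\<lambda>ij. {l $ fst ij $ snd ij..u $ fst ij $ snd ij}"] one
    by (simp add: case_prod_beta)
  also have "\<dots> = ennreal ((\<Prod>ij\<in>UNIV. h (fst ij) (snd ij)) / (\<Prod>ij\<in>(UNIV::('d\<times>'d) set). 2))"
    by (simp add: prod_dividef)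
  also have "\<dots> = (\<Prod>ij\<in>UNIV. ennreal (h (fst ij) (snd ij))) / (\<Prod>ij\<in>(UNIV::('d\<times>'d) set). ennreal 2)"
  proof -
    have "0 \<le> (\<Prod>ij\<in>UNIV. h (fst ij) (snd ij))" by (intro prod_nonneg) (auto simp: h_def)
    then show ?thesis
      by (subst (1 2) prod_ennreal) (auto simp: h_def divide_ennreal)
  qed
  also have "(\<Prod>ij\<in>UNIV. ennreal (h (fst ij) (snd ij))) = emeasure lborel (cube 1 \<inter> S)"
  proof -
    have "cube 1 \<inter> S = cbox (\<chi> i j. max (l $ i $ j) (- 1)) (\<chi> i j. min (u $ i $ j) 1)"
      unfolding S by (auto simp: cube_def mem_box Basis_vec_def inner_axis abs_le_iff)
    then show ?thesis by (simp add: emeasure_lborel_matrix_box h_def case_prod_beta)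
  qed
  also have "(\<Prod>ij\<in>(UNIV::('d\<times>'d) set). ennreal 2) = emeasure lborel (cube 1 :: (real^'d^'d) set)"
    by (simp add: cube_cbox emeasure_lborel_matrix_box case_prod_beta)
  also have "emeasure lborel (cube 1 \<inter> S) / emeasure lborel (cube 1 :: (real^'d^'d) set) =
     emeasure (uniform_measure lborel (cube 1)) S"
    unfolding S by (rule emeasure_uniform_measure[symmetric]) auto
  finally show "emeasure (distr P borel X) S = emeasure (uniform_measure lborel (cube 1)) S" .
qed

section \<open>Almost sure invertibility\<close>

lemma continuous_det: "continuous_on UNIV (det :: real^'d^'d \<Rightarrow> real)"
  unfolding det_def by (intro continuous_intros)

lemma measurable_invertible [measurable]: "Measurable.pred borel (invertible :: real^'d^'d \<Rightarrow> bool)"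
proof -
  have [measurable]: "(det :: real^'d^'d \<Rightarrow> real) \<in> borel_measurable borel"
    by (rule borel_measurable_continuous_onI[OF continuous_det])
  have "(invertible :: real^'d^'d \<Rightarrow> bool) = (\<lambda>M. det M \<noteq> 0)"
    by (auto simp: invertible_det_nz)
  show ?thesis unfolding \<open>invertible = (\<lambda>M. det M \<noteq> 0)\<close> by measurable
qed

text \<open>On every line in the direction of the identity matrix only finitely many points are singular.\<close>

lemma AE_invertible_perturbation:
  fixes A :: "real^'d^'d"
  assumes \<epsilon>: "\<epsilon> \<noteq> 0"
  shows "AE X in lborel. invertible (A + \<epsilon> *\<^sub>R X)"
proof -
  define g :: "real^'d^'d \<Rightarrow> ennreal" where "g X = (if invertible (A + \<epsilon> *\<^sub>R X) then 0 else 1)" for X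
  have [measurable]: "g \<in> borel_measurable borel" unfolding g_def by measurable
  have line: "(\<integral>\<^sup>+t. g (t *\<^sub>R mat 1 + X) \<partial>lborel) = 0" for X
  proof -
    have fin: "finite {t. \<not> invertible (A + \<epsilon> *\<^sub>R (t *\<^sub>R mat 1 + X))}"
    proof -
      have "\<not> invertible (A + \<epsilon> *\<^sub>R (t *\<^sub>R mat 1 + X)) \<longleftrightarrow> poly (charpoly (- (A + \<epsilon> *\<^sub>R X))) (\<epsilon> * t) = 0" for t
        by (simp add: poly_charpoly invertible_det_nz algebra_simps)
      then have "{t. \<not> invertible (A + \<epsilon> *\<^sub>R (t *\<^sub>R mat 1 + X))} = (\<lambda>t. \<epsilon> * t) -` {x. poly (charpoly (- (A + \<epsilon> *\<^sub>R X))) x = 0}"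
        by auto
      moreover have "finite \<dots>"
        by (intro finite_vimageI poly_roots_finite charpoly_nonzero) (use \<epsilon> in \<open>auto simp: inj_def\<close>)
      ultimately show ?thesis by simp
    qed
    have "AE t in lborel. t \<notin> {t. \<not> invertible (A + \<epsilon> *\<^sub>R (t *\<^sub>R mat 1 + X))}"
      by (rule AE_not_in) (use fin finite_imp_null_set_lborel in blast)
    then have "AE t in lborel. g (t *\<^sub>R mat 1 + X) = 0" by eventually_elim (simp add: g_def)
    then have "(\<integral>\<^sup>+t. g (t *\<^sub>R mat 1 + X) \<partial>lborel) = (\<integral>\<^sup>+(t::real). 0 \<partial>lborel)"
      by (rule nn_integral_cong_AE)
    then show ?thesis by simp
  qed
  have "(\<integral>\<^sup>+(t::real). (\<integral>\<^sup>+X. g X \<partial>lborel) \<partial>lborel) = (\<integral>\<^sup>+t. (\<integral>\<^sup>+X. g (t *\<^sub>R mat 1 + X) \<partial>lborel) \<partial>lborel)"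
    by (simp add: nn_integral_lborel_translate)
  also have "\<dots> = (\<integral>\<^sup>+X. (\<integral>\<^sup>+t. g (t *\<^sub>R mat 1 + X) \<partial>lborel) \<partial>lborel)"
    by (rule lborel_pair.Fubini') measurable
  also have "\<dots> = 0" by (simp add: line)
  finally have "(\<integral>\<^sup>+X. g X \<partial>lborel) = 0" by (simp add: ennreal_mult_eq_top_iff)
  then have "AE X in lborel. g X = 0" by (subst (asm) nn_integral_0_iff_AE) auto
  then show ?thesis by eventually_elim (simp add: g_def split: if_splits)
qed

section \<open>Expectations along the random product\<close>

lemma matrix_product_cong:
  "(\<And>k. 1 \<le> k \<Longrightarrow> k \<le> n \<Longrightarrow> B k = C k) \<Longrightarrow> matrix_product B n = matrix_product C n"
  by (induction n) auto

lemma matrix_product_measurable: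
  assumes "\<And>k. 1 \<le> k \<Longrightarrow> k \<le> n \<Longrightarrow> (\<lambda>x. B x k) \<in> borel_measurable M"
  shows "(\<lambda>x. matrix_product (B x) n) \<in> borel_measurable M"
  using assms
proof (induction n)
  case (Suc n)
  then have [measurable]: "(\<lambda>x. B x (Suc n)) \<in> borel_measurable M" "(\<lambda>x. matrix_product (B x) n) \<in> borel_measurable M"
    by auto
  show ?case by simp
qed simp

lemma iid_uniform_matricesD:
  fixes \<Xi> :: "nat \<Rightarrow> 'w \<Rightarrow> real^'d^'d"
  assumes iid: "iid_uniform_matrices P \<Xi>"
  shows "prob_space P" "prob_space.indep_vars P (\<lambda>_. borel) \<Xi> {1..}"
    "\<And>n. 1 \<le> n \<Longrightarrow> \<Xi> n \<in> P \<rightarrow>\<^sub>M borel"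
    "\<And>n. 1 \<le> n \<Longrightarrow> distr P borel (\<Xi> n) = uniform_measure lborel (cube 1)"
proof -
  show P: "prob_space P" and ind: "prob_space.indep_vars P (\<lambda>_. borel) \<Xi> {1..}"
    using iid by (auto simp: iid_uniform_matrices_def)
  show m: "\<Xi> n \<in> P \<rightarrow>\<^sub>M borel" if "1 \<le> n" for n
    using ind that unfolding prob_space.indep_vars_def[OF P] by auto
  show "distr P borel (\<Xi> n) = uniform_measure lborel (cube 1)" if "1 \<le> n" for n
    using iid that by (intro distr_uniform_matrix[OF P m[OF that]]) (auto simp: iid_uniform_matrices_def)
qed

lemma perturbed_product_measurable:
  assumes "iid_uniform_matrices P (\<Xi> :: nat \<Rightarrow> 'w \<Rightarrow> real^'d^'d)"
  shows "(\<lambda>\<omega>. perturbed_product A \<epsilon> (\<lambda>k. \<Xi> k \<omega>) n) \<in> borel_measurable P"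
  unfolding perturbed_product_def
  using iid_uniform_matricesD(3)[OF assms] by (intro matrix_product_measurable) measurable

text \<open>Induction over all \<open>f\<close> at once: the last factor is independent of the
  earlier ones, and integrating it out replaces \<open>f\<close> by its noise average.\<close>

lemma expectation_perturbed_product:
  fixes \<Xi> :: "nat \<Rightarrow> 'w \<Rightarrow> real^'d^'d" and f :: "real^'d^'d \<Rightarrow> ennreal"
  assumes iid: "iid_uniform_matrices P \<Xi>" and f: "f \<in> borel_measurable borel"
  shows "(\<integral>\<^sup>+\<omega>. f (perturbed_product A \<epsilon> (\<lambda>k. \<Xi> k \<omega>) n ** Z) \<partial>P) = iterated_avg A \<epsilon> n f Z"
  using f
proof (induction n arbitrary: f)
  case 0
  interpret prob_space P by (rule iid_uniform_matricesD(1)[OF iid])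
  show ?case by (simp add: perturbed_product_def emeasure_space_1)
next
  case (Suc n)
  interpret prob_space P by (rule iid_uniform_matricesD(1)[OF iid])
  note [measurable] = Suc.prems perturbed_product_measurable[OF iid]
  let ?N = "\<lambda>\<omega>. perturbed_product A \<epsilon> (\<lambda>k. \<Xi> k \<omega>) n"
  have [measurable]: "\<Xi> (Suc n) \<in> P \<rightarrow>\<^sub>M borel" by (rule iid_uniform_matricesD(3)[OF iid]) simp
  have "indep_var (PiM {Suc n} (\<lambda>_. borel)) (\<lambda>\<omega>. restrict (\<lambda>i. \<Xi> i \<omega>) {Suc n})
     (PiM {1..n} (\<lambda>_. borel)) (\<lambda>\<omega>. restrict (\<lambda>i. \<Xi> i \<omega>) {1..n})"
    by (rule indep_var_restrict[OF iid_uniform_matricesD(2)[OF iid]]) auto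
  then have "indep_var borel ((\<lambda>x. x (Suc n)) \<circ> (\<lambda>\<omega>. restrict (\<lambda>i. \<Xi> i \<omega>) {Suc n}))
     borel ((\<lambda>x. perturbed_product A \<epsilon> x n) \<circ> (\<lambda>\<omega>. restrict (\<lambda>i. \<Xi> i \<omega>) {1..n}))"
  proof (rule indep_var_compose)
    show "(\<lambda>x. perturbed_product A \<epsilon> x n) \<in> (\<Pi>\<^sub>M i\<in>{1..n}. borel) \<rightarrow>\<^sub>M borel"
      unfolding perturbed_product_def by (rule matrix_product_measurable) measurable
  qed measurable
  moreover have "perturbed_product A \<epsilon> (restrict (\<lambda>i. \<Xi> i \<omega>) {1..n}) n = ?N \<omega>" for \<omega>
    unfolding perturbed_product_def by (rule matrix_product_cong) simp
  ultimately have "indep_var borel (\<Xi> (Suc n)) borel ?N" by (simp add: comp_def)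
  then have joint: "distr P (borel \<Otimes>\<^sub>M borel) (\<lambda>\<omega>. (\<Xi> (Suc n) \<omega>, ?N \<omega>)) =
      uniform_measure lborel (cube 1) \<Otimes>\<^sub>M distr P borel ?N"
    unfolding indep_var_distribution_eq using iid_uniform_matricesD(4)[OF iid, of "Suc n"] by simp
  interpret U: prob_space "uniform_measure lborel (cube 1) :: (real^'d^'d) measure" by (rule prob_space_uniform_cube)
  interpret D: prob_space "distr P borel ?N" by (rule prob_space_distr) simp
  interpret UD: pair_sigma_finite "uniform_measure lborel (cube 1) :: (real^'d^'d) measure" "distr P borel ?N" ..
  let ?h = "\<lambda>(x, y). f ((A (Suc n) + \<epsilon> *\<^sub>R x) ** (y ** Z))"
  have hm: "?h \<in> borel_measurable (borel \<Otimes>\<^sub>M borel)" by measurable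
  have S: "sets (uniform_measure lborel (cube 1) \<Otimes>\<^sub>M distr P borel ?N) = sets (borel \<Otimes>\<^sub>M borel)"
    by (rule sets_pair_measure_cong) simp_all
  have hm': "?h \<in> borel_measurable (uniform_measure lborel (cube 1) \<Otimes>\<^sub>M distr P borel ?N)"
    unfolding measurable_cong_sets[OF S refl] by (rule hm)
  have "(\<integral>\<^sup>+\<omega>. f (perturbed_product A \<epsilon> (\<lambda>k. \<Xi> k \<omega>) (Suc n) ** Z) \<partial>P) =
      (\<integral>\<^sup>+\<omega>. ?h (\<Xi> (Suc n) \<omega>, ?N \<omega>) \<partial>P)"
    by (simp add: perturbed_product_def matrix_mul_assoc)
  also have "\<dots> = (\<integral>\<^sup>+z. ?h z \<partial>distr P (borel \<Otimes>\<^sub>M borel) (\<lambda>\<omega>. (\<Xi> (Suc n) \<omega>, ?N \<omega>)))"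
    by (rule nn_integral_distr[symmetric]) (use hm in auto)
  also have "\<dots> = (\<integral>\<^sup>+y. (\<integral>\<^sup>+x. ?h (x, y) \<partial>uniform_measure lborel (cube 1)) \<partial>distr P borel ?N)"
    unfolding joint by (rule UD.nn_integral_snd[OF hm', symmetric])
  also have "\<dots> = (\<integral>\<^sup>+y. noise_avg (A (Suc n)) \<epsilon> f (y ** Z) \<partial>distr P borel ?N)"
    by (simp add: noise_avg_def)
  also have "\<dots> = (\<integral>\<^sup>+\<omega>. noise_avg (A (Suc n)) \<epsilon> f (?N \<omega> ** Z) \<partial>P)"
    by (rule nn_integral_distr) (use measurable_noise_avg[OF Suc.prems] in measurable)
  also have "\<dots> = iterated_avg A \<epsilon> (Suc n) f Z"
    using Suc.IH[OF measurable_noise_avg[OF Suc.prems]] by simp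
  finally show ?case .
qed

lemma AE_perturbed_invertible:
  fixes \<Xi> :: "nat \<Rightarrow> 'w \<Rightarrow> real^'d^'d"
  assumes iid: "iid_uniform_matrices P \<Xi>" and \<epsilon>: "\<epsilon> \<noteq> 0"
  shows "AE \<omega> in P. \<forall>n\<ge>1. invertible (A n + \<epsilon> *\<^sub>R \<Xi> n \<omega>)"
proof -
  have "AE \<omega> in P. 1 \<le> n \<longrightarrow> invertible (A n + \<epsilon> *\<^sub>R \<Xi> n \<omega>)" for n
  proof (cases "1 \<le> n")
    case True
    have "AE X in uniform_measure lborel (cube 1). invertible (A n + \<epsilon> *\<^sub>R X)"
      by (rule AE_uniform_measureI) (use AE_invertible_perturbation[OF \<epsilon>, of "A n"] in auto)
    then have "AE X in distr P borel (\<Xi> n). invertible (A n + \<epsilon> *\<^sub>R X)"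
      unfolding iid_uniform_matricesD(4)[OF iid True] .
    then show ?thesis
      using iid_uniform_matricesD(3)[OF iid True] by (subst (asm) AE_distr_iff) auto
  qed simp
  then have "AE \<omega> in P. \<forall>n. 1 \<le> n \<longrightarrow> invertible (A n + \<epsilon> *\<^sub>R \<Xi> n \<omega>)" by (simp add: AE_all_countable)
  then show ?thesis by simp
qed

lemma invertible_matrix_product:
  "(\<And>k. 1 \<le> k \<Longrightarrow> k \<le> n \<Longrightarrow> invertible (B k :: real^'d^'d)) \<Longrightarrow> invertible (matrix_product B n)"
  by (induction n) (auto intro!: invertible_mult simp: invertible_def[of "mat 1"])

section \<open>The tail law\<close>

text \<open>The constant \<open>\<kappa>\<close> is the level at which the distribution function
  jumps from 0 to 1, possibly infinite. Rational levels separate \<open>L x\<close> from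
  \<open>\<kappa>\<close>, so countably many null sets suffice.\<close>

lemma (in prob_space) AE_eq_const_if_zero_one:
  fixes L :: "'a \<Rightarrow> ereal"
  assumes [measurable]: "L \<in> borel_measurable M"
    and zo: "\<And>a. prob {x \<in> space M. L x < a} = 0 \<or> prob {x \<in> space M. L x < a} = 1"
  shows "\<exists>\<kappa>. AE x in M. L x = \<kappa>"
proof -
  define \<kappa> where "\<kappa> = Sup {a. prob {x \<in> space M. L x < a} = 0}"
  have lt: "AE x in M. \<not> L x < a" if a: "a < \<kappa>" for a
  proof -
    obtain b where b: "a < b" "prob {x \<in> space M. L x < b} = 0"
      using a unfolding \<kappa>_def less_Sup_iff by blast
    have "{x \<in> space M. L x < a} \<subseteq> {x \<in> space M. L x < b}" using b(1) by auto
    then have "prob {x \<in> space M. L x < a} \<le> 0"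
      unfolding b(2)[symmetric] by (rule finite_measure_mono) measurable
    then have "prob {x \<in> space M. L x < a} = 0" by (simp add: measure_le_0_iff)
    then show ?thesis by (subst (asm) prob_eq_0) auto
  qed
  have gt: "AE x in M. L x < a" if "\<kappa> < a" for a
  proof -
    have "prob {x \<in> space M. L x < a} \<noteq> 0"
      using that Sup_upper[of a "{a. prob {x \<in> space M. L x < a} = 0}"] unfolding \<kappa>_def by auto
    then have "prob {x \<in> space M. L x < a} = 1" using zo[of a] by blast
    then show ?thesis by (subst (asm) prob_Collect_eq_1) auto
  qed
  have "AE x in M. \<forall>r::rat. (ereal (of_rat r) < \<kappa> \<longrightarrow> \<not> L x < ereal (of_rat r)) \<and>
      (\<kappa> < ereal (of_rat r) \<longrightarrow> L x < ereal (of_rat r))"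
    unfolding AE_all_countable
  proof
    fix r :: rat
    show "AE x in M. (ereal (of_rat r) < \<kappa> \<longrightarrow> \<not> L x < ereal (of_rat r)) \<and>
      (\<kappa> < ereal (of_rat r) \<longrightarrow> L x < ereal (of_rat r))"
      using lt[of "ereal (of_rat r)"] gt[of "ereal (of_rat r)"]
      by (cases "ereal (of_rat r) < \<kappa>"; cases "\<kappa> < ereal (of_rat r)") auto
  qed
  then have "AE x in M. L x = \<kappa>"
  proof eventually_elim
    case (elim x)
    show ?case
    proof (rule ccontr)
      assume "L x \<noteq> \<kappa>"
      then consider "L x < \<kappa>" | "\<kappa> < L x" by (metis linorder_neqE)
      then show False
      proof cases
        case 1
        then obtain r where "L x < ereal (of_rat r)" "ereal (of_rat r) < \<kappa>" using ereal_dense3 by blast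
        then show False using elim by blast
      next
        case 2
        then obtain r where "\<kappa> < ereal (of_rat r)" "ereal (of_rat r) < L x" using ereal_dense3 by blast
        then show False using elim less_asym by blast
      qed
    qed
  qed
  then show ?thesis by blast
qed

lemma (in prob_space) AE_const_of_tail_measurable:
  fixes L :: "'a \<Rightarrow> ereal" and Y :: "nat \<Rightarrow> 'a \<Rightarrow> 'b::topological_space"
  assumes ind: "indep_vars (\<lambda>_. borel) Y UNIV"
    and tail: "\<And>m. L \<in> borel_measurable (sigma (space M) (\<Union>k\<in>{m..}. {Y k -` S \<inter> space M | S. S \<in> sets borel}))"
  shows "\<exists>\<kappa>. AE x in M. L x = \<kappa>"
proof (rule AE_eq_const_if_zero_one)
  define \<A> where "\<A> k = {Y k -` S \<inter> space M | S. S \<in> sets borel}" for k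
  have Ym: "Y k \<in> M \<rightarrow>\<^sub>M borel" for k using ind unfolding indep_vars_def by auto
  have sub: "(\<Union>k\<in>{m..}. \<A> k) \<subseteq> sets M" for m unfolding \<A>_def using Ym by (auto simp: measurable_sets)
  have pow: "(\<Union>k\<in>{m..}. \<A> k) \<subseteq> Pow (space M)" for m unfolding \<A>_def by auto
  have sets_L: "{x \<in> space M. L x < a} \<in> sigma_sets (space M) (\<Union>k\<in>{m..}. \<A> k)" for a m
  proof -
    have "L \<in> borel_measurable (sigma (space M) (\<Union>k\<in>{m..}. \<A> k))" using tail[of m] by (simp add: \<A>_def)
    then have "{x \<in> space (sigma (space M) (\<Union>k\<in>{m..}. \<A> k)). L x < a} \<in> sets (sigma (space M) (\<Union>k\<in>{m..}. \<A> k))"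
      by measurable
    then show ?thesis using pow[of m] by (simp add: sets_measure_of space_measure_of)
  qed
  show "L \<in> borel_measurable M"
  proof (rule measurableI)
    fix S :: "ereal set" assume "S \<in> sets borel"
    from measurable_sets[OF tail[of 0] this]
    have "L -` S \<inter> space M \<in> sigma_sets (space M) (\<Union>k\<in>{0..}. \<A> k)"
      using pow[of 0] by (simp add: sets_measure_of space_measure_of \<A>_def)
    then show "L -` S \<inter> space M \<in> sets M" using sets.sigma_sets_subset[OF sub[of 0]] by blast
  qed simp
  fix a
  show "prob {x \<in> space M. L x < a} = 0 \<or> prob {x \<in> space M. L x < a} = 1"
  proof (rule kolmogorov_0_1_law[of \<A>])
    show "sigma_algebra (space M) (\<A> k)" for k
    proof -
      have "sets (vimage_algebra (space M) (Y k) borel) = \<A> k"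
        unfolding \<A>_def by (rule sets_vimage_algebra2) auto
      then show ?thesis
        using sets.sigma_algebra_axioms[of "vimage_algebra (space M) (Y k) borel"] by simp
    qed
    show "indep_sets \<A> UNIV" using ind unfolding indep_vars_def2 \<A>_def by auto
    show "{x \<in> space M. L x < a} \<in> tail_events \<A>" unfolding tail_events_def using sets_L by auto
  qed
qed

section \<open>The logarithmic gap under changes of finitely many factors\<close>

definition log_gap :: "nat \<Rightarrow> real^'d^'d \<Rightarrow> real" where
  "log_gap j N = ln (singular_value j N / singular_value (Suc j) N)"

lemma measurable_log_gap:
  assumes "1 \<le> j" "j < CARD('d::finite)"
  shows "(log_gap j :: real^'d^'d \<Rightarrow> real) \<in> borel_measurable borel"
proof -
  obtain k where j: "j = Suc k" using assms by (cases j) auto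
  have [measurable]: "(singular_value j :: real^'d^'d \<Rightarrow> real) \<in> borel_measurable borel"
    "(singular_value (Suc j) :: real^'d^'d \<Rightarrow> real) \<in> borel_measurable borel"
    unfolding j by (rule measurable_singular_value, use assms j in simp)+
  show ?thesis unfolding log_gap_def by measurable
qed

text \<open>A right factor \<open>D\<close> lowers a singular value at most by the factor
  \<open>c\<close>, and its inverse, multiplied back, at most by \<open>c'\<close>. Hence both
  logarithms move by an amount that does not depend on \<open>N\<close>.\<close>

lemma log_gap_mult_bounded:
  fixes D :: "real^'d^'d"
  assumes j: "1 \<le> j" "j < CARD('d)" and D: "invertible D"
  obtains b where "\<And>N. invertible N \<Longrightarrow> \<bar>log_gap j (N ** D) - log_gap j N\<bar> \<le> b"
proof -
  obtain k where k: "j = Suc k" using j by (cases j) auto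
  obtain D' where D': "D ** D' = mat 1" "D' ** D = mat 1" using D by (auto simp: invertible_def)
  then have iD': "invertible D'" by (auto simp: invertible_def)
  obtain c where c: "0 < c" "\<And>x. c * norm x \<le> norm (D *v x)" using invertible_bounded_below[OF D] by blast
  obtain c' where c': "0 < c'" "\<And>x. c' * norm x \<le> norm (D' *v x)" using invertible_bounded_below[OF iD'] by blast
  have sv: "\<bar>ln (singular_value (Suc i) (N ** D)) - ln (singular_value (Suc i) N)\<bar> \<le> \<bar>ln c\<bar> + \<bar>ln c'\<bar>"
    if i: "i < CARD('d)" and N: "invertible N" for i N
  proof -
    have p: "0 < singular_value (Suc i) N" "0 < singular_value (Suc i) (N ** D)"
      using singular_value_pos[OF i N] singular_value_pos[OF i invertible_mult[OF N D]] .
    have "singular_value (Suc i) N * c \<le> singular_value (Suc i) (N ** D)"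
      by (rule singular_value_mult_ge[OF i c])
    then have "ln (singular_value (Suc i) N * c) \<le> ln (singular_value (Suc i) (N ** D))"
      using p c by simp
    then have 1: "ln (singular_value (Suc i) N) + ln c \<le> ln (singular_value (Suc i) (N ** D))"
      using p c by (simp add: ln_mult)
    have "singular_value (Suc i) (N ** D) * c' \<le> singular_value (Suc i) (N ** D ** D')"
      by (rule singular_value_mult_ge[OF i c'])
    then have "singular_value (Suc i) (N ** D) * c' \<le> singular_value (Suc i) N"
      by (simp add: matrix_mul_assoc[symmetric] D')
    then have "ln (singular_value (Suc i) (N ** D) * c') \<le> ln (singular_value (Suc i) N)"
      using p c' by simp
    then have 2: "ln (singular_value (Suc i) (N ** D)) + ln c' \<le> ln (singular_value (Suc i) N)"
      using p c' by (simp add: ln_mult)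
    from 1 2 show ?thesis by linarith
  qed
  show ?thesis
  proof (rule that[of "2 * (\<bar>ln c\<bar> + \<bar>ln c'\<bar>)"])
    fix N :: "real^'d^'d" assume N: "invertible N"
    have "log_gap j M = ln (singular_value (Suc k) M) - ln (singular_value (Suc (Suc k)) M)"
      if "invertible M" for M :: "real^'d^'d"
      unfolding log_gap_def k
      using singular_value_pos[OF _ that, of k] singular_value_pos[OF _ that, of "Suc k"] j k
      by (simp add: ln_div)
    then show "\<bar>log_gap j (N ** D) - log_gap j N\<bar> \<le> 2 * (\<bar>ln c\<bar> + \<bar>ln c'\<bar>)"
      using sv[of k N] sv[of "Suc k" N] j k N invertible_mult[OF N D] by simp
  qed
qed

text \<open>Early factors stand at the right end of the product, so replacing them multiplies every
  later product from the right by one fixed invertible \<open>D\<close>. The resulting bounded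
  change of the gap vanishes after division by \<open>n\<close>.\<close>

lemma liminf_log_gap_tail:
  fixes B C :: "nat \<Rightarrow> real^'d^'d"
  assumes j: "1 \<le> j" "j < CARD('d)" and B: "\<And>n. invertible (B n)" and C: "\<And>n. invertible (C n)"
    and eq: "\<And>n. m < n \<Longrightarrow> B n = C n"
  shows "liminf (\<lambda>n. ereal (1 / real n * log_gap j (matrix_product B n))) =
    liminf (\<lambda>n. ereal (1 / real n * log_gap j (matrix_product C n)))"
proof -
  have iB: "invertible (matrix_product B n)" and iC: "invertible (matrix_product C n)" for n
    by (intro invertible_matrix_product B C)+
  obtain B' where B': "matrix_product B m ** B' = mat 1" "B' ** matrix_product B m = mat 1"
    using iB[of m] by (auto simp: invertible_def)
  define D where "D = B' ** matrix_product C m"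
  have "invertible B'" using B' by (auto simp: invertible_def)
  then have iD: "invertible D" unfolding D_def by (intro invertible_mult iC)
  have CD: "matrix_product C n = matrix_product B n ** D" if "m \<le> n" for n
    using that
  proof (induction n rule: dec_induct)
    case base
    show ?case by (simp add: D_def matrix_mul_assoc B')
  next
    case (step n)
    then show ?case using eq[of "Suc n"] by (simp add: matrix_mul_assoc)
  qed
  obtain b where b: "\<And>N. invertible N \<Longrightarrow> \<bar>log_gap j (N ** D) - log_gap j N\<bar> \<le> b"
    using log_gap_mult_bounded[OF j iD] by blast
  define x y where "x n = 1 / real n * log_gap j (matrix_product B n)"
    and "y n = 1 / real n * log_gap j (matrix_product C n)" for n
  have "(\<lambda>n. y n - x n) \<longlonglongrightarrow> 0"
  proof (rule Lim_null_comparison)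
    show "\<forall>\<^sub>F n in sequentially. norm (y n - x n) \<le> b / real n"
      using eventually_ge_at_top[of m]
    proof eventually_elim
      case (elim n)
      have "y n - x n = (log_gap j (matrix_product B n ** D) - log_gap j (matrix_product B n)) / real n"
        unfolding x_def y_def CD[OF elim] by (simp add: diff_divide_distrib)
      then show ?case using b[OF iB[of n]] by (simp add: divide_right_mono)
    qed
    show "(\<lambda>n. b / real n) \<longlonglongrightarrow> 0" by (rule lim_const_over_n)
  qed
  then have "(\<lambda>n. ereal (y n - x n)) \<longlonglongrightarrow> ereal 0" by simp
  then have "liminf (\<lambda>n. ereal (y n - x n) + ereal (x n)) = ereal 0 + liminf (\<lambda>n. ereal (x n))"
    by (rule ereal_liminf_lim_add) simp
  then show ?thesis by (simp add: x_def y_def zero_ereal_def[symmetric])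
qed

section \<open>The gap\<close>

text \<open>Markov's inequality at the threshold \<open>sqrt q ^ n\<close> leaves the summable bound
  \<open>C * sqrt q ^ n\<close> for the Borel--Cantelli lemma.\<close>

lemma (in prob_space) AE_eventually_le_geometric:
  fixes r :: "nat \<Rightarrow> 'a \<Rightarrow> ennreal"
  assumes [measurable]: "\<And>n. r n \<in> borel_measurable M"
    and le: "\<And>n. (\<integral>\<^sup>+x. r n x \<partial>M) \<le> ennreal (C * q ^ n)" and q: "0 < q" "q < 1" and C: "0 \<le> C"
  shows "AE x in M. \<forall>\<^sub>F n in sequentially. r n x \<le> ennreal (sqrt q ^ n)"
proof -
  have s: "0 < sqrt q" "sqrt q < 1" using q by auto
  define T where "T n = {x \<in> space M. 1 \<le> ennreal (1 / sqrt q ^ n) * r n x}" for n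
  have [measurable]: "T n \<in> sets M" for n unfolding T_def by measurable
  have T: "measure M (T n) \<le> C * sqrt q ^ n" for n
  proof -
    have "emeasure M (T n) \<le> ennreal (1 / sqrt q ^ n) * (\<integral>\<^sup>+x. r n x * indicator (space M) x \<partial>M)"
      unfolding T_def by (rule nn_integral_Markov_inequality) auto
    also have "(\<integral>\<^sup>+x. r n x * indicator (space M) x \<partial>M) = (\<integral>\<^sup>+x. r n x \<partial>M)"
      by (rule nn_integral_cong) simp
    also have "ennreal (1 / sqrt q ^ n) * \<dots> \<le> ennreal (1 / sqrt q ^ n) * ennreal (C * q ^ n)"
      using le by (rule mult_left_mono) simp
    also have "\<dots> = ennreal (1 / sqrt q ^ n * (C * q ^ n))"
      by (rule ennreal_mult'[symmetric]) (use s in simp)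
    also have "q ^ n = sqrt q ^ n * sqrt q ^ n"
      using q by (simp add: power_mult_distrib[symmetric])
    also have "1 / sqrt q ^ n * (C * (sqrt q ^ n * sqrt q ^ n)) = C * sqrt q ^ n" using s by simp
    finally show ?thesis using C s by (simp add: emeasure_eq_measure)
  qed
  have "AE x in M. \<forall>\<^sub>F n in sequentially. x \<in> space M - T n"
  proof (rule borel_cantelli_AE1)
    show "summable (\<lambda>n. measure M (T n))"
      by (rule summable_comparison_test'[where g = "\<lambda>n. C * sqrt q ^ n"])
         (use T s in \<open>auto intro!: summable_mult summable_geometric\<close>)
  qed (auto simp: emeasure_eq_measure)
  then show ?thesis
  proof eventually_elim
    case (elim x)
    then show ?case
    proof eventually_elim
      case (elim n)
      then have "ennreal (1 / sqrt q ^ n) * r n x \<le> 1" by (simp add: T_def not_le less_imp_le)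
      then have "ennreal (sqrt q ^ n) * (ennreal (1 / sqrt q ^ n) * r n x) \<le> ennreal (sqrt q ^ n) * 1"
        by (rule mult_left_mono) simp
      then show ?case using s by (simp add: mult.assoc[symmetric] ennreal_mult[symmetric])
    qed
  qed
qed

text \<open>Tonelli moves the expectation inside the fibre integral, where it becomes the iterated
  average at the deterministic frame \<open>X ** shear t\<close>.\<close>

lemma expectation_ratio_le:
  fixes \<Xi> :: "nat \<Rightarrow> 'w \<Rightarrow> real^'d^'d" and A :: "nat \<Rightarrow> real^'d^'d" and e :: "nat \<Rightarrow> 'd"
  assumes iid: "iid_uniform_matrices P \<Xi>" and e: "bij_betw e {..<CARD('d)} UNIV" and k: "Suc k < CARD('d)"
    and \<epsilon>: "\<epsilon> \<noteq> 0" and B: "0 \<le> B" "0 < \<rho>"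
    and decay: "\<And>(I :: 'd set) p q Z. partial_flag I p q \<Longrightarrow>
       partial_flag.mass p q (iterated_avg A \<epsilon> n (partial_flag.phi I p q)) Z \<le> ennreal (\<rho> ^ n * B)"
    and F: "finite F" "\<And>K :: real^'d^'d. orthogonal_matrix K \<Longrightarrow> \<exists>X\<in>F. \<forall>x. norm (X *v x - K *v x) \<le> norm x / 2"
  shows "(\<integral>\<^sup>+\<omega>. ennreal (sqrt (singular_value (Suc (Suc k)) (perturbed_product A \<epsilon> (\<lambda>k. \<Xi> k \<omega>) n) /
      singular_value (Suc k) (perturbed_product A \<epsilon> (\<lambda>k. \<Xi> k \<omega>) n))) \<partial>P) \<le>
    ennreal (real (card F) * 12 * sqrt B * sqrt \<rho> ^ n)"
proof -
  interpret prob_space P by (rule iid_uniform_matricesD(1)[OF iid])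
  have pf: "partial_flag (e ` {..<k}) (e k) (e (Suc k))" by (rule partial_flag_enumeration[OF e k])
  interpret partial_flag "e ` {..<k}" "e k" "e (Suc k)" by (rule pf)
  let ?N = "\<lambda>\<omega>. perturbed_product A \<epsilon> (\<lambda>k. \<Xi> k \<omega>) n"
  note [measurable] = perturbed_product_measurable[OF iid]
  have pm[measurable]: "phi \<in> borel_measurable borel" by (rule half_density_measurable[OF half_density_phi])
  let ?J = "\<lambda>\<omega> X. \<integral>\<^sup>+t. indicator {0..1} t * phi (?N \<omega> ** X ** shear t) \<partial>lborel"
  define g where "g = iterated_avg A \<epsilon> n phi"
  have g_half: "half_density g" unfolding g_def by (rule half_density_iterated_avg[OF half_density_phi])
  have "\<rho> ^ n * B = (sqrt B * sqrt \<rho> ^ n)\<^sup>2"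
    using B by (simp add: power_mult_distrib power_mult[symmetric] mult.commute[of n 2] power_mult)
  then have g_mass: "mass g X \<le> ennreal ((sqrt B * sqrt \<rho> ^ n)\<^sup>2)" for X
    using decay[OF pf, of X] by (simp add: g_def)
  have mj: "(\<lambda>(\<omega>, t). indicator {0..1::real} t * phi (?N \<omega> ** X ** shear t)) \<in> borel_measurable (P \<Otimes>\<^sub>M lborel)" for X
    by measurable
  have each: "(\<integral>\<^sup>+\<omega>. ?J \<omega> X \<partial>P) \<le> ennreal (sqrt B * sqrt \<rho> ^ n)" for X
  proof -
    interpret PL: pair_sigma_finite P "lborel :: real measure" ..
    have "(\<integral>\<^sup>+\<omega>. ?J \<omega> X \<partial>P) = (\<integral>\<^sup>+t. (\<integral>\<^sup>+\<omega>. indicator {0..1} t * phi (?N \<omega> ** X ** shear t) \<partial>P) \<partial>lborel)"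
      by (rule PL.Fubini'[OF mj, symmetric])
    also have "\<dots> = (\<integral>\<^sup>+t. indicator {0..1} t * (\<integral>\<^sup>+\<omega>. phi (?N \<omega> ** (X ** shear t)) \<partial>P) \<partial>lborel)"
      by (intro nn_integral_cong) (simp add: nn_integral_cmult matrix_mul_assoc[symmetric])
    also have "\<dots> = (\<integral>\<^sup>+t. indicator {0..1} t * g (X ** shear t) \<partial>lborel)"
      unfolding g_def expectation_perturbed_product[OF iid pm] ..
    also have "\<dots> \<le> ennreal (sqrt B * sqrt \<rho> ^ n)"
      by (rule integral_shear_le[OF g_half g_mass]) (use B in simp)
    finally show ?thesis .
  qed
  have Jm: "(\<lambda>\<omega>. ?J \<omega> X) \<in> borel_measurable P" for X
    using lborel.borel_measurable_nn_integral_fst[OF mj, of X] by simp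
  have "AE \<omega> in P. invertible (?N \<omega>)"
    using AE_perturbed_invertible[OF iid \<epsilon>, of A]
    by (auto simp: perturbed_product_def intro!: invertible_matrix_product)
  then have "(\<integral>\<^sup>+\<omega>. ennreal (sqrt (singular_value (Suc (Suc k)) (?N \<omega>) / singular_value (Suc k) (?N \<omega>))) \<partial>P) \<le>
      (\<integral>\<^sup>+\<omega>. (\<Sum>X\<in>F. 12 * ?J \<omega> X) \<partial>P)"
    by (intro nn_integral_mono_AE, eventually_elim) (rule singular_value_ratio_le[OF e k _ F])
  also have "\<dots> = (\<Sum>X\<in>F. 12 * (\<integral>\<^sup>+\<omega>. ?J \<omega> X \<partial>P))"
    using Jm by (simp add: nn_integral_sum nn_integral_cmult)
  also have "\<dots> \<le> (\<Sum>X\<in>F. 12 * ennreal (sqrt B * sqrt \<rho> ^ n))"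
    by (intro sum_mono mult_left_mono each) auto
  also have "\<dots> = ennreal (real (card F)) * (ennreal 12 * ennreal (sqrt B * sqrt \<rho> ^ n))"
    by (simp add: ennreal_of_nat_eq_real_of_nat)
  also have "\<dots> = ennreal (real (card F) * (12 * (sqrt B * sqrt \<rho> ^ n)))"
    using B by (simp only: ennreal_mult[symmetric] real_sqrt_ge_zero mult_nonneg_nonneg zero_le_power less_imp_le
       of_nat_0_le_iff zero_le_numeral)
  finally show ?thesis by (simp add: mult.assoc)
qed

text \<open>The factor 2 undoes the square root of the ratio of singular values.\<close>

lemma liminf_log_gap_ge:
  fixes N :: "nat \<Rightarrow> real^'d^'d"
  assumes k: "Suc k < CARD('d)" and N: "\<And>n. invertible (N n)" and q: "0 < q" "q < 1"
    and ev: "\<forall>\<^sub>F n in sequentially.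
      ennreal (sqrt (singular_value (Suc (Suc k)) (N n) / singular_value (Suc k) (N n))) \<le> ennreal (q ^ n)"
  shows "ereal (2 * ln (1 / q)) \<le> liminf (\<lambda>n. ereal (1 / real n * log_gap (Suc k) (N n)))"
proof (rule Liminf_bounded)
  show "\<forall>\<^sub>F n in sequentially. ereal (2 * ln (1 / q)) \<le> ereal (1 / real n * log_gap (Suc k) (N n))"
    using ev eventually_gt_at_top[of 0]
  proof eventually_elim
    case (elim n)
    define a b where "a = singular_value (Suc k) (N n)" and "b = singular_value (Suc (Suc k)) (N n)"
    have ab: "0 < a" "0 < b"
      unfolding a_def b_def using k by (auto intro!: singular_value_pos N)
    have "sqrt (b / a) \<le> q ^ n" using elim(1) q by (simp add: a_def b_def)
    then have "(sqrt (b / a))\<^sup>2 \<le> (q ^ n)\<^sup>2" using ab by (intro power_mono) auto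
    then have "b / a \<le> q ^ (2 * n)" using ab by (simp add: power_mult[symmetric] mult.commute)
    then have "ln (b / a) \<le> ln (q ^ (2 * n))" using ab q by simp
    then have "ln (b / a) \<le> 2 * real n * ln q" using q by (simp add: ln_realpow)
    then have "2 * ln (1 / q) * real n \<le> log_gap (Suc k) (N n)"
      using ab q by (simp add: log_gap_def a_def[symmetric] b_def[symmetric] ln_div algebra_simps)
    then show ?case using elim(2) by (simp add: field_simps)
  qed
qed

text \<open>Replacing singular factors by the identity changes the product only on a null set and makes the
  \<open>liminf\<close> measurable with respect to the tail.\<close>

lemma liminf_log_gap_AE_const:
  fixes \<Xi> :: "nat \<Rightarrow> 'w \<Rightarrow> real^'d^'d" and A :: "nat \<Rightarrow> real^'d^'d"
  assumes iid: "iid_uniform_matrices P \<Xi>" and j: "1 \<le> j" "j < CARD('d)" and \<epsilon>: "\<epsilon> \<noteq> 0"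
  shows "\<exists>\<kappa>. AE \<omega> in P. liminf (\<lambda>n. ereal (1 / real n * log_gap j (perturbed_product A \<epsilon> (\<lambda>k. \<Xi> k \<omega>) n))) = \<kappa>"
proof -
  interpret prob_space P by (rule iid_uniform_matricesD(1)[OF iid])
  define B where "B k X = (if 1 \<le> k \<and> invertible (A k + \<epsilon> *\<^sub>R X) then A k + \<epsilon> *\<^sub>R X else mat 1)" for k X
  have invB: "invertible (B k X)" for k X by (auto simp: B_def invertible_def[of "mat 1"])
  have [measurable]: "B k \<in> borel_measurable borel" for k unfolding B_def by measurable
  define lim where "lim C = liminf (\<lambda>n. ereal (1 / real n * log_gap j (matrix_product C n)))" for C :: "nat \<Rightarrow> real^'d^'d"
  define L where "L \<omega> = lim (\<lambda>k. B k (\<Xi> k \<omega>))" for \<omega>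
  have "\<exists>\<kappa>. AE \<omega> in P. L \<omega> = \<kappa>"
  proof (rule AE_const_of_tail_measurable)
    \<comment> \<open>The tail law is for families indexed by all natural numbers, while the noise
      starts at index 1; hence the shift by \<open>Suc\<close>.\<close>
    have "indep_vars (\<lambda>k. PiM {Suc k} (\<lambda>_. borel)) (\<lambda>k \<omega>. restrict (\<lambda>i. \<Xi> i \<omega>) {Suc k}) UNIV"
      by (rule indep_vars_restrict[OF iid_uniform_matricesD(2)[OF iid]]) (auto simp: disjoint_family_on_def)
    then have "indep_vars (\<lambda>_. borel) (\<lambda>k \<omega>. (restrict (\<lambda>i. \<Xi> i \<omega>) {Suc k}) (Suc k)) UNIV"
      by (rule indep_vars_compose2[where Y = "\<lambda>k x. x (Suc k)"]) measurable
    then show "indep_vars (\<lambda>_. borel) (\<lambda>k. \<Xi> (Suc k)) UNIV" by simp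
    fix m
    define G where "G = (\<Union>k\<in>{m..}. {\<Xi> (Suc k) -` S \<inter> space P | S. S \<in> sets borel})"
    define T where "T = sigma (space P) G"
    have pow: "G \<subseteq> Pow (space P)" unfolding G_def by auto
    have T\<Xi>: "\<Xi> k \<in> T \<rightarrow>\<^sub>M borel" if "m < k" for k
    proof (rule measurableI)
      fix S :: "(real^'d^'d) set" assume "S \<in> sets borel"
      moreover have "k = Suc (k - 1)" "m \<le> k - 1" using that by auto
      ultimately have "\<Xi> k -` S \<inter> space P \<in> G" unfolding G_def by (metis (mono_tags, lifting) UN_I atLeast_iff mem_Collect_eq)
      then show "\<Xi> k -` S \<inter> space T \<in> sets T"
        unfolding T_def using pow by (simp add: sets_measure_of space_measure_of sigma_sets.Basic)
    qed simp
    \<comment> \<open>Erasing the first \<open>m\<close> factors keeps the \<open>liminf\<close> and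
      leaves a function of the noise with index above \<open>m\<close>.\<close>
    define C where "C \<omega> k = (if k \<le> m then mat 1 else B k (\<Xi> k \<omega>))" for \<omega> k
    have "L \<omega> = lim (C \<omega>)" for \<omega>
      unfolding L_def lim_def
      by (rule liminf_log_gap_tail[OF j, where m = m]) (auto simp: C_def invB invertible_def[of "mat 1"])
    then have L_eq: "L = (\<lambda>\<omega>. lim (C \<omega>))" by auto
    have "(\<lambda>\<omega>. C \<omega> k) \<in> borel_measurable T" for k
    proof (cases "k \<le> m")
      case False
      then show ?thesis using measurable_compose[OF T\<Xi>, of k "B k" borel] by (simp add: C_def)
    qed (simp add: C_def)
    then have [measurable]: "(\<lambda>\<omega>. matrix_product (C \<omega>) n) \<in> borel_measurable T" for n
      by (rule matrix_product_measurable)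
    note [measurable] = measurable_log_gap[OF j]
    show "L \<in> borel_measurable T" unfolding L_eq lim_def by measurable
  qed
  then obtain \<kappa> where "AE \<omega> in P. L \<omega> = \<kappa>" by blast
  moreover have "AE \<omega> in P. \<forall>n\<ge>1. invertible (A n + \<epsilon> *\<^sub>R \<Xi> n \<omega>)" by (rule AE_perturbed_invertible[OF iid \<epsilon>])
  ultimately have "AE \<omega> in P. liminf (\<lambda>n. ereal (1 / real n * log_gap j (perturbed_product A \<epsilon> (\<lambda>k. \<Xi> k \<omega>) n))) = \<kappa>"
  proof eventually_elim
    case (elim \<omega>)
    have "matrix_product (\<lambda>k. B k (\<Xi> k \<omega>)) n = perturbed_product A \<epsilon> (\<lambda>k. \<Xi> k \<omega>) n" for n
      unfolding perturbed_product_def using elim(2) by (intro matrix_product_cong) (simp add: B_def)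
    then show ?case using elim(1) by (simp add: L_def lim_def)
  qed
  then show ?thesis by blast
qed

theorem theorem5:
  fixes \<epsilon> :: real
  assumes "CARD('d::finite) \<ge> 2" and "0 < \<epsilon>" and "\<epsilon> < 1"
  shows "\<exists>c>0. \<forall>(P :: 'w measure) (\<Xi> :: nat \<Rightarrow> 'w \<Rightarrow> real^'d^'d). iid_uniform_matrices P \<Xi> \<longrightarrow>
    (\<forall>A :: nat \<Rightarrow> real^'d^'d. (\<forall>n\<ge>1. onorm ((*v) (A n)) \<le> 1) \<longrightarrow>
      (\<forall>j\<in>{1..CARD('d) - 1}. \<exists>\<kappa>. ereal c \<le> \<kappa> \<and>
        (AE \<omega> in P. liminf (\<lambda>n. ereal (1 / real n *
            ln (singular_value j (perturbed_product A \<epsilon> (\<lambda>k. \<Xi> k \<omega>) n) /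
                singular_value (j + 1) (perturbed_product A \<epsilon> (\<lambda>k. \<Xi> k \<omega>) n)))) = \<kappa>)))"
proof -
  obtain \<rho> B where \<rho>: "0 < \<rho>" "\<rho> < 1" and B: "0 < B" and
    decay: "\<And>(I :: 'd set) p q A n Z. partial_flag I p q \<Longrightarrow> (\<And>n i j. 1 \<le> n \<Longrightarrow> \<bar>A n $ i $ j\<bar> \<le> 1) \<Longrightarrow>
       partial_flag.mass p q (iterated_avg A \<epsilon> n (partial_flag.phi I p q)) Z \<le> ennreal (\<rho> ^ n * B)"
    using iterated_avg_phi_decay[OF assms(2), where ?'d = 'd] by metis
  obtain F :: "(real^'d^'d) set" where F: "finite F"
    "\<And>K. orthogonal_matrix K \<Longrightarrow> \<exists>X\<in>F. \<forall>x. norm (X *v x - K *v x) \<le> norm x / 2"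
    using finite_orthogonal_net by blast
  obtain e :: "nat \<Rightarrow> 'd" where e: "bij_betw e {..<CARD('d)} UNIV" using ex_enumeration by blast
  \<comment> \<open>One square root comes from passing from the squared norm to the integral over
    slopes, the other from the Markov threshold. The resulting constant
    \<open>2 * ln (1 / q)\<close> equals \<open>ln (1 / \<rho>) / 2\<close> and is fixed before
    \<open>P\<close>, \<open>\<Xi>\<close>, \<open>A\<close> and \<open>j\<close>.\<close>
  define q where "q = sqrt (sqrt \<rho>)"
  have q: "0 < q" "q < 1" using \<rho> by (auto simp: q_def)
  show ?thesis
  proof (intro exI[of _ "2 * ln (1 / q)"] conjI allI impI ballI)
    show "0 < 2 * ln (1 / q)" using q by simp
    fix P :: "'w measure" and \<Xi> :: "nat \<Rightarrow> 'w \<Rightarrow> real^'d^'d" and A :: "nat \<Rightarrow> real^'d^'d" and j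
    assume iid: "iid_uniform_matrices P \<Xi>" and A: "\<forall>n\<ge>1. onorm ((*v) (A n)) \<le> 1" and j: "j \<in> {1..CARD('d) - 1}"
    interpret prob_space P by (rule iid_uniform_matricesD(1)[OF iid])
    \<comment> \<open>The contraction is formulated with a bound on the entries, which the operator
      norm dominates.\<close>
    have A1: "\<bar>A n $ i $ l\<bar> \<le> 1" if "1 \<le> n" for n i l
      using A that matrix_component_le_onorm[of "A n" i l] by (meson order_trans)
    have j': "1 \<le> j" "j < CARD('d)" using j by auto
    then obtain k where k: "j = Suc k" "Suc k < CARD('d)" by (cases j) auto
    let ?N = "\<lambda>n \<omega>. perturbed_product A \<epsilon> (\<lambda>k. \<Xi> k \<omega>) n"
    note [measurable] = perturbed_product_measurable[OF iid]
    have [measurable]: "(singular_value (Suc k) :: real^'d^'d \<Rightarrow> real) \<in> borel_measurable borel"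
      "(singular_value (Suc (Suc k)) :: real^'d^'d \<Rightarrow> real) \<in> borel_measurable borel"
      by (rule measurable_singular_value, use k in simp)+
    have "AE \<omega> in P. \<forall>\<^sub>F n in sequentially.
        ennreal (sqrt (singular_value (Suc (Suc k)) (?N n \<omega>) / singular_value (Suc k) (?N n \<omega>))) \<le> ennreal (q ^ n)"
      unfolding q_def
    proof (rule AE_eventually_le_geometric)
      show "(\<integral>\<^sup>+\<omega>. ennreal (sqrt (singular_value (Suc (Suc k)) (?N n \<omega>) / singular_value (Suc k) (?N n \<omega>))) \<partial>P)
          \<le> ennreal (real (card F) * 12 * sqrt B * sqrt \<rho> ^ n)" for n
        by (rule expectation_ratio_le[OF iid e k(2) _ _ \<rho>(1) decay[OF _ A1] F]) (use assms B in auto)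
    qed (use \<rho> B in auto)
    moreover have "AE \<omega> in P. \<forall>n\<ge>1. invertible (A n + \<epsilon> *\<^sub>R \<Xi> n \<omega>)"
      by (rule AE_perturbed_invertible[OF iid]) (use assms in simp)
    ultimately have ge: "AE \<omega> in P. ereal (2 * ln (1 / q)) \<le> liminf (\<lambda>n. ereal (1 / real n * log_gap j (?N n \<omega>)))"
    proof eventually_elim
      case (elim \<omega>)
      have "invertible (?N n \<omega>)" for n
        unfolding perturbed_product_def using elim(2) by (intro invertible_matrix_product) auto
      then show ?case unfolding k(1) using liminf_log_gap_ge[OF k(2) _ q elim(1)] by blast
    qed
    obtain \<kappa> where \<kappa>: "AE \<omega> in P. liminf (\<lambda>n. ereal (1 / real n * log_gap j (?N n \<omega>))) = \<kappa>"
      using liminf_log_gap_AE_const[OF iid j', of \<epsilon> A] assms(2) by auto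
    have "AE \<omega> in P. ereal (2 * ln (1 / q)) \<le> \<kappa>" using ge \<kappa> by eventually_elim simp
    then have "ereal (2 * ln (1 / q)) \<le> \<kappa>" by simp
    then show "\<exists>\<kappa>. ereal (2 * ln (1 / q)) \<le> \<kappa> \<and>
        (AE \<omega> in P. liminf (\<lambda>n. ereal (1 / real n *
            ln (singular_value j (?N n \<omega>) / singular_value (j + 1) (?N n \<omega>)))) = \<kappa>)"
      using \<kappa> by (auto simp: log_gap_def)
  qed
qed

end
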